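(* Let $S\subset\mathbb{R}^3$ be a complete, connected, orientable smooth immersed PGF surface. Then $S$ has a global parameterization $\mathbf{x}:\mathbb{R}^2\to S$ of the form $$\mathbf{x}(u,v)=\mathbf{r}(v)+x(u)\,\mathbf{q}_1(v)+y(u)\,\mathbf{q}_2(v),$$ where $\mathbf{r}:\mathbb{R}\to\mathbb{R}^3$ is a regular curve with rotation minimizing frame $(\mathbf{t},\mathbf{q}_1,\mathbf{q}_2)$, $(x(u),y(u))$ is a unit-speed plane curve, and the curves $v=\text{const}$ are the leaves of the planar geodesic foliation. This parameterization is a covering map $\mathbb{R}^2\to S$, and $(u,v)$ are curvature line coordinates.
   Context: A planar geodesic foliation of an immersed surface $S\subset\mathbb{R}^3$ is a $1$-dimensional foliation of $S$ whose leaves are planar geodesic curves of $S$, with the additional property that along each leaf the unit normal of the surface is parallel to the plane containing that leaf (for a straight-line leaf: the normal is constant along the line). A PGF surface is a surface together with such a foliation. Complete means complete with respect to the induced Riemannian metric. For a regular curve $\mathbf{r}$ with unit tangent $\mathbf{t}$, a rotation minimizing frame is an orthonormal frame field $(\mathbf{t},\mathbf{q}_1,\mathbf{q}_2)$ along $\mathbf{r}$ with $\mathbf{q}_1',\mathbf{q}_2'$ everywhere parallel to $\mathbf{t}$. *)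

theory Defs
  imports "HOL-Analysis.Analysis"
begin

primrec Ck :: "nat \<Rightarrow> 'a::euclidean_space set \<Rightarrow> ('a \<Rightarrow> 'b::euclidean_space) \<Rightarrow> bool" where
  "Ck 0 S f = continuous_on S f"
| "Ck (Suc n) S f = (f differentiable_on S \<and>
      (\<forall>b\<in>Basis. Ck n S (\<lambda>x. frechet_derivative f (at x) b)))"

definition smooth_on :: "'a::euclidean_space set \<Rightarrow> ('a \<Rightarrow> 'b::euclidean_space) \<Rightarrow> bool" where
  "smooth_on S f \<longleftrightarrow> open S \<and> (\<forall>n. Ck n S f)"

definition pd1 :: "(real \<times> real \<Rightarrow> 'b::real_normed_vector) \<Rightarrow> real \<times> real \<Rightarrow> 'b" where
  "pd1 X p = frechet_derivative X (at p) (1, 0)"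

definition pd2 :: "(real \<times> real \<Rightarrow> 'b::real_normed_vector) \<Rightarrow> real \<times> real \<Rightarrow> 'b" where
  "pd2 X p = frechet_derivative X (at p) (0, 1)"

definition d1 :: "(real \<Rightarrow> 'b::real_normed_vector) \<Rightarrow> real \<Rightarrow> 'b" where
  "d1 g t = vector_derivative g (at t)"

text \<open>The abstract surface is the type 'm (a Hausdorff, second countable space);
  f is the immersion into R^3.  A local parametrization is a homeomorphism psi from an open
  W in R^2 onto an open subset of the surface such that f o psi is a smooth regular
  parametrized surface.  (The smooth structure of the surface is the one making f an
  immersion; it is determined by f.)\<close>

definition local_param :: "('m::topological_space \<Rightarrow> real^3) \<Rightarrow> (real \<times> real) set
    \<Rightarrow> (real \<times> real \<Rightarrow> 'm) \<Rightarrow> bool" where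
  "local_param f W \<psi> \<longleftrightarrow> open W \<and> open (\<psi> ` W) \<and>
     (\<exists>g. homeomorphism W (\<psi> ` W) \<psi> g) \<and>
     smooth_on W (f \<circ> \<psi>) \<and>
     (\<forall>w\<in>W. cross3 (pd1 (f \<circ> \<psi>) w) (pd2 (f \<circ> \<psi>) w) \<noteq> 0)"

definition immersed_surface :: "('m::topological_space \<Rightarrow> real^3) \<Rightarrow> bool" where
  "immersed_surface f \<longleftrightarrow> (\<forall>p. \<exists>W \<psi>. local_param f W \<psi> \<and> p \<in> \<psi> ` W)"

definition unit_normal :: "('m::topological_space \<Rightarrow> real^3) \<Rightarrow> ('m \<Rightarrow> real^3) \<Rightarrow> bool" where
  "unit_normal f N \<longleftrightarrow> continuous_on UNIV N \<and> (\<forall>p. norm (N p) = 1) \<and>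
     (\<forall>W \<psi> w. local_param f W \<psi> \<and> w \<in> W \<longrightarrow>
        N (\<psi> w) \<bullet> pd1 (f \<circ> \<psi>) w = 0 \<and> N (\<psi> w) \<bullet> pd2 (f \<circ> \<psi>) w = 0)"

definition orientable :: "('m::topological_space \<Rightarrow> real^3) \<Rightarrow> bool" where
  "orientable f \<longleftrightarrow> (\<exists>N. unit_normal f N)"

definition curve_length :: "(real \<Rightarrow> 'b::real_normed_vector) \<Rightarrow> real \<Rightarrow> real \<Rightarrow> ereal" where
  "curve_length g a b =
     (SUP ts \<in> {ts. ts \<noteq> [] \<and> sorted ts \<and> hd ts = a \<and> last ts = b}.
        ereal (\<Sum>i < length ts - 1. norm (g (ts ! Suc i) - g (ts ! i))))"

definition idist :: "('m::topological_space \<Rightarrow> real^3) \<Rightarrow> 'm \<Rightarrow> 'm \<Rightarrow> ereal" where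
  "idist f p q = (INF \<gamma> \<in> {\<gamma>. continuous_on {0..1} \<gamma> \<and> \<gamma> 0 = p \<and> \<gamma> 1 = q}.
                    curve_length (f \<circ> \<gamma>) 0 1)"

definition complete_surface :: "('m::topological_space \<Rightarrow> real^3) \<Rightarrow> bool" where
  "complete_surface f \<longleftrightarrow>
     (\<forall>s :: nat \<Rightarrow> 'm.
        (\<forall>e>0. \<exists>K. \<forall>m\<ge>K. \<forall>n\<ge>K. idist f (s m) (s n) < ereal e) \<longrightarrow>
        (\<exists>l. s \<longlonglongrightarrow> l))"

definition foliated_chart :: "('m::topological_space \<Rightarrow> real^3) \<Rightarrow> 'm set set
    \<Rightarrow> real \<Rightarrow> real \<Rightarrow> real \<Rightarrow> real \<Rightarrow> (real \<times> real \<Rightarrow> 'm) \<Rightarrow> bool" where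
  "foliated_chart f F a b c d \<psi> \<longleftrightarrow>
     a < b \<and> c < d \<and> local_param f ({a<..<b} \<times> {c<..<d}) \<psi> \<and>
     (\<forall>v\<in>{c<..<d}. \<exists>L\<in>F. \<psi> ` ({a<..<b} \<times> {v}) \<subseteq> L)"

definition plaque :: "('m::topological_space \<Rightarrow> real^3) \<Rightarrow> 'm set set \<Rightarrow> 'm set \<Rightarrow> bool" where
  "plaque f F P \<longleftrightarrow> (\<exists>a b c d \<psi> v. foliated_chart f F a b c d \<psi> \<and> v \<in> {c<..<d} \<and>
                         P = \<psi> ` ({a<..<b} \<times> {v}))"

text \<open>A 1-dimensional (smooth) foliation: a partition of the surface covered by foliated
  charts, whose leaves are plaque-chain connected (i.e. connected in the leaf topology).\<close>
definition foliation :: "('m::topological_space \<Rightarrow> real^3) \<Rightarrow> 'm set set \<Rightarrow> bool" where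
  "foliation f F \<longleftrightarrow>
     (\<forall>L\<in>F. L \<noteq> {}) \<and> pairwise disjnt F \<and> \<Union>F = UNIV \<and>
     (\<forall>p. \<exists>a b c d \<psi>. foliated_chart f F a b c d \<psi> \<and> p \<in> \<psi> ` ({a<..<b} \<times> {c<..<d})) \<and>
     (\<forall>L\<in>F. \<forall>x\<in>L. \<forall>y\<in>L. \<exists>Ps. Ps \<noteq> [] \<and> (\<forall>P\<in>set Ps. plaque f F P) \<and>
          x \<in> hd Ps \<and> y \<in> last Ps \<and>
          (\<forall>i < length Ps - 1. Ps ! i \<inter> Ps ! Suc i \<noteq> {}))"

text \<open>Planar geodesic foliation: each leaf lies in an affine plane (through p0 with normal n)
  to which the surface normal is parallel along the leaf, and each leaf is a geodesic
  (acceleration in the span of velocity and surface normal, checked on all plaques).\<close>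
definition planar_geodesic_foliation :: "('m::topological_space \<Rightarrow> real^3) \<Rightarrow> 'm set set \<Rightarrow> bool" where
  "planar_geodesic_foliation f F \<longleftrightarrow> foliation f F \<and>
     (\<forall>L\<in>F. \<exists>p0 n. n \<noteq> 0 \<and>
        (\<forall>q\<in>L. (f q - p0) \<bullet> n = 0) \<and>
        (\<forall>W \<psi> w. local_param f W \<psi> \<and> w \<in> W \<and> \<psi> w \<in> L \<longrightarrow>
            cross3 (pd1 (f \<circ> \<psi>) w) (pd2 (f \<circ> \<psi>) w) \<bullet> n = 0)) \<and>
     (\<forall>a b c d \<psi> w. foliated_chart f F a b c d \<psi> \<and> w \<in> {a<..<b} \<times> {c<..<d} \<longrightarrow>
        pd1 (pd1 (f \<circ> \<psi>)) w \<in>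
          span {pd1 (f \<circ> \<psi>) w, cross3 (pd1 (f \<circ> \<psi>) w) (pd2 (f \<circ> \<psi>) w)})"

definition regular_curve :: "(real \<Rightarrow> real^3) \<Rightarrow> bool" where
  "regular_curve r \<longleftrightarrow> smooth_on UNIV r \<and> (\<forall>v. d1 r v \<noteq> 0)"

definition unit_tangent :: "(real \<Rightarrow> real^3) \<Rightarrow> real \<Rightarrow> real^3" where
  "unit_tangent r v = (1 / norm (d1 r v)) *\<^sub>R d1 r v"

definition rotation_minimizing_frame :: "(real \<Rightarrow> real^3) \<Rightarrow> (real \<Rightarrow> real^3) \<Rightarrow> (real \<Rightarrow> real^3) \<Rightarrow> bool" where
  "rotation_minimizing_frame r q1 q2 \<longleftrightarrow>
     smooth_on UNIV q1 \<and> smooth_on UNIV q2 \<and>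
     (\<forall>v. norm (q1 v) = 1 \<and> norm (q2 v) = 1 \<and> q1 v \<bullet> q2 v = 0 \<and>
          unit_tangent r v \<bullet> q1 v = 0 \<and> unit_tangent r v \<bullet> q2 v = 0 \<and>
          (\<exists>k1. d1 q1 v = k1 *\<^sub>R unit_tangent r v) \<and>
          (\<exists>k2. d1 q2 v = k2 *\<^sub>R unit_tangent r v))"

definition unit_speed_plane_curve :: "(real \<Rightarrow> real) \<Rightarrow> (real \<Rightarrow> real) \<Rightarrow> bool" where
  "unit_speed_plane_curve x y \<longleftrightarrow> smooth_on UNIV x \<and> smooth_on UNIV y \<and>
     (\<forall>u. (d1 x u)\<^sup>2 + (d1 y u)\<^sup>2 = 1)"

text \<open>(u,v) are curvature line coordinates for the parametrized surface X: X is a smooth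
  regular parametrization with F = X_u . X_v = 0 and M = X_uv . (X_u x X_v) = 0.\<close>
definition curvature_line_coordinates :: "(real \<times> real \<Rightarrow> real^3) \<Rightarrow> bool" where
  "curvature_line_coordinates X \<longleftrightarrow> smooth_on UNIV X \<and>
     (\<forall>w. cross3 (pd1 X w) (pd2 X w) \<noteq> 0 \<and>
          pd1 X w \<bullet> pd2 X w = 0 \<and>
          pd2 (pd1 X) w \<bullet> cross3 (pd1 X w) (pd2 X w) = 0)"

end

theory Submission
  imports Defs
begin

text \<open>Along a leaf the unit normal \<open>e\<close> of its plane is constant and tangent to the surface. Expanding a foliated
  chart in a rotation minimizing frame of \<open>e\<close>, all its leaves become the same plane curve, because the coordinates in
  the normal planes of \<open>e\<close> have rank one; this is the asserted parameterization, locally. By completeness the leaves and the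
  trajectories of \<open>e\<close> run for all time, where \<open>e\<close> is defined only up to sign and is therefore carried along
  with each curve. The local form shows that flowing along the leaves takes trajectories to reparametrized
  trajectories. Hence the leaves through one trajectory are all given by the same plane curve in its frame, and flowing the
  trajectories of a small box back to it gives sections of the resulting map through every preimage: it is a covering.\<close>

section \<open>Smooth maps between Euclidean spaces\<close>

text \<open>The surface is a bare topological space with an immersion, so a curve in it is
  differentiated through its image under \<open>f\<close>, and the derivative of its box coordinates
  is recovered from there. No existence theorem for differential equations enters: in a box, leaf
  curves are horizontal segments and the trajectory through the centre is vertical. This gives local
  existence, uniqueness and continuation past an end point; completeness supplies the end point.
  Only the base trajectory has unit speed. At height \<open>u\<close> the speed is
  \<open>g u\<close>, and its antiderivative is the time change that relates two trajectories across
  a family of leaves. That \<open>X\<close> is a covering and not only a local homeomorphism rests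
  on a uniformity: a box around a point of the surface is lifted as a whole through each of its
  preimages, because both flows are defined for all time, so the size of the evenly covered set does
  not depend on the preimage. A curve may return to a box, possibly with the opposite direction;
  hence the signs \<open>\<sigma>\<close> throughout.\<close>

lemma Ck_Suc_derivative:
  fixes f :: "'a::euclidean_space \<Rightarrow> 'b::euclidean_space"
  assumes "open S" and "\<And>x. x \<in> S \<Longrightarrow> (f has_derivative f' x) (at x)"
  shows "Ck (Suc n) S f \<longleftrightarrow> (\<forall>b\<in>Basis. Ck n S (\<lambda>x. frechet_derivative f (at x) b))"
  using assms by (auto simp: differentiable_on_def differentiable_def intro: has_derivative_at_withinI)

lemma Ck_differentiable: "Ck (Suc n) S f \<Longrightarrow> open S \<Longrightarrow> x \<in> S \<Longrightarrow> f differentiable at x"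
  by (auto simp: differentiable_on_eq_differentiable_at)

lemma Ck_has_derivative:
  "Ck (Suc n) S f \<Longrightarrow> open S \<Longrightarrow> x \<in> S \<Longrightarrow> (f has_derivative frechet_derivative f (at x)) (at x)"
  using Ck_differentiable frechet_derivative_works by blast

lemma frechet_derivative_cong_open:
  assumes "open S" "x \<in> S" "\<And>x. x \<in> S \<Longrightarrow> f x = g x"
  shows "frechet_derivative f (at x) = frechet_derivative g (at x)"
proof -
  have "(f has_derivative D) (at x) \<longleftrightarrow> (g has_derivative D) (at x)" for D
    using assms has_derivative_transform_within_open by metis
  then show ?thesis
    by (simp add: frechet_derivative_def)
qed

lemma Ck_cong:
  assumes "open S" "\<And>x. x \<in> S \<Longrightarrow> f x = g x"
  shows "Ck n S f \<longleftrightarrow> Ck n S g"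
  using assms(2)
proof (induction n arbitrary: f g)
  case 0
  then show ?case by (simp cong: continuous_on_cong)
next
  case (Suc n)
  have d: "f differentiable_on S \<longleftrightarrow> g differentiable_on S"
    using Suc.prems unfolding differentiable_on_def
    by (metis differentiable_transform_within zero_less_one)
  have fd: "frechet_derivative f (at x) = frechet_derivative g (at x)" if "x \<in> S" for x
    by (rule frechet_derivative_cong_open[OF assms(1) that Suc.prems])
  have "Ck n S (\<lambda>x. frechet_derivative f (at x) b) \<longleftrightarrow> Ck n S (\<lambda>x. frechet_derivative g (at x) b)" for b
    by (rule Suc.IH) (simp add: fd)
  then show ?case using d by simp
qed

text \<open>\<open>Ck\<close> is phrased with the operator \<open>frechet_derivative\<close>; this
  rule lets the later inductions supply an explicit derivative instead.\<close>

lemma Ck_SucI: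
  fixes f :: "'a::euclidean_space \<Rightarrow> 'b::euclidean_space"
  assumes "open S" "\<And>x. x \<in> S \<Longrightarrow> (f has_derivative f' x) (at x)"
    and "\<And>b. b \<in> Basis \<Longrightarrow> Ck n S (\<lambda>x. f' x b)"
  shows "Ck (Suc n) S f"
proof -
  have "frechet_derivative f (at x) b = f' x b" if "x \<in> S" for x b
    using assms(2)[OF that] frechet_derivative_at by metis
  then have "Ck n S (\<lambda>x. frechet_derivative f (at x) b)" if "b \<in> Basis" for b
    using assms(3)[OF that] Ck_cong[OF assms(1)] by (smt (verit, best))
  then show ?thesis
    using Ck_Suc_derivative[OF assms(1,2)] by blast
qed

lemma Ck_continuous: "Ck n S f \<Longrightarrow> continuous_on S f"
  by (cases n) (auto simp: differentiable_imp_continuous_on)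

lemma Ck_mono_set: "Ck n S f \<Longrightarrow> T \<subseteq> S \<Longrightarrow> Ck n T f"
  by (induction n arbitrary: f) (auto intro: continuous_on_subset differentiable_on_subset)

lemma Ck_SucD: "Ck (Suc n) S f \<Longrightarrow> Ck n S f"
proof (induction n arbitrary: f)
  case 0
  then show ?case using Ck_continuous by fastforce
next
  case (Suc n)
  then show ?case by simp
qed

declare Ck.simps(2) [simp del]

lemma Ck_locally:
  assumes "open S" "\<And>x. x \<in> S \<Longrightarrow> \<exists>T. open T \<and> x \<in> T \<and> Ck n T f"
  shows "Ck n S f"
  using assms(2)
proof (induction n arbitrary: f)
  case 0
  then show ?case
    by (metis Ck.simps(1) continuous_at_imp_continuous_on continuous_on_eq_continuous_at)
next
  case (Suc n)
  have "f differentiable at x" if "x \<in> S" for x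
    using Suc.prems[OF that] Ck_differentiable by blast
  moreover have "Ck n S (\<lambda>x. frechet_derivative f (at x) b)" if "b \<in> Basis" for b
    by (rule Suc.IH) (use Suc.prems that Ck.simps(2) in metis)
  ultimately show ?case
    by (simp add: Ck.simps(2) differentiable_at_imp_differentiable_on)
qed

lemma Ck_const: "open S \<Longrightarrow> Ck n S (\<lambda>x::'a::euclidean_space. c::'b::euclidean_space)"
proof (induction n arbitrary: c)
  case (Suc n)
  show ?case
    by (rule Ck_SucI[where f' = "\<lambda>x h. 0"]) (use Suc in auto)
qed simp

lemma Ck_add:
  assumes "open S" "Ck n S f" "Ck n S g"
  shows "Ck n S (\<lambda>x. f x + g x)"
  using assms(2,3)
proof (induction n arbitrary: f g)
  case 0
  then show ?case by (auto intro: continuous_intros)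
next
  case (Suc n)
  show ?case
  proof (rule Ck_SucI[OF assms(1)])
    show "((\<lambda>x. f x + g x) has_derivative (\<lambda>h. frechet_derivative f (at x) h + frechet_derivative g (at x) h)) (at x)"
      if "x \<in> S" for x
      by (rule has_derivative_add[OF Ck_has_derivative[OF Suc.prems(1) assms(1) that] Ck_has_derivative[OF Suc.prems(2) assms(1) that]])
    show "Ck n S (\<lambda>x. frechet_derivative f (at x) b + frechet_derivative g (at x) b)" if "b \<in> Basis" for b
      by (rule Suc.IH) (use Suc.prems that in \<open>auto simp: Ck.simps(2)\<close>)
  qed
qed

lemma Ck_sum:
  assumes "open S" "finite I" "\<And>i. i \<in> I \<Longrightarrow> Ck n S (f i)"
  shows "Ck n S (\<lambda>x. \<Sum>i\<in>I. f i x)"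
  using assms(2,3) by (induction I rule: finite_induct) (auto intro: Ck_const Ck_add assms(1))

text \<open>Scalar, inner and cross products in one induction: the product rule gives two terms of
  the same shape with one factor differentiated, so the induction must be general in
  \<open>f\<close> and \<open>g\<close>.\<close>

lemma Ck_bilinear:
  fixes f :: "'a::euclidean_space \<Rightarrow> 'b::euclidean_space" and g :: "'a \<Rightarrow> 'c::euclidean_space"
  assumes "bounded_bilinear B" "open S" "Ck n S f" "Ck n S g"
  shows "Ck n S (\<lambda>x. B (f x) (g x) :: 'd::euclidean_space)"
  using assms(3,4)
proof (induction n arbitrary: f g)
  case 0
  then show ?case using bounded_bilinear.continuous_on[OF assms(1)] by auto
next
  case (Suc n)
  show ?case
  proof (rule Ck_SucI[OF assms(2)])
    show "((\<lambda>x. B (f x) (g x)) has_derivative (\<lambda>h. B (f x) (frechet_derivative g (at x) h) + B (frechet_derivative f (at x) h) (g x))) (at x)"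
      if "x \<in> S" for x
      by (rule bounded_bilinear.FDERIV[OF assms(1) Ck_has_derivative[OF Suc.prems(1) assms(2) that] Ck_has_derivative[OF Suc.prems(2) assms(2) that]])
    show "Ck n S (\<lambda>x. B (f x) (frechet_derivative g (at x) b) + B (frechet_derivative f (at x) b) (g x))"
      if "b \<in> Basis" for b
      by (intro Ck_add[OF assms(2)] Suc.IH) (use Suc.prems that Ck_SucD in \<open>auto simp: Ck.simps(2)\<close>)
  qed
qed

lemma Ck_linear:
  assumes "bounded_linear L" "open S" "Ck n S f"
  shows "Ck n S (\<lambda>x. L (f x) :: 'd::euclidean_space)"
  using assms(3)
proof (induction n arbitrary: f)
  case 0
  then show ?case using bounded_linear.continuous_on[OF assms(1)] by auto
next
  case (Suc n)
  show ?case
    by (rule Ck_SucI[OF assms(2), where f' = "\<lambda>x h. L (frechet_derivative f (at x) h)"])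
      (use Suc Ck_has_derivative[OF _ assms(2)] in \<open>auto intro!: bounded_linear.has_derivative[OF assms(1)] simp: Ck.simps(2)\<close>)
qed

text \<open>Differentiating in a basis direction gives a fixed linear combination of the partials of
  \<open>g\<close>, composed with the same affine map, so the induction closes. This serves slices,
  projections, translations and reflections.\<close>

lemma Ck_affine_compose:
  fixes g :: "'b::euclidean_space \<Rightarrow> 'c::euclidean_space" and L :: "'a::euclidean_space \<Rightarrow> 'b"
  assumes L: "bounded_linear L" and "open S" "open T" "Ck n T g" "\<And>x. x \<in> S \<Longrightarrow> c + L x \<in> T"
  shows "Ck n S (\<lambda>x. g (c + L x))"
  using assms(4)
proof (induction n arbitrary: g)
  case 0
  have "continuous_on S (\<lambda>x. c + L x)"
    using linear_continuous_on[OF L] by (auto intro!: continuous_intros)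
  then show ?case using 0 assms(5) by (auto intro!: continuous_on_compose2[of T g])
next
  case (Suc n)
  show ?case
  proof (rule Ck_SucI[OF assms(2)])
    fix x assume x: "x \<in> S"
    have "((\<lambda>x. c + L x) has_derivative L) (at x)"
      using bounded_linear_imp_has_derivative[OF L] by (auto intro!: derivative_eq_intros)
    from diff_chain_at[OF this Ck_has_derivative[OF Suc.prems assms(3) assms(5)[OF x]]]
    show "((\<lambda>x. g (c + L x)) has_derivative (\<lambda>h. frechet_derivative g (at (c + L x)) (L h))) (at x)"
      by (simp add: o_def)
  next
    fix b :: 'a assume "b \<in> Basis"
    let ?g' = "\<lambda>i y. frechet_derivative g (at y) i"
    have h: "Ck n S (\<lambda>x. (L b \<bullet> i) *\<^sub>R ?g' i (c + L x))" if "i \<in> Basis" for i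
      by (rule Ck_linear[OF bounded_linear_scaleR_right assms(2) Suc.IH]) (use Suc.prems that in \<open>auto simp: Ck.simps(2)\<close>)
    have "Ck n S (\<lambda>x. \<Sum>i\<in>Basis. (L b \<bullet> i) *\<^sub>R ?g' i (c + L x))"
      by (rule Ck_sum[OF assms(2) finite_Basis h])
    moreover have "(\<Sum>i\<in>Basis. (L b \<bullet> i) *\<^sub>R ?g' i (c + L x)) = frechet_derivative g (at (c + L x)) (L b)" if "x \<in> S" for x
    proof -
      have "linear (frechet_derivative g (at (c + L x)))"
        using Ck_has_derivative[OF Suc.prems assms(3) assms(5)[OF that]] has_derivative_linear by blast
      then have "frechet_derivative g (at (c + L x)) (\<Sum>i\<in>Basis. (L b \<bullet> i) *\<^sub>R i) = (\<Sum>i\<in>Basis. (L b \<bullet> i) *\<^sub>R ?g' i (c + L x))"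
        by (simp add: linear_sum linear_scale)
      then show ?thesis by (simp add: euclidean_representation)
    qed
    ultimately show "Ck n S (\<lambda>x. frechet_derivative g (at (c + L x)) (L b))"
      using Ck_cong[OF assms(2)] by (smt (verit, best))
  qed
qed

lemma smooth_onD: "smooth_on S f \<Longrightarrow> Ck n S f" "smooth_on S f \<Longrightarrow> open S"
  by (simp_all add: smooth_on_def)

lemma smooth_on_cong: "smooth_on S f \<Longrightarrow> (\<And>x. x \<in> S \<Longrightarrow> f x = g x) \<Longrightarrow> smooth_on S g"
  using Ck_cong unfolding smooth_on_def by metis

lemma smooth_on_subset: "smooth_on S f \<Longrightarrow> open T \<Longrightarrow> T \<subseteq> S \<Longrightarrow> smooth_on T f"
  using Ck_mono_set unfolding smooth_on_def by blast

lemma smooth_on_locally: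
  assumes "\<And>x. x \<in> S \<Longrightarrow> \<exists>T. open T \<and> x \<in> T \<and> smooth_on T f" "open S"
  shows "smooth_on S f"
  unfolding smooth_on_def using assms Ck_locally[OF assms(2)] smooth_onD(1) by metis

lemma smooth_on_const: "open S \<Longrightarrow> smooth_on S (\<lambda>x. c)"
  by (simp add: smooth_on_def Ck_const)

lemma smooth_on_add: "smooth_on S f \<Longrightarrow> smooth_on S g \<Longrightarrow> smooth_on S (\<lambda>x. f x + g x)"
  by (simp add: smooth_on_def Ck_add)

lemma smooth_on_linear: "bounded_linear L \<Longrightarrow> smooth_on S f \<Longrightarrow> smooth_on S (\<lambda>x. L (f x))"
  by (simp add: smooth_on_def Ck_linear)

lemma smooth_on_bilinear:
  "bounded_bilinear B \<Longrightarrow> smooth_on S f \<Longrightarrow> smooth_on S g \<Longrightarrow> smooth_on S (\<lambda>x. B (f x) (g x))"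
  by (simp add: smooth_on_def Ck_bilinear)

lemma smooth_on_affine_compose:
  assumes "bounded_linear L" "open S" "smooth_on T g" "\<And>x. x \<in> S \<Longrightarrow> c + L x \<in> T"
  shows "smooth_on S (\<lambda>x. g (c + L x))"
  using assms Ck_affine_compose[OF assms(1,2)] unfolding smooth_on_def by blast

lemmas smooth_on_scaleR = smooth_on_bilinear[OF bounded_bilinear_scaleR]
lemmas smooth_on_inner = smooth_on_bilinear[OF bounded_bilinear_inner]

lemma smooth_on_mult:
  fixes f g :: "'a::euclidean_space \<Rightarrow> real"
  shows "smooth_on S f \<Longrightarrow> smooth_on S g \<Longrightarrow> smooth_on S (\<lambda>x. f x * g x)"
  using smooth_on_bilinear[OF bounded_bilinear_mult] .

lemma smooth_on_minus: "smooth_on S f \<Longrightarrow> smooth_on S (\<lambda>x. - f x)"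
  using smooth_on_linear[OF bounded_linear_minus[OF bounded_linear_ident], of S f] by simp

lemma smooth_on_diff: "smooth_on S f \<Longrightarrow> smooth_on S g \<Longrightarrow> smooth_on S (\<lambda>x. f x - g x)"
  using smooth_on_add[OF _ smooth_on_minus] by fastforce

lemma bounded_bilinear_cross3: "bounded_bilinear cross3"
  using bilinear_conv_bounded_bilinear bilinear_cross by blast

lemmas smooth_on_cross3 = smooth_on_bilinear[OF bounded_bilinear_cross3]

lemma smooth_on_partial:
  assumes "smooth_on S f" "b \<in> Basis"
  shows "smooth_on S (\<lambda>x. frechet_derivative f (at x) b)"
  using assms unfolding smooth_on_def by (metis Ck.simps(2))

lemma smooth_on_has_derivative:
  "smooth_on S f \<Longrightarrow> x \<in> S \<Longrightarrow> (f has_derivative frechet_derivative f (at x)) (at x)"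
  using Ck_has_derivative smooth_onD by blast

lemma smooth_on_imp_continuous_on: "smooth_on S f \<Longrightarrow> continuous_on S f"
  using Ck_continuous smooth_onD(1) by blast

section \<open>Smooth functions of one real variable\<close>

lemma Ck_vector_derivative:
  fixes f :: "real \<Rightarrow> 'b::euclidean_space"
  assumes "open S" "\<And>x. x \<in> S \<Longrightarrow> (f has_vector_derivative f' x) (at x)"
  shows "Ck (Suc n) S f \<longleftrightarrow> Ck n S f'"
proof -
  have d: "(f has_derivative (\<lambda>h. h *\<^sub>R f' x)) (at x)" if "x \<in> S" for x
    using assms(2)[OF that] by (simp add: has_vector_derivative_def)
  then have "frechet_derivative f (at x) 1 = f' x" if "x \<in> S" for x
    using frechet_derivative_at that by (metis scaleR_one)
  then show ?thesis
    using Ck_Suc_derivative[OF assms(1) d] Ck_cong[OF assms(1), of "\<lambda>x. frechet_derivative f (at x) 1" f']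
    by auto
qed

lemma Ck_vector_SucI:
  fixes f :: "real \<Rightarrow> 'b::euclidean_space"
  assumes "open S" "\<And>x. x \<in> S \<Longrightarrow> (f has_vector_derivative f' x) (at x)" "Ck n S f'"
  shows "Ck (Suc n) S f"
  using Ck_vector_derivative[of S f f' n] assms by simp

lemma smooth_on_vector_derivative:
  fixes f :: "real \<Rightarrow> 'b::euclidean_space"
  assumes "open S" "\<And>x. x \<in> S \<Longrightarrow> (f has_vector_derivative f' x) (at x)" "smooth_on S f'"
  shows "smooth_on S f"
  unfolding smooth_on_def using Ck_vector_derivative[OF assms(1,2)] assms(3)
  by (meson assms(1) smooth_onD(1) Ck_SucD)

lemma smooth_on_has_vector_derivative:
  fixes f :: "real \<Rightarrow> 'b::euclidean_space"
  assumes "smooth_on S f" "x \<in> S"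
  shows "(f has_vector_derivative vector_derivative f (at x)) (at x)"
  using smooth_on_has_derivative[OF assms] vector_derivative_works differentiable_def by blast

lemma smooth_on_deriv:
  fixes f :: "real \<Rightarrow> 'b::euclidean_space"
  assumes "smooth_on S f"
  shows "smooth_on S (\<lambda>x. vector_derivative f (at x))"
  unfolding smooth_on_def
  using Ck_vector_derivative[OF smooth_onD(2)[OF assms] smooth_on_has_vector_derivative[OF assms]] assms
  by (metis smooth_on_def)

lemma Ck_real_compose:
  fixes g :: "real \<Rightarrow> 'b::euclidean_space" and f :: "real \<Rightarrow> real"
  assumes "open S" "open T" "\<And>x. x \<in> S \<Longrightarrow> f x \<in> T"
  shows "Ck n S f \<Longrightarrow> Ck n T g \<Longrightarrow> Ck n S (\<lambda>x. g (f x))"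
proof (induction n arbitrary: g)
  case 0
  then show ?case using assms by (auto intro!: continuous_on_compose2[of T g])
next
  case (Suc n)
  let ?f' = "\<lambda>x. vector_derivative f (at x)" and ?g' = "\<lambda>x. vector_derivative g (at x)"
  have g': "(g has_vector_derivative ?g' y) (at y)" if "y \<in> T" for y
    using Ck_differentiable[OF Suc.prems(2) assms(2) that] vector_derivative_works by blast
  have f': "(f has_vector_derivative ?f' x) (at x)" if "x \<in> S" for x
    using Ck_differentiable[OF Suc.prems(1) assms(1) that] vector_derivative_works by blast
  have "((\<lambda>x. g (f x)) has_vector_derivative ?f' x *\<^sub>R ?g' (f x)) (at x)" if "x \<in> S" for x
    using vector_diff_chain_at[OF f'[OF that] g'[OF assms(3)[OF that]]] by (simp add: o_def)
  moreover have "Ck n S ?f'" "Ck n T ?g'"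
    using Ck_vector_derivative[OF assms(2) g'] Ck_vector_derivative[OF assms(1) f'] Suc.prems by blast+
  then have "Ck n S (\<lambda>x. ?f' x *\<^sub>R ?g' (f x))"
    using Ck_bilinear[OF bounded_bilinear_scaleR assms(1), of n ?f' "\<lambda>x. ?g' (f x)"] Suc.IH[of ?g'] Suc.prems(1) Ck_SucD
    by blast
  ultimately show ?case
    by (rule Ck_vector_SucI[OF assms(1)])
qed

lemma smooth_on_real_compose:
  fixes g :: "real \<Rightarrow> 'b::euclidean_space" and f :: "real \<Rightarrow> real"
  assumes "smooth_on T g" "smooth_on S f" "\<And>x. x \<in> S \<Longrightarrow> f x \<in> T"
  shows "smooth_on S (\<lambda>x. g (f x))"
  using Ck_real_compose[of S T f] assms unfolding smooth_on_def by blast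

lemma smooth_on_powr: "smooth_on {0<..} (\<lambda>x::real. x powr r)"
proof -
  \<comment> \<open>Coefficient and exponent vary, so that the family is closed under
    differentiation. The inverse and the trigonometric functions below are treated in the same
    way.\<close>
  have "Ck n {0<..} (\<lambda>x::real. c * x powr r)" for n c
  proof (induction n arbitrary: c r)
    case 0
    show ?case by (auto intro!: continuous_intros)
  next
    case (Suc n)
    have h: "((\<lambda>x. c * x powr r) has_vector_derivative (c * r) * x powr (r - 1)) (at x)" if "x \<in> {0<..}" for x :: real
      unfolding has_real_derivative_iff_has_vector_derivative[symmetric] using that
      by (auto intro!: derivative_eq_intros simp: powr_diff field_simps)
    show ?case by (rule Ck_vector_SucI[OF open_greaterThan h Suc])
  qed
  from this[of _ 1] show ?thesis by (simp add: smooth_on_def)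
qed

lemma smooth_on_inverse: "smooth_on (- {0}) (inverse :: real \<Rightarrow> real)"
proof -
  have "Ck n (- {0}) (\<lambda>x::real. c * inverse x ^ Suc k)" for n c k
  proof (induction n arbitrary: c k)
    case 0
    show ?case by (auto intro!: continuous_intros)
  next
    case (Suc n)
    have h: "((\<lambda>x. c * inverse x ^ Suc k) has_vector_derivative (- c * real (Suc k)) * inverse x ^ Suc (Suc k)) (at x)"
      if "x \<in> - {0}" for x :: real
    proof -
      have "(inverse has_real_derivative - (inverse x * inverse x)) (at x)"
        using DERIV_inverse[of x UNIV] that by (simp add: numeral_2_eq_2)
      from DERIV_cmult[OF DERIV_power[OF this, of "Suc k"], of c] show ?thesis
        unfolding has_real_derivative_iff_has_vector_derivative[symmetric] by (simp add: algebra_simps)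
    qed
    show ?case by (rule Ck_vector_SucI[OF _ h Suc]) (auto simp: open_Compl)
  qed
  from this[of _ 1 0] show ?thesis by (simp add: smooth_on_def open_Compl)
qed

lemma smooth_on_sin_cos: "smooth_on UNIV (sin :: real \<Rightarrow> real)" "smooth_on UNIV (cos :: real \<Rightarrow> real)"
proof -
  have "Ck n UNIV (\<lambda>x::real. a * sin x + b * cos x)" for n a b
  proof (induction n arbitrary: a b)
    case 0
    show ?case by (auto intro!: continuous_intros)
  next
    case (Suc n)
    have h: "((\<lambda>x. a * sin x + b * cos x) has_vector_derivative ((-b) * sin x + a * cos x)) (at x)" for x :: real
      unfolding has_real_derivative_iff_has_vector_derivative[symmetric]
      by (auto intro!: derivative_eq_intros)
    show ?case by (rule Ck_vector_SucI[OF open_UNIV h Suc])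
  qed
  from this[of _ 1 0] this[of _ 0 1] show "smooth_on UNIV (sin :: real \<Rightarrow> real)" "smooth_on UNIV (cos :: real \<Rightarrow> real)"
    by (simp_all add: smooth_on_def)
qed

lemma smooth_on_normalize:
  fixes a :: "real \<Rightarrow> 'b::euclidean_space"
  assumes "smooth_on S a" "\<And>x. x \<in> S \<Longrightarrow> a x \<noteq> 0"
  shows "smooth_on S (\<lambda>x. (1 / norm (a x)) *\<^sub>R a x)"
proof -
  \<comment> \<open>The norm is not smooth at the origin, so its reciprocal is written as a power of
    the positive smooth function \<open>a x \<bullet> a x\<close>.\<close>
  have "smooth_on S (\<lambda>x. (a x \<bullet> a x) powr (-1/2))"
    by (rule smooth_on_real_compose[OF smooth_on_powr smooth_on_inner[OF assms(1,1)]]) (use assms(2) in auto)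
  then have "smooth_on S (\<lambda>x. ((a x \<bullet> a x) powr (-1/2)) *\<^sub>R a x)"
    using smooth_on_scaleR assms(1) by blast
  moreover have "(a x \<bullet> a x) powr (-1/2) = 1 / norm (a x)" for x
    by (simp add: powr_minus powr_half_sqrt norm_eq_sqrt_inner field_simps)
  ultimately show ?thesis by simp
qed

lemma continuous_on_has_antiderivative:
  fixes f :: "real \<Rightarrow> real"
  assumes "continuous_on {a<..<b} f" "x0 \<in> {a<..<b}"
  obtains F where "F x0 = 0" "\<And>x. x \<in> {a<..<b} \<Longrightarrow> (F has_real_derivative f x) (at x)"
proof -
  have "\<exists>F. \<forall>x. ereal a < ereal x \<longrightarrow> ereal x < ereal b \<longrightarrow> (F has_vector_derivative f x) (at x)"
    by (rule einterval_antiderivative) (use assms in \<open>auto simp: continuous_on_eq_continuous_at\<close>)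
  then obtain F where F: "\<And>x. x \<in> {a<..<b} \<Longrightarrow> (F has_vector_derivative f x) (at x)"
    by auto
  have "((\<lambda>x. F x - F x0) has_real_derivative f x) (at x)" if "x \<in> {a<..<b}" for x
    using F[OF that] by (auto simp: has_real_derivative_iff_has_vector_derivative intro!: derivative_eq_intros)
  then show thesis using that[of "\<lambda>x. F x - F x0"] by simp
qed

lemma smooth_antiderivative:
  fixes f :: "real \<Rightarrow> real"
  assumes "smooth_on {a<..<b} f" "x0 \<in> {a<..<b}"
  obtains F where "F x0 = 0" "\<And>x. x \<in> {a<..<b} \<Longrightarrow> (F has_real_derivative f x) (at x)" "smooth_on {a<..<b} F"
proof -
  obtain F where F: "F x0 = 0" "\<And>x. x \<in> {a<..<b} \<Longrightarrow> (F has_real_derivative f x) (at x)"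
    using continuous_on_has_antiderivative[OF smooth_on_imp_continuous_on[OF assms(1)] assms(2)] by blast
  moreover have "smooth_on {a<..<b} F"
    by (rule smooth_on_vector_derivative[OF _ _ assms(1)])
      (use F(2) in \<open>auto simp: has_real_derivative_iff_has_vector_derivative\<close>)
  ultimately show thesis using that by blast
qed

text \<open>Injectivity comes from the mean value theorem and openness of the image from invariance
  of domain. Smoothness is bootstrapped: the derivative \<open>inverse (f (G y))\<close> is as
  smooth as \<open>G\<close>, so \<open>G\<close> gains one order at a time. The main use is the
  change to arc length.\<close>

lemma smooth_local_inverse:
  fixes F :: "real \<Rightarrow> real"
  assumes F: "\<And>x. x \<in> {a<..<b} \<Longrightarrow> (F has_real_derivative f x) (at x)" and f: "smooth_on {a<..<b} f"
    and nz: "\<And>x. x \<in> {a<..<b} \<Longrightarrow> f x \<noteq> 0" and x0: "x0 \<in> {a<..<b}" "F x0 = 0"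
  obtains e G where "e > 0" "G 0 = x0" "\<And>y. \<bar>y\<bar> < e \<Longrightarrow> G y \<in> {a<..<b} \<and> F (G y) = y"
    "smooth_on {-e<..<e} G" "\<And>y. \<bar>y\<bar> < e \<Longrightarrow> (G has_real_derivative inverse (f (G y))) (at y)" "inj_on F {a<..<b}"
proof -
  have "continuous_on {a<..<b} F"
    using F DERIV_isCont continuous_at_imp_continuous_on by blast
  have inj: "inj_on F {a<..<b}"
  proof (rule inj_onI, rule ccontr)
    fix x y assume xy: "x \<in> {a<..<b}" "y \<in> {a<..<b}" "F x = F y" "x \<noteq> y"
    have *: False if "x \<in> {a<..<b}" "y \<in> {a<..<b}" "F x = F y" "x < y" for x y
    proof -
      have "\<exists>z. z > x \<and> z < y \<and> F y - F x = (y - x) * f z"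
        by (rule MVT2[OF that(4)]) (use that F in auto)
      then show False using nz that by auto
    qed
    show False using *[of x y] *[of y x] xy by argo
  qed
  have op: "open (F ` {a<..<b})"
    by (rule invariance_of_domain[OF \<open>continuous_on {a<..<b} F\<close> _ inj]) simp
  define G where "G = inv_into {a<..<b} F"
  have GF: "G (F x) = x" if "x \<in> {a<..<b}" for x
    unfolding G_def using inj that by simp
  have FG: "G y \<in> {a<..<b}" "F (G y) = y" if "y \<in> F ` {a<..<b}" for y
    unfolding G_def using that by (simp_all add: inv_into_into f_inv_into_f del: greaterThanLessThan_iff)
  have "0 \<in> F ` {a<..<b}" using x0 by force
  then obtain e where e: "e > 0" "ball 0 e \<subseteq> F ` {a<..<b}"
    using op open_contains_ball by metis
  have bal: "y \<in> F ` {a<..<b}" if "\<bar>y\<bar> < e" for y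
    using e(2) that by (auto simp: subset_iff dist_real_def)
  obtain g where g: "homeomorphism {a<..<b} (F ` {a<..<b}) F g"
    using invariance_of_domain_homeomorphism[OF _ \<open>continuous_on {a<..<b} F\<close> _ inj] by auto
  then have "g y = G y" if "y \<in> F ` {a<..<b}" for y
    using that GF by (auto simp: homeomorphism_def)
  then have hom: "continuous_on (F ` {a<..<b}) G"
    using g unfolding homeomorphism_def by (simp cong: continuous_on_cong)
  have G': "(G has_real_derivative inverse (f (G y))) (at y)" if *: "y \<in> F ` {a<..<b}" for y
  proof -
    have "isCont G y" using hom op that continuous_on_eq_continuous_at by blast
    obtain r where r: "r > 0" "ball y r \<subseteq> F ` {a<..<b}" using openE[OF op *] by metis
    show ?thesis
      by (rule DERIV_inverse_function[where a = "y - r" and b = "y + r" and f = F])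
        (use F FG that nz r \<open>isCont G y\<close> in \<open>auto simp: subset_iff dist_real_def\<close>)
  qed
  have ck: "Ck n {-e<..<e} G" for n
  proof (induction n)
    case 0
    have "{-e<..<e} \<subseteq> F ` {a<..<b}" using bal by (auto simp del: image_iff)
    then show ?case using hom continuous_on_subset by auto
  next
    case (Suc n)
    have "(G has_vector_derivative inverse (f (G y))) (at y)" if "y \<in> {-e<..<e}" for y
      using G'[OF bal] that by (auto simp: has_real_derivative_iff_has_vector_derivative)
    moreover have "Ck n {-e<..<e} (\<lambda>y. inverse (f (G y)))"
    proof (rule Ck_real_compose[where T = "{a<..<b}" and g = "\<lambda>x. inverse (f x)"])
      show "Ck n {a<..<b} (\<lambda>x. inverse (f x))"
        by (rule smooth_onD(1)[OF smooth_on_real_compose[OF smooth_on_inverse f]]) (use nz in auto)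
      show "G y \<in> {a<..<b}" if "y \<in> {-e<..<e}" for y
        using FG(1)[OF bal] that by auto
    qed (use Suc in auto)
    ultimately show ?case
      by (rule Ck_vector_SucI[OF open_greaterThanLessThan])
  qed
  show thesis
    by (rule that[of e G])
      (use e(1) GF[OF x0(1)] x0 FG bal G' ck inj in \<open>auto simp: smooth_on_def\<close>)
qed

section \<open>Orthonormal frames\<close>

lemma frame3:
  fixes e a :: "real^3"
  assumes "norm e = 1" "norm a = 1" "e \<bullet> a = 0"
  shows "norm (cross3 e a) = 1" "e \<bullet> cross3 e a = 0" "a \<bullet> cross3 e a = 0"
    "cross3 (cross3 e a) e = a" "cross3 a (cross3 e a) = e"
    "x = (x \<bullet> e) *\<^sub>R e + (x \<bullet> a) *\<^sub>R a + (x \<bullet> cross3 e a) *\<^sub>R cross3 e a"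
proof -
  let ?b = "cross3 e a"
  have ee: "e \<bullet> e = 1" "a \<bullet> a = 1" "a \<bullet> e = 0"
    using assms by (simp_all add: norm_eq_1 inner_commute)
  show n: "norm ?b = 1"
    using norm_cross[of e a] assms norm_ge_zero[of ?b] by (simp add: power2_eq_1_iff)
  show o: "e \<bullet> ?b = 0" "a \<bullet> ?b = 0"
    by (simp_all add: dot_cross_self)
  show "cross3 ?b e = a"
    using Lagrange[of e e a] ee assms(3) by (simp add: cross_skew[of ?b e])
  show "cross3 a ?b = e"
    using Lagrange[of a e a] ee by simp
  define y where "y = x - ((x \<bullet> e) *\<^sub>R e + (x \<bullet> a) *\<^sub>R a + (x \<bullet> ?b) *\<^sub>R ?b)"
  have bb: "?b \<bullet> ?b = 1" using n by (simp add: norm_eq_1)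
  have y: "y \<bullet> e = 0" "y \<bullet> a = 0" "y \<bullet> ?b = 0"
    unfolding y_def using ee o bb assms(3) by (simp_all add: inner_diff_left inner_add_left dot_cross_self)
  \<comment> \<open>The remainder \<open>y\<close> is orthogonal to \<open>e\<close> and
    \<open>a\<close>, hence parallel to \<open>cross3 e a\<close>; being orthogonal to that vector
    as well, it vanishes.\<close>
  have "cross3 y ?b = 0"
    using Lagrange[of y e a] y by simp
  then have "norm y = 0"
    using norm_cross[of y ?b] y n by simp
  then show "x = (x \<bullet> e) *\<^sub>R e + (x \<bullet> a) *\<^sub>R a + (x \<bullet> ?b) *\<^sub>R ?b"
    by (simp add: y_def)
qed

lemma orthogonal_to_frame:
  fixes e a x :: "real^3"
  assumes "norm e = 1" "norm a = 1" "e \<bullet> a = 0" "x \<bullet> e = 0" "x \<bullet> a = 0"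
  shows "x = (x \<bullet> cross3 e a) *\<^sub>R cross3 e a"
  using frame3(6)[OF assms(1-3), of x] assms(4,5) by simp

lemma unit_orthogonal_to_frame:
  fixes e a x :: "real^3"
  assumes "norm e = 1" "norm a = 1" "e \<bullet> a = 0" "x \<bullet> e = 0" "x \<bullet> a = 0" "norm x = 1"
  shows "x = cross3 e a \<or> x = - cross3 e a"
proof -
  have x: "x = (x \<bullet> cross3 e a) *\<^sub>R cross3 e a"
    using orthogonal_to_frame assms by blast
  then have "norm x = \<bar>x \<bullet> cross3 e a\<bar> * norm (cross3 e a)"
    by (metis norm_scaleR)
  then have "\<bar>x \<bullet> cross3 e a\<bar> = 1"
    using frame3(1)[OF assms(1-3)] assms(6) by simp
  then have "x \<bullet> cross3 e a = 1 \<or> x \<bullet> cross3 e a = -1"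
    by linarith
  then show ?thesis
    using x by (metis scaleR_minus1_left scaleR_one)
qed

text \<open>Links the abstract unit normal, which is only known to be continuous, with the
  normalized cross product of the partial derivatives, which is smooth.\<close>

lemma unit_normal_unique:
  fixes a b x :: "real^3"
  assumes "cross3 a b \<noteq> 0" "x \<bullet> a = 0" "x \<bullet> b = 0" "norm x = 1"
  defines "m \<equiv> (1 / norm (cross3 a b)) *\<^sub>R cross3 a b"
  shows "x = m \<or> x = - m"
proof -
  have "cross3 x (cross3 a b) = 0"
    using Lagrange[of x a b] assms by simp
  then have "(norm x)\<^sup>2 * (norm (cross3 a b))\<^sup>2 = (x \<bullet> cross3 a b)\<^sup>2"
    using norm_cross[of x "cross3 a b"] by simp
  moreover have "(x \<bullet> m)\<^sup>2 = (x \<bullet> cross3 a b)\<^sup>2 / (norm (cross3 a b))\<^sup>2"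
    by (simp add: m_def power_divide)
  ultimately have "(x \<bullet> m)\<^sup>2 = 1"
    using assms(1,4) by auto
  then have xm: "x \<bullet> m = 1 \<or> x \<bullet> m = -1" by (simp add: power2_eq_1_iff)
  have mm: "norm m = 1" using assms(1) by (simp add: m_def)
  have "(norm (x - m))\<^sup>2 = 2 - 2 * (x \<bullet> m)" "(norm (x + m))\<^sup>2 = 2 + 2 * (x \<bullet> m)"
    using mm assms(4) unfolding power2_norm_eq_inner
    by (simp_all add: inner_diff_left inner_diff_right inner_add_left inner_add_right norm_eq_1 inner_commute)
  then have "x - m = 0 \<or> x + m = 0"
    using xm by (auto simp: power2_eq_iff)
  then show ?thesis by (metis add_eq_0_iff eq_iff_diff_eq_0 add.inverse_inverse)
qed

lemma has_vector_derivative_inner: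
  fixes f g :: "real \<Rightarrow> 'a::real_inner"
  assumes "(f has_vector_derivative f') (at x within S)" "(g has_vector_derivative g') (at x within S)"
  shows "((\<lambda>x. f x \<bullet> g x) has_real_derivative f x \<bullet> g' + f' \<bullet> g x) (at x within S)"
  using bounded_bilinear.has_vector_derivative[OF bounded_bilinear_inner assms]
  by (simp add: has_real_derivative_iff_has_vector_derivative)

lemma inner_const_derivative:
  fixes f g :: "real \<Rightarrow> 'a::real_inner"
  assumes "(f has_vector_derivative f') (at x)" "(g has_vector_derivative g') (at x)"
    and "open S" "x \<in> S" "\<And>y. y \<in> S \<Longrightarrow> f y \<bullet> g y = k"
  shows "f x \<bullet> g' + f' \<bullet> g x = 0"
proof -
  have "((\<lambda>_. k) has_real_derivative f x \<bullet> g' + f' \<bullet> g x) (at x)"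
    using has_vector_derivative_inner[OF assms(1,2)] assms(3-5)
    by (auto intro: has_field_derivative_transform_within_open)
  then show ?thesis using DERIV_const DERIV_unique by blast
qed

text \<open>Rotate the frame \<open>a\<close>, \<open>cross3 e a\<close> by an angle. Orthonormality
  already fixes all components of \<open>p1'\<close> and \<open>p2'\<close> in the plane normal to
  \<open>e\<close> except \<open>p1' \<bullet> p2\<close>, so a single integral for the angle
  suffices. Here \<open>e\<close> is any smooth unit field; a curve tangent to it is constructed
  only in the normal form.\<close>

lemma rotation_minimizing_frame_exists:
  fixes e a :: "real \<Rightarrow> real^3"
  assumes e: "smooth_on {c<..<d} e" and a: "smooth_on {c<..<d} a" and v0: "v0 \<in> {c<..<d}"
    and on: "\<And>v. v \<in> {c<..<d} \<Longrightarrow> norm (e v) = 1 \<and> norm (a v) = 1 \<and> e v \<bullet> a v = 0"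
  obtains p1 p2 c1 c2 where "smooth_on {c<..<d} p1" "smooth_on {c<..<d} p2" "smooth_on {c<..<d} c1" "smooth_on {c<..<d} c2"
    "p1 v0 = a v0"
    "\<And>v. v \<in> {c<..<d} \<Longrightarrow> norm (p1 v) = 1 \<and> e v \<bullet> p1 v = 0 \<and> p2 v = cross3 (e v) (p1 v)"
    "\<And>v. v \<in> {c<..<d} \<Longrightarrow> (p1 has_vector_derivative c1 v *\<^sub>R e v) (at v)"
    "\<And>v. v \<in> {c<..<d} \<Longrightarrow> (p2 has_vector_derivative c2 v *\<^sub>R e v) (at v)"
proof -
  let ?J = "{c<..<d}"
  define b where "b v = cross3 (e v) (a v)" for v
  have b: "smooth_on ?J b"
    unfolding b_def by (rule smooth_on_cross3[OF e a])
  let ?a' = "\<lambda>v. vector_derivative a (at v)" and ?b' = "\<lambda>v. vector_derivative b (at v)"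
  \<comment> \<open>\<open>th' = a' \<bullet> b\<close> makes the \<open>p2\<close>-component of \<open>p1'\<close> vanish.\<close>
  obtain th where th: "th v0 = 0" "\<And>v. v \<in> ?J \<Longrightarrow> (th has_real_derivative ?a' v \<bullet> b v) (at v)" "smooth_on ?J th"
    using smooth_antiderivative[OF smooth_on_inner[OF smooth_on_deriv[OF a] b] v0] by blast
  define p1 where "p1 v = cos (th v) *\<^sub>R a v - sin (th v) *\<^sub>R b v" for v
  define p2 where "p2 v = sin (th v) *\<^sub>R a v + cos (th v) *\<^sub>R b v" for v
  have sc: "smooth_on ?J (\<lambda>v. sin (th v))" "smooth_on ?J (\<lambda>v. cos (th v))"
    by (rule smooth_on_real_compose[OF _ th(3)], rule smooth_on_sin_cos, simp)+
  have p: "smooth_on ?J p1" "smooth_on ?J p2"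
    unfolding p1_def p2_def by (intro smooth_on_diff smooth_on_add smooth_on_scaleR sc a b)+
  have alg: "norm (p1 v) = 1" "e v \<bullet> p1 v = 0" "p2 v = cross3 (e v) (p1 v)" "norm (p2 v) = 1"
    if v: "v \<in> ?J" for v
  proof -
    have o: "norm (e v) = 1" "norm (a v) = 1" "e v \<bullet> a v = 0" using on v by auto
    note fr = frame3[OF o, folded b_def]
    have ip: "a v \<bullet> a v = 1" "b v \<bullet> b v = 1" "b v \<bullet> a v = 0" "a v \<bullet> b v = 0"
      using o fr by (simp_all add: norm_eq_1 inner_commute)
    have "p1 v \<bullet> p1 v = (cos (th v))\<^sup>2 + (sin (th v))\<^sup>2" "p2 v \<bullet> p2 v = (sin (th v))\<^sup>2 + (cos (th v))\<^sup>2"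
      by (simp_all add: p1_def p2_def inner_diff_left inner_diff_right inner_add_left inner_add_right ip power2_eq_square)
    then show "norm (p1 v) = 1" "norm (p2 v) = 1" by (simp_all add: norm_eq_1)
    show "e v \<bullet> p1 v = 0"
      using o fr by (simp add: p1_def inner_diff_right)
    have "cross3 (e v) (b v) = - a v"
      using fr(4) cross_skew[of "e v" "b v"] by simp
    then show "p2 v = cross3 (e v) (p1 v)"
      by (simp add: p1_def p2_def Cross3.right_diff_distrib cross_mult_right b_def[symmetric])
  qed
  let ?p1' = "\<lambda>v. vector_derivative p1 (at v)" and ?p2' = "\<lambda>v. vector_derivative p2 (at v)"
  note dv = smooth_on_has_vector_derivative
  have par: "?p1' v = (?p1' v \<bullet> e v) *\<^sub>R e v \<and> ?p2' v = (?p2' v \<bullet> e v) *\<^sub>R e v" if v: "v \<in> ?J" for v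
  proof -
    have o: "norm (e v) = 1" "norm (a v) = 1" "e v \<bullet> a v = 0" using on v by auto
    note fr = frame3[OF o, folded b_def]
    have ip: "a v \<bullet> a v = 1" "b v \<bullet> b v = 1" "b v \<bullet> a v = 0" "a v \<bullet> b v = 0"
      using o fr by (simp_all add: norm_eq_1 inner_commute)
    have aa: "a v \<bullet> ?a' v = 0"
      using inner_const_derivative[OF dv[OF a v] dv[OF a v] _ v, of 1] on by (simp add: norm_eq_1 inner_commute)
    have ab: "a v \<bullet> ?b' v = - (?a' v \<bullet> b v)"
      using inner_const_derivative[OF dv[OF a v] dv[OF b v] _ v, of 0] on by (simp add: b_def dot_cross_self)
    have bb: "b v \<bullet> ?b' v = 0"
      using inner_const_derivative[OF dv[OF b v] dv[OF b v] _ v, of 1] on frame3(1)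
      by (simp add: b_def norm_eq_1 inner_commute)
    let ?t = "?a' v \<bullet> b v"
    have "((\<lambda>v. cos (th v)) has_real_derivative - sin (th v) * ?t) (at v)" "((\<lambda>v. sin (th v)) has_real_derivative cos (th v) * ?t) (at v)"
      using th(2)[OF v] by (auto intro!: derivative_eq_intros)
    then have "(p1 has_vector_derivative (cos (th v) *\<^sub>R ?a' v + (- sin (th v) * ?t) *\<^sub>R a v) - (sin (th v) *\<^sub>R ?b' v + (cos (th v) * ?t) *\<^sub>R b v)) (at v)"
      unfolding p1_def by (intro has_vector_derivative_diff has_vector_derivative_scaleR dv[OF a v] dv[OF b v])
    then have d: "?p1' v = (cos (th v) *\<^sub>R ?a' v + (- sin (th v) * ?t) *\<^sub>R a v) - (sin (th v) *\<^sub>R ?b' v + (cos (th v) * ?t) *\<^sub>R b v)"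
      by (rule vector_derivative_at)
    have "?p1' v \<bullet> p2 v = - ?t * ((sin (th v))\<^sup>2 + (cos (th v))\<^sup>2) + ?t * ((sin (th v))\<^sup>2 + (cos (th v))\<^sup>2)"
      unfolding d p2_def using aa ab bb
      by (simp add: inner_diff_left inner_diff_right inner_add_left inner_add_right ip power2_eq_square inner_commute algebra_simps)
    then have 12: "?p1' v \<bullet> p2 v = 0" by simp
    have 21: "?p2' v \<bullet> p1 v = 0"
      using inner_const_derivative[OF dv[OF p(1) v] dv[OF p(2) v] _ v, of 0] alg 12 by (simp add: dot_cross_self inner_commute)
    have 11: "?p1' v \<bullet> p1 v = 0"
      using inner_const_derivative[OF dv[OF p(1) v] dv[OF p(1) v] _ v, of 1] alg by (simp add: norm_eq_1 inner_commute)
    have 22: "?p2' v \<bullet> p2 v = 0"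
      using inner_const_derivative[OF dv[OF p(2) v] dv[OF p(2) v] _ v, of 1] alg(4) by (simp add: norm_eq_1 inner_commute)
    note f = frame3(6)[OF o(1) alg(1,2)[OF v], folded alg(3)[OF v]]
    show ?thesis using f[of "?p1' v"] f[of "?p2' v"] 11 12 21 22 by simp
  qed
  show thesis
  proof (rule that[of p1 p2 "\<lambda>v. ?p1' v \<bullet> e v" "\<lambda>v. ?p2' v \<bullet> e v"])
    show "p1 v0 = a v0" by (simp add: p1_def th)
    show "(p1 has_vector_derivative (?p1' v \<bullet> e v) *\<^sub>R e v) (at v)" if "v \<in> ?J" for v
      using dv[OF p(1) that] par[OF that] by metis
    show "(p2 has_vector_derivative (?p2' v \<bullet> e v) *\<^sub>R e v) (at v)" if "v \<in> ?J" for v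
      using dv[OF p(2) that] par[OF that] by metis
  qed (use p alg smooth_on_inner[OF smooth_on_deriv e] in auto)
qed

section \<open>The local normal form\<close>

text \<open>The plane curve \<open>(xi, eta)\<close> is carried along \<open>R\<close> by the rotation minimizing frame \<open>(E, P, Q)\<close>. In
  the swept surface \<open>h\<close>, the lines \<open>w = const\<close> have velocity \<open>T\<close>, and \<open>s = const\<close> have velocity \<open>Lam E\<close>.\<close>

locale nbox =
  fixes eps :: real and R E P Q :: "real \<Rightarrow> real^3" and p q xi eta xi' eta' :: "real \<Rightarrow> real"
  assumes eps: "eps > 0"
    and smooth: "smooth_on {-eps<..<eps} R" "smooth_on {-eps<..<eps} E" "smooth_on {-eps<..<eps} P"
      "smooth_on {-eps<..<eps} Q" "smooth_on {-eps<..<eps} xi" "smooth_on {-eps<..<eps} eta"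
    and R': "\<bar>w\<bar> < eps \<Longrightarrow> (R has_vector_derivative E w) (at w)"
    and P': "\<bar>w\<bar> < eps \<Longrightarrow> (P has_vector_derivative p w *\<^sub>R E w) (at w)"
    and Q': "\<bar>w\<bar> < eps \<Longrightarrow> (Q has_vector_derivative q w *\<^sub>R E w) (at w)"
    and frame: "\<bar>w\<bar> < eps \<Longrightarrow> norm (E w) = 1" "\<bar>w\<bar> < eps \<Longrightarrow> norm (P w) = 1" "\<bar>w\<bar> < eps \<Longrightarrow> E w \<bullet> P w = 0"
      "\<bar>w\<bar> < eps \<Longrightarrow> Q w = cross3 (E w) (P w)"
    and xi': "\<bar>s\<bar> < eps \<Longrightarrow> (xi has_real_derivative xi' s) (at s)"
    and eta': "\<bar>s\<bar> < eps \<Longrightarrow> (eta has_real_derivative eta' s) (at s)"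
    and unit_speed: "\<bar>s\<bar> < eps \<Longrightarrow> (xi' s)\<^sup>2 + (eta' s)\<^sup>2 = 1"
    and init: "xi 0 = 0" "eta 0 = 0" "xi' 0 = 1" "eta' 0 = 0"
    and speed_nonzero: "\<bar>s\<bar> < eps \<Longrightarrow> \<bar>w\<bar> < eps \<Longrightarrow> 1 + xi s * p w + eta s * q w \<noteq> 0"
begin

definition "h s w = R w + xi s *\<^sub>R P w + eta s *\<^sub>R Q w"
definition "T s w = xi' s *\<^sub>R P w + eta' s *\<^sub>R Q w"
definition "Lam s w = 1 + xi s * p w + eta s * q w"

lemma frame_more:
  assumes "\<bar>w\<bar> < eps"
  shows "norm (Q w) = 1" "E w \<bullet> Q w = 0" "P w \<bullet> Q w = 0" "cross3 (Q w) (E w) = P w" "cross3 (P w) (Q w) = E w"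
    "E w \<bullet> E w = 1" "P w \<bullet> P w = 1" "Q w \<bullet> Q w = 1" "P w \<bullet> E w = 0" "Q w \<bullet> E w = 0" "Q w \<bullet> P w = 0"
proof -
  note f = frame3[OF frame(1-3)[OF assms], folded frame(4)[OF assms]]
  show "norm (Q w) = 1" "E w \<bullet> Q w = 0" "P w \<bullet> Q w = 0" "cross3 (Q w) (E w) = P w" "cross3 (P w) (Q w) = E w"
    using f by simp_all
  then show "E w \<bullet> E w = 1" "P w \<bullet> P w = 1" "Q w \<bullet> Q w = 1" "P w \<bullet> E w = 0" "Q w \<bullet> E w = 0" "Q w \<bullet> P w = 0"
    using frame[OF assms] by (simp_all add: norm_eq_1 inner_commute)
qed

text \<open>In a box the surface normal will be \<open>cross3 (E w) (T s w)\<close>, so the last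
  identity says that normal cross direction is the leaf velocity.\<close>

lemma T_frame:
  assumes "\<bar>s\<bar> < eps" "\<bar>w\<bar> < eps"
  shows "norm (T s w) = 1" "E w \<bullet> T s w = 0" "T s w \<bullet> E w = 0" "T s w \<bullet> T s w = 1"
    "cross3 (cross3 (E w) (T s w)) (E w) = T s w"
proof -
  have "T s w \<bullet> T s w = (xi' s)\<^sup>2 + (eta' s)\<^sup>2"
    using frame_more[OF assms(2)] by (simp add: T_def inner_add_left inner_add_right power2_eq_square)
  then show n: "norm (T s w) = 1" "T s w \<bullet> T s w = 1" using unit_speed[OF assms(1)] by (simp_all add: norm_eq_1)
  show o: "E w \<bullet> T s w = 0" "T s w \<bullet> E w = 0"
    using frame_more[OF assms(2)] frame(3)[OF assms(2)] by (simp_all add: T_def inner_add_right inner_add_left)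
  show "cross3 (cross3 (E w) (T s w)) (E w) = T s w"
    using frame3(4)[OF frame(1)[OF assms(2)] n(1) o(1)] .
qed

lemma Lam_nonzero: "\<bar>s\<bar> < eps \<Longrightarrow> \<bar>w\<bar> < eps \<Longrightarrow> Lam s w \<noteq> 0"
  using speed_nonzero by (simp add: Lam_def)

text \<open>On the centre line the leaves start in direction \<open>P\<close> and the trajectory has
  unit speed. This is what later identifies \<open>P\<close> and \<open>Q\<close> with the frame
  along the base trajectory.\<close>

lemma init_simps: "Lam 0 w = 1" "T 0 w = P w" "h 0 w = R w"
  by (simp_all add: Lam_def T_def h_def init)

lemma h_has_derivative:
  assumes "\<bar>s\<bar> < eps" "\<bar>w\<bar> < eps"
  shows "((\<lambda>z. h (fst z) (snd z)) has_derivative (\<lambda>k. fst k *\<^sub>R T s w + snd k *\<^sub>R Lam s w *\<^sub>R E w)) (at (s, w))"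
proof -
  have d: "((\<lambda>z. f (snd z)) has_derivative (\<lambda>k. snd k *\<^sub>R f')) (at (s, w))"
    if "(f has_vector_derivative f') (at w)" for f :: "real \<Rightarrow> real^3" and f'
    using has_derivative_compose[OF has_derivative_snd[OF has_derivative_ident], of f "\<lambda>h. h *\<^sub>R f'" "(s,w)" UNIV] that
    by (simp add: has_vector_derivative_def)
  have x: "((\<lambda>z. f (fst z)) has_derivative (\<lambda>k. fst k * f')) (at (s, w))"
    if "(f has_real_derivative f') (at s)" for f :: "real \<Rightarrow> real" and f'
    using has_derivative_compose[OF has_derivative_fst[OF has_derivative_ident], of f "\<lambda>h. h * f'" "(s,w)" UNIV] that
    by (simp add: has_field_derivative_def mult_commute_abs)
  show ?thesis
    unfolding h_def
    by (rule has_derivative_eq_rhs[OF has_derivative_add[OF has_derivative_add[OF d[OF R'[OF assms(2)]]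
          has_derivative_scaleR[OF x[OF xi'[OF assms(1)]] d[OF P'[OF assms(2)]]]]
          has_derivative_scaleR[OF x[OF eta'[OF assms(1)]] d[OF Q'[OF assms(2)]]]]])
      (simp add: T_def Lam_def fun_eq_iff algebra_simps)
qed

end

text \<open>Reverses the direction \<open>E\<close> by passing to \<open>h (- s) (- w)\<close>. With
  \<open>E\<close> the vector \<open>P\<close> must change sign to keep
  \<open>Q = cross3 E P\<close>, and then \<open>xi\<close> must change sign to keep both the
  surface and \<open>xi' 0 = 1\<close>.\<close>

lemma nbox_flip:
  assumes "nbox eps R E P Q p q xi eta xi' eta'"
  shows "nbox eps (\<lambda>w. R (- w)) (\<lambda>w. - E (- w)) (\<lambda>w. - P (- w)) (\<lambda>w. Q (- w))
     (\<lambda>w. - p (- w)) (\<lambda>w. q (- w)) (\<lambda>s. - xi (- s)) (\<lambda>s. eta (- s)) (\<lambda>s. xi' (- s)) (\<lambda>s. - eta' (- s))"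
proof -
  interpret nbox eps R E P Q p q xi eta xi' eta' by fact
  have sm: "smooth_on {-eps<..<eps} (\<lambda>w. f (- w))" if "smooth_on {-eps<..<eps} f" for f :: "real \<Rightarrow> 'b::euclidean_space"
    using smooth_on_affine_compose[OF bounded_linear_minus[OF bounded_linear_ident], of "{-eps<..<eps}" "{-eps<..<eps}" f 0] that
    by auto
  have vd: "((\<lambda>w. f (- w)) has_vector_derivative - f') (at w)" if "(f has_vector_derivative f') (at (- w))"
    for f :: "real \<Rightarrow> 'b::euclidean_space" and f' w
    using vector_diff_chain_at[OF has_vector_derivative_minus[OF has_vector_derivative_id], of f f' w] that by (simp add: o_def)
  have rd: "((\<lambda>w. f (- w)) has_real_derivative - f') (at w)" if "(f has_real_derivative f') (at (- w))"
    for f :: "real \<Rightarrow> real" and f' w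
    using vd[of f f' w] that by (simp add: has_real_derivative_iff_has_vector_derivative)
  show ?thesis
  proof (unfold_locales)
    show "((\<lambda>w. - P (- w)) has_vector_derivative (- p (- w)) *\<^sub>R - E (- w)) (at w)" if "\<bar>w\<bar> < eps" for w
      using has_vector_derivative_minus[OF vd[OF P'[of "- w"]]] that by simp
    show "((\<lambda>w. Q (- w)) has_vector_derivative q (- w) *\<^sub>R - E (- w)) (at w)" if "\<bar>w\<bar> < eps" for w
      using vd[OF Q'[of "- w"]] that by simp
    show "((\<lambda>s. - xi (- s)) has_real_derivative xi' (- s)) (at s)" if "\<bar>s\<bar> < eps" for s
      using DERIV_minus[OF rd[OF xi'[of "- s"]]] that by simp
    show "1 + - xi (- s) * - p (- w) + eta (- s) * q (- w) \<noteq> 0" if "\<bar>s\<bar> < eps" "\<bar>w\<bar> < eps" for s w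
      using speed_nonzero[of "- s" "- w"] that by simp
  qed (use eps sm smooth smooth_on_minus init frame unit_speed vd[OF R'] rd[OF eta'] in auto)
qed

text \<open>The map \<open>(u, v)\<close> to \<open>(Y (u, v), v)\<close> is injective where
  \<open>g > 0\<close>, since \<open>Y\<close> increases in \<open>u\<close> there. Invariance of
  domain gives an open image, and the inverse is differentiated from the derivative of the map at
  the point. Only continuity of the partial derivative \<open>g\<close> is used.\<close>

lemma implicit_function_plane:
  fixes Y g l :: "real \<times> real \<Rightarrow> real"
  assumes W: "open W" "(u0, v0) \<in> W"
    and Y: "\<And>w. w \<in> W \<Longrightarrow> (Y has_derivative (\<lambda>j. fst j * g w + snd j * l w)) (at w)"
    and g: "continuous_on W g" "g (u0, v0) > 0" and Y0: "Y (u0, v0) = 0"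
  obtains r \<delta> k where "r > 0" "\<delta> > 0" "\<delta> \<le> r" "{u0-r<..<u0+r} \<times> {v0-r<..<v0+r} \<subseteq> W"
    "\<And>w. w \<in> {u0-r<..<u0+r} \<times> {v0-r<..<v0+r} \<Longrightarrow> g w > 0"
    "\<And>y v. \<bar>y\<bar> < \<delta> \<Longrightarrow> \<bar>v - v0\<bar> < \<delta> \<Longrightarrow> k y v \<in> {u0-r<..<u0+r} \<and> Y (k y v, v) = y"
    "\<And>u v. \<bar>Y (u, v)\<bar> < \<delta> \<Longrightarrow> \<bar>v - v0\<bar> < \<delta> \<Longrightarrow> u \<in> {u0-r<..<u0+r} \<Longrightarrow> u = k (Y (u, v)) v"
    "\<And>y v. \<bar>y\<bar> < \<delta> \<Longrightarrow> \<bar>v - v0\<bar> < \<delta> \<Longrightarrow> ((\<lambda>z. (k (fst z) (snd z), snd z)) has_derivative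
        (\<lambda>j. ((fst j - snd j * l (k y v, v)) / g (k y v, v), snd j))) (at (y, v))"
proof -
  have "isCont g (u0, v0)" using g(1) W continuous_on_eq_continuous_at by blast
  then have "eventually (\<lambda>w. g w > 0) (at (u0, v0))"
    using g(2) by (simp add: isCont_def order_tendstoD(1))
  moreover have "eventually (\<lambda>w. w \<in> W) (at (u0, v0))" using W eventually_at_topological by blast
  ultimately have "eventually (\<lambda>w. g w > 0 \<and> w \<in> W) (at (u0, v0))" by (rule eventually_conj)
  then obtain T where T: "open T" "(u0, v0) \<in> T" "\<And>w. w \<in> T \<Longrightarrow> g w > 0 \<and> w \<in> W"
    using g(2) W unfolding eventually_at_topological by fastforce
  then obtain A B where AB: "open A" "open B" "u0 \<in> A" "v0 \<in> B" "A \<times> B \<subseteq> T"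
    by (metis mem_Sigma_iff open_prod_elim)
  obtain r1 r2 where r12: "r1 > 0" "ball u0 r1 \<subseteq> A" "r2 > 0" "ball v0 r2 \<subseteq> B"
    using AB openE by metis
  define r where "r = min r1 r2"
  have r: "r > 0" using r12 by (simp add: r_def)
  define S where "S = {u0-r<..<u0+r} \<times> {v0-r<..<v0+r}"
  have "{u0-r<..<u0+r} \<subseteq> ball u0 r1" "{v0-r<..<v0+r} \<subseteq> ball v0 r2"
    by (auto simp: r_def dist_real_def)
  then have S: "S \<subseteq> W" "\<And>w. w \<in> S \<Longrightarrow> g w > 0"
    using r12 AB T(3) unfolding S_def by blast+
  have oS: "open S" "(u0, v0) \<in> S" using r by (auto simp: S_def open_Times)
  define H where "H w = (Y w, snd w)" for w :: "real \<times> real"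
  have Hd: "(H has_derivative (\<lambda>j. (fst j * g w + snd j * l w, snd j))) (at w)" if "w \<in> S" for w
    unfolding H_def by (rule has_derivative_Pair[OF Y has_derivative_snd[OF has_derivative_ident]]) (use S(1) that in auto)
  have Hc: "continuous_on S H"
    using Hd has_derivative_continuous continuous_at_imp_continuous_on by blast
  have lt: "Y (u, v) < Y (u', v)" if "(u, v) \<in> S" "(u', v) \<in> S" "u < u'" for u u' v
  proof (rule DERIV_pos_imp_increasing[OF that(3)])
    fix x assume x: "u \<le> x" "x \<le> u'"
    then have xS: "(x, v) \<in> S" using that by (auto simp: S_def)
    have "((\<lambda>x. (x, v)) has_derivative (\<lambda>h. (h, 0))) (at x)"
      by (intro has_derivative_Pair has_derivative_ident has_derivative_const)
    from has_derivative_compose[OF this Y[of "(x, v)"]]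
    have "((\<lambda>x. Y (x, v)) has_real_derivative g (x, v)) (at x)"
      using xS S(1) by (auto simp: has_field_derivative_def mult_commute_abs)
    then show "\<exists>y. ((\<lambda>x. Y (x, v)) has_real_derivative y) (at x) \<and> y > 0"
      using S(2)[OF xS] by blast
  qed
  have inj: "inj_on H S"
  proof (rule inj_onI)
    fix w w' assume w: "w \<in> S" "w' \<in> S" "H w = H w'"
    then have "snd w = snd w'" "Y w = Y w'" by (simp_all add: H_def)
    then show "w = w'"
      using w lt[of "fst w" "snd w" "fst w'"] lt[of "fst w'" "snd w" "fst w"]
      by (metis less_irrefl linorder_neqE prod.collapse)
  qed
  have op: "open (H ` S)" by (rule invariance_of_domain[OF Hc oS(1) inj])
  define K where "K = inv_into S H"
  have KH: "K (H w) = w" if "w \<in> S" for w unfolding K_def using inj that by simp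
  have HK: "K z \<in> S" "H (K z) = z" if "z \<in> H ` S" for z
    unfolding K_def using that by (simp_all add: inv_into_into f_inv_into_f)
  have Kc: "continuous_on (H ` S) K"
    unfolding K_def by (rule continuous_on_inverse_open[OF oS(1) Hc]) (use inj in auto)
  have "H (u0, v0) = (0, v0)" by (simp add: H_def Y0)
  then have "(0, v0) \<in> H ` S" using oS(2) by (metis imageI)
  then obtain A B where AB: "open A" "open B" "0 \<in> A" "v0 \<in> B" "A \<times> B \<subseteq> H ` S"
    using op by (metis mem_Sigma_iff open_prod_elim)
  obtain d1 d2 where d12: "d1 > 0" "ball 0 d1 \<subseteq> A" "d2 > 0" "ball v0 d2 \<subseteq> B"
    using AB openE by metis
  \<comment> \<open>The bound by \<open>r\<close> puts every \<open>(u, v)\<close> with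
    \<open>v\<close> within \<open>\<delta>\<close> of \<open>v0\<close> into the box
    \<open>S\<close>, as the uniqueness of \<open>k\<close> requires.\<close>
  define \<delta> where "\<delta> = min r (min d1 d2)"
  have in_img: "(y, v) \<in> H ` S" if "\<bar>y\<bar> < \<delta>" "\<bar>v - v0\<bar> < \<delta>" for y v
  proof -
    have "y \<in> ball 0 d1" "v \<in> ball v0 d2" using that by (auto simp: \<delta>_def dist_real_def)
    then show ?thesis using AB d12 by blast
  qed
  define k where "k y v = fst (K (y, v))" for y v
  have snd_K: "snd (K z) = snd z" if "z \<in> H ` S" for z
    using HK(2)[OF that] by (auto simp: H_def prod_eq_iff)
  then have K_eq: "K z = (k (fst z) (snd z), snd z)" if "z \<in> H ` S" for z
    using that by (simp add: k_def prod_eq_iff)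
  show thesis
  proof (rule that[of r \<delta> k])
    show "r > 0" "\<delta> > 0" "\<delta> \<le> r" using r d12 by (auto simp: \<delta>_def)
    show "{u0-r<..<u0+r} \<times> {v0-r<..<v0+r} \<subseteq> W" using S(1) by (simp add: S_def)
    show "g w > 0" if "w \<in> {u0-r<..<u0+r} \<times> {v0-r<..<v0+r}" for w using S(2) that by (simp add: S_def)
    fix y v assume yv: "\<bar>y\<bar> < \<delta>" "\<bar>v - v0\<bar> < \<delta>"
    note im = in_img[OF yv]
    have "K (y, v) = (k y v, v)" using K_eq[OF im] by simp
    with HK[OF im] show "k y v \<in> {u0-r<..<u0+r} \<and> Y (k y v, v) = y"
      by (auto simp: S_def H_def)
    let ?w = "K (y, v)"
    have gp: "g ?w \<noteq> 0" using S(2)[OF HK(1)[OF im]] by simp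
    have "(K has_derivative (\<lambda>j. ((fst j - snd j * l ?w) / g ?w, snd j))) (at (y, v))"
    proof (rule has_derivative_inverse_basic[OF Hd[OF HK(1)[OF im]] _ _ _ op im HK(2)])
      show "bounded_linear (\<lambda>j. ((fst j - snd j * l ?w) / g ?w, snd j))"
        by (intro bounded_linear_Pair bounded_linear_divide bounded_linear_compose[OF bounded_linear_divide] bounded_linear_sub bounded_linear_fst bounded_linear_snd
           bounded_linear_compose[OF bounded_linear_mult_left bounded_linear_snd])
      show "(\<lambda>j. ((fst j - snd j * l ?w) / g ?w, snd j)) \<circ> (\<lambda>j. (fst j * g ?w + snd j * l ?w, snd j)) = id"
        using gp by (auto simp: fun_eq_iff)
      show "continuous (at (y, v)) K" using Kc op im continuous_on_eq_continuous_at by blast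
    qed
    then show "((\<lambda>z. (k (fst z) (snd z), snd z)) has_derivative
        (\<lambda>j. ((fst j - snd j * l (k y v, v)) / g (k y v, v), snd j))) (at (y, v))"
      unfolding \<open>K (y, v) = (k y v, v)\<close>
      by (rule has_derivative_transform_within_open[OF _ op im]) (simp add: K_eq)
  next
    fix u v assume uv: "\<bar>Y (u, v)\<bar> < \<delta>" "\<bar>v - v0\<bar> < \<delta>" "u \<in> {u0-r<..<u0+r}"
    then have "(u, v) \<in> S" by (auto simp: S_def \<delta>_def)
    from KH[OF this] show "u = k (Y (u, v)) v" by (simp add: k_def H_def)
  qed
qed

text \<open>All sign ambiguities, of normals and of leaf directions, are settled along connected
  sets by comparing with a continuous reference vector.\<close>

lemma continuous_pm_one:
  fixes f :: "'a::topological_space \<Rightarrow> real"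
  assumes "connected S" "continuous_on S f" "\<And>x. x \<in> S \<Longrightarrow> f x = 1 \<or> f x = -1"
  shows "\<exists>\<sigma>. (\<sigma> = 1 \<or> \<sigma> = -1) \<and> (\<forall>x\<in>S. f x = \<sigma>)"
proof -
  have "finite (f ` S)" by (rule finite_subset[of _ "{1,-1}"]) (use assms(3) in auto)
  then have "f constant_on S" using continuous_finite_range_constant[OF assms(1,2)] by blast
  then show ?thesis using assms(3) unfolding constant_on_def by fastforce
qed

text \<open>Intended for \<open>Phi = f \<circ> \<psi>\<close> and
  \<open>n = N \<circ> \<psi>\<close> in a foliated chart \<open>\<psi>\<close>, whose lines
  \<open>v = const\<close> lie in leaves. The normal is assumed continuous only, because
  \<open>unit_normal\<close> promises no more.\<close>

locale leaf_chart =
  fixes Phi n :: "real \<times> real \<Rightarrow> real^3" and a b c d u0 v0 :: real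
  assumes u0: "u0 \<in> {a<..<b}" and v0: "v0 \<in> {c<..<d}"
    and Phi: "smooth_on ({a<..<b} \<times> {c<..<d}) Phi"
    and reg: "w \<in> {a<..<b} \<times> {c<..<d} \<Longrightarrow> cross3 (pd1 Phi w) (pd2 Phi w) \<noteq> 0"
    and n_cont: "continuous_on ({a<..<b} \<times> {c<..<d}) n"
    and n: "w \<in> {a<..<b} \<times> {c<..<d} \<Longrightarrow> norm (n w) = 1"
      "w \<in> {a<..<b} \<times> {c<..<d} \<Longrightarrow> n w \<bullet> pd1 Phi w = 0" "w \<in> {a<..<b} \<times> {c<..<d} \<Longrightarrow> n w \<bullet> pd2 Phi w = 0"
begin

abbreviation "W \<equiv> {a<..<b} \<times> {c<..<d}"
definition "tau w = (1 / norm (pd1 Phi w)) *\<^sub>R pd1 Phi w"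

lemma open_W: "open W" by (simp add: open_Times)

lemma Phi_deriv:
  assumes "w \<in> W"
  shows "(Phi has_derivative (\<lambda>k. fst k *\<^sub>R pd1 Phi w + snd k *\<^sub>R pd2 Phi w)) (at w)"
proof -
  let ?D = "frechet_derivative Phi (at w)"
  have D: "(Phi has_derivative ?D) (at w)" by (rule smooth_on_has_derivative[OF Phi assms])
  then have lin: "linear ?D" using has_derivative_linear by blast
  have "?D k = fst k *\<^sub>R pd1 Phi w + snd k *\<^sub>R pd2 Phi w" for k
  proof -
    have "k = fst k *\<^sub>R (1, 0) + snd k *\<^sub>R (0, 1)" by (simp add: prod_eq_iff)
    then have "?D k = ?D (fst k *\<^sub>R (1, 0) + snd k *\<^sub>R (0, 1))" by simp
    also have "\<dots> = fst k *\<^sub>R pd1 Phi w + snd k *\<^sub>R pd2 Phi w"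
      by (simp only: linear_add[OF lin] linear_scale[OF lin] pd1_def pd2_def)
    finally show ?thesis .
  qed
  then show ?thesis using D by presburger
qed

lemma pd_nonzero: "w \<in> W \<Longrightarrow> pd1 Phi w \<noteq> 0"
  using reg by fastforce

lemma tau: "w \<in> W \<Longrightarrow> norm (tau w) = 1" "w \<in> W \<Longrightarrow> tau w \<bullet> n w = 0" "w \<in> W \<Longrightarrow> n w \<bullet> tau w = 0"
  using pd_nonzero n by (auto simp: tau_def inner_commute)

lemma pd_smooth: "smooth_on W (pd1 Phi)" "smooth_on W (pd2 Phi)"
  using smooth_on_partial[OF Phi, of "(1,0)"] smooth_on_partial[OF Phi, of "(0,1)"]
  by (simp_all add: pd1_def[abs_def] pd2_def[abs_def] Basis_prod_def)

lemma tau_cont: "continuous_on W tau"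
  unfolding tau_def using pd_nonzero smooth_on_imp_continuous_on[OF pd_smooth(1)] by (auto intro!: continuous_intros)

lemma slice: "smooth_on W f \<Longrightarrow> smooth_on {c<..<d} (\<lambda>v. f (u0, v) :: 'b::euclidean_space)"
  using smooth_on_affine_compose[OF bounded_linear_Pair[OF bounded_linear_zero bounded_linear_ident],
      of "{c<..<d}" W f "(u0, 0)"] u0 by auto

lemma slice': "smooth_on W f \<Longrightarrow> smooth_on {a<..<b} (\<lambda>u. f (u, v0) :: 'b::euclidean_space)"
  using smooth_on_affine_compose[OF bounded_linear_Pair[OF bounded_linear_ident bounded_linear_zero],
      of "{a<..<b}" W f "(0, v0)"] v0 by auto

text \<open>On a slice \<open>n\<close> agrees up to sign with the normalized cross product of the
  partials, and the sign is constant because the slice is connected; so \<open>n\<close> inherits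
  smoothness.\<close>

lemma slice_smooth: "smooth_on {c<..<d} (\<lambda>v. tau (u0, v))" "smooth_on {c<..<d} (\<lambda>v. n (u0, v))"
proof -
  show "smooth_on {c<..<d} (\<lambda>v. tau (u0, v))"
    unfolding tau_def by (rule smooth_on_normalize[OF slice[OF pd_smooth(1)]]) (use pd_nonzero u0 in auto)
  let ?C = "\<lambda>v. cross3 (pd1 Phi (u0, v)) (pd2 Phi (u0, v))"
  define m where "m v = (1 / norm (?C v)) *\<^sub>R ?C v" for v
  have m: "smooth_on {c<..<d} m"
    unfolding m_def by (rule smooth_on_normalize[OF smooth_on_cross3[OF slice slice]]) (use pd_smooth reg u0 in auto)
  have nc: "continuous_on {c<..<d} (\<lambda>v. n (u0, v))"
    by (rule continuous_on_compose2[OF n_cont]) (use u0 in \<open>auto intro!: continuous_intros\<close>)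
  have pm: "n (u0, v) = m v \<or> n (u0, v) = - m v" "m v \<bullet> m v = 1" if "v \<in> {c<..<d}" for v
  proof -
    have w: "(u0, v) \<in> W" using u0 that by simp
    show "n (u0, v) = m v \<or> n (u0, v) = - m v"
      unfolding m_def by (rule unit_normal_unique[OF reg[OF w] n(2)[OF w] n(3)[OF w] n(1)[OF w]])
    have "norm (m v) = 1" using reg[OF w] by (simp add: m_def)
    then show "m v \<bullet> m v = 1" by (simp add: norm_eq_1)
  qed
  have "\<exists>\<sigma>. (\<sigma> = 1 \<or> \<sigma> = -1) \<and> (\<forall>v\<in>{c<..<d}. n (u0, v) \<bullet> m v = \<sigma>)"
  proof (rule continuous_pm_one)
    show "continuous_on {c<..<d} (\<lambda>v. n (u0, v) \<bullet> m v)"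
      using nc smooth_on_imp_continuous_on[OF m] by (intro continuous_intros)
    show "n (u0, v) \<bullet> m v = 1 \<or> n (u0, v) \<bullet> m v = -1" if "v \<in> {c<..<d}" for v
      using pm[OF that] by (metis inner_minus_left)
  qed auto
  then obtain \<sigma> where s: "\<And>v. v \<in> {c<..<d} \<Longrightarrow> n (u0, v) \<bullet> m v = \<sigma>" by blast
  have "smooth_on {c<..<d} (\<lambda>v. \<sigma> *\<^sub>R m v)"
    by (rule smooth_on_linear[OF bounded_linear_scaleR_right m])
  then show "smooth_on {c<..<d} (\<lambda>v. n (u0, v))"
  proof (rule smooth_on_cong)
    fix v assume v: "v \<in> {c<..<d}"
    then show "\<sigma> *\<^sub>R m v = n (u0, v)"
      using s[OF v] pm[OF v] by (metis inner_minus_left scaleR_minus1_left scaleR_one)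
  qed
qed

end

context leaf_chart
begin

text \<open>The parameters are exchanged in two steps: the leaf parameter \<open>u\<close> becomes
  the coordinate \<open>Y1\<close> along \<open>p1\<close>, and then both \<open>Y1\<close> and
  \<open>v\<close> become arc lengths, of the common plane curve and of the base curve. The
  resulting map into the chart is stated to be continuous and injective, which in the plane makes it
  a homeomorphism onto an open set.\<close>

theorem normal_form:
  assumes e_const: "\<And>u v. (u, v) \<in> W \<Longrightarrow> cross3 (tau (u, v)) (n (u, v)) = cross3 (tau (u0, v)) (n (u0, v))"
    and planar: "\<And>u v. (u, v) \<in> W \<Longrightarrow> (Phi (u, v) - Phi (u0, v)) \<bullet> cross3 (tau (u0, v)) (n (u0, v)) = 0"
  obtains eps R E P Q p q xi eta xi' eta' k om where
    "nbox eps R E P Q p q xi eta xi' eta'"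
    "continuous_on ({-eps<..<eps} \<times> {-eps<..<eps}) (\<lambda>z. (k (fst z) (snd z), om (snd z)))"
    "inj_on (\<lambda>z. (k (fst z) (snd z), om (snd z))) ({-eps<..<eps} \<times> {-eps<..<eps})"
    "k 0 0 = u0" "om 0 = v0" "E 0 = cross3 (tau (u0, v0)) (n (u0, v0))"
    "\<And>s w. \<bar>s\<bar> < eps \<Longrightarrow> \<bar>w\<bar> < eps \<Longrightarrow> (k s w, om w) \<in> W \<and> Phi (k s w, om w) = nbox.h R P Q xi eta s w \<and>
      n (k s w, om w) = cross3 (E w) (nbox.T P Q xi' eta' s w)"
proof -
  let ?J = "{c<..<d}"
  define e where "e v = cross3 (tau (u0, v)) (n (u0, v))" for v
  define t0 where "t0 v = tau (u0, v)" for v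
  have inW: "(u0, v) \<in> W" if "v \<in> ?J" for v using u0 that by simp
  have e: "smooth_on ?J e" unfolding e_def by (rule smooth_on_cross3[OF slice_smooth])
  have t0: "smooth_on ?J t0" unfolding t0_def by (rule slice_smooth(1))
  have on: "norm (e v) = 1 \<and> norm (t0 v) = 1 \<and> e v \<bullet> t0 v = 0" if "v \<in> ?J" for v
    using frame3(1,2)[OF tau(1)[OF inW[OF that]] n(1)[OF inW[OF that]] tau(2)[OF inW[OF that]]] tau(1)[OF inW[OF that]]
    by (simp add: e_def t0_def dot_cross_self)
  obtain p1 p2 c1 c2 where sm: "smooth_on ?J p1" "smooth_on ?J p2" "smooth_on ?J c1" "smooth_on ?J c2"
    and p1_v0: "p1 v0 = t0 v0"
    and p: "\<And>v. v \<in> ?J \<Longrightarrow> norm (p1 v) = 1 \<and> e v \<bullet> p1 v = 0 \<and> p2 v = cross3 (e v) (p1 v)"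
    and p1': "\<And>v. v \<in> ?J \<Longrightarrow> (p1 has_vector_derivative c1 v *\<^sub>R e v) (at v)"
    and p2': "\<And>v. v \<in> ?J \<Longrightarrow> (p2 has_vector_derivative c2 v *\<^sub>R e v) (at v)"
    using rotation_minimizing_frame_exists[OF e t0 v0 on] by metis
  have ip: "e v \<bullet> e v = 1" "p1 v \<bullet> p1 v = 1" "p2 v \<bullet> p2 v = 1" "e v \<bullet> p1 v = 0" "e v \<bullet> p2 v = 0" "p1 v \<bullet> p2 v = 0"
      "p1 v \<bullet> e v = 0" "p2 v \<bullet> e v = 0" "p2 v \<bullet> p1 v = 0"
      and expand: "\<And>x. x = (x \<bullet> e v) *\<^sub>R e v + (x \<bullet> p1 v) *\<^sub>R p1 v + (x \<bullet> p2 v) *\<^sub>R p2 v"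
    if "v \<in> ?J" for v
    using frame3[of "e v" "p1 v"] p[OF that] on[OF that] by (simp_all add: norm_eq_1 inner_commute)
  have p2_v0: "p2 v0 = n (u0, v0)"
    using p[OF v0] p1_v0 frame3(4)[OF tau(1)[OF inW[OF v0]] n(1)[OF inW[OF v0]] tau(2)[OF inW[OF v0]]]
    unfolding e_def t0_def by auto
  define rho where "rho v = Phi (u0, v)" for v
  have rho: "smooth_on ?J rho" unfolding rho_def by (rule slice[OF Phi])
  let ?rho' = "\<lambda>v. vector_derivative rho (at v)"
  note dv = smooth_on_has_vector_derivative
  obtain A where A: "A v0 = 0" "\<And>v. v \<in> ?J \<Longrightarrow> (A has_real_derivative - (?rho' v \<bullet> p1 v)) (at v)" "smooth_on ?J A"
    using smooth_antiderivative[OF smooth_on_minus[OF smooth_on_inner[OF smooth_on_deriv[OF rho] sm(1)]] v0] by blast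
  obtain B where B: "B v0 = 0" "\<And>v. v \<in> ?J \<Longrightarrow> (B has_real_derivative - (?rho' v \<bullet> p2 v)) (at v)" "smooth_on ?J B"
    using smooth_antiderivative[OF smooth_on_minus[OF smooth_on_inner[OF smooth_on_deriv[OF rho] sm(2)]] v0] by blast
  \<comment> \<open>\<open>R0\<close> is moved inside the normal planes of \<open>e\<close> so that \<open>R0'\<close> is parallel to \<open>e\<close>; \<open>Y1\<close>, \<open>Y2\<close> below are
    the coordinates of \<open>Phi\<close> in the frame \<open>p1\<close>, \<open>p2\<close> centred at \<open>R0\<close>.\<close>
  define R0 where "R0 v = rho v + A v *\<^sub>R p1 v + B v *\<^sub>R p2 v" for v
  have R0: "smooth_on ?J R0"
    unfolding R0_def by (intro smooth_on_add smooth_on_scaleR rho A(3) B(3) sm)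
  \<comment> \<open>The signed speed of \<open>R0\<close> along \<open>e\<close>: the rotation of
    the frame contributes the terms with \<open>c1\<close> and \<open>c2\<close>, while the choice
    of \<open>A\<close> and \<open>B\<close> cancels the components along \<open>p1\<close> and
    \<open>p2\<close>.\<close>
  define ka where "ka v = ?rho' v \<bullet> e v + A v * c1 v + B v * c2 v" for v
  have ka: "smooth_on ?J ka"
    unfolding ka_def by (intro smooth_on_add smooth_on_mult smooth_on_inner smooth_on_deriv rho e A(3) B(3) sm)
  have R0': "(R0 has_vector_derivative ka v *\<^sub>R e v) (at v)" if v: "v \<in> ?J" for v
  proof -
    have "(R0 has_vector_derivative ?rho' v + (A v *\<^sub>R (c1 v *\<^sub>R e v) + - (?rho' v \<bullet> p1 v) *\<^sub>R p1 v)
        + (B v *\<^sub>R (c2 v *\<^sub>R e v) + - (?rho' v \<bullet> p2 v) *\<^sub>R p2 v)) (at v)"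
      unfolding R0_def
      by (intro has_vector_derivative_add has_vector_derivative_scaleR dv[OF rho v] p1'[OF v] p2'[OF v] A(2)[OF v] B(2)[OF v])
    moreover have "?rho' v + (A v *\<^sub>R (c1 v *\<^sub>R e v) + - (?rho' v \<bullet> p1 v) *\<^sub>R p1 v)
        + (B v *\<^sub>R (c2 v *\<^sub>R e v) + - (?rho' v \<bullet> p2 v) *\<^sub>R p2 v) = ka v *\<^sub>R e v"
      by (subst expand[OF v, of "?rho' v"]) (simp add: ka_def algebra_simps)
    ultimately show ?thesis by simp
  qed
  define Y1 where "Y1 z = (Phi z - R0 (snd z)) \<bullet> p1 (snd z)" for z
  define Y2 where "Y2 z = (Phi z - R0 (snd z)) \<bullet> p2 (snd z)" for z
  have PhiR0: "(Phi (u, v) - R0 v) \<bullet> e v = 0" if "(u, v) \<in> W" for u v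
  proof -
    have "v \<in> ?J" using that by simp
    have "(Phi (u, v) - R0 v) \<bullet> e v = (Phi (u, v) - Phi (u0, v)) \<bullet> e v"
      using ip[OF \<open>v \<in> ?J\<close>] by (simp add: R0_def rho_def inner_diff_left inner_add_left)
    then show ?thesis using planar[OF that] by (simp add: e_def)
  qed
  have Phi_eq: "Phi (u, v) = R0 v + Y1 (u, v) *\<^sub>R p1 v + Y2 (u, v) *\<^sub>R p2 v" if "(u, v) \<in> W" for u v
    using expand[of v "Phi (u, v) - R0 v"] PhiR0[OF that] that by (simp add: Y1_def Y2_def algebra_simps)
  define D where "D w k = fst k *\<^sub>R pd1 Phi w + snd k *\<^sub>R pd2 Phi w" for w and k :: "real \<times> real"
  \<comment> \<open>The frame vector moves along \<open>e\<close>, to which \<open>Phi - R0\<close>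
    is orthogonal, and \<open>R0\<close> moves along \<open>e\<close>, to which the frame vector is
    orthogonal. So only the derivative of \<open>Phi\<close> survives.\<close>
  have Yd: "((\<lambda>z. (Phi z - R0 (snd z)) \<bullet> pp (snd z)) has_derivative (\<lambda>k. D w k \<bullet> pp (snd w))) (at w)"
    if w: "w \<in> W" and pp: "(pp has_vector_derivative cc *\<^sub>R e (snd w)) (at (snd w))" "e (snd w) \<bullet> pp (snd w) = 0" for w pp cc
  proof -
    have v: "snd w \<in> ?J" using w by auto
    have s: "((\<lambda>z. f (snd z)) has_derivative (\<lambda>k. snd k *\<^sub>R f')) (at w)"
      if "(f has_vector_derivative f') (at (snd w))" for f :: "real \<Rightarrow> real^3" and f'
      using has_derivative_compose[OF has_derivative_snd[OF has_derivative_ident], of f "\<lambda>h. h *\<^sub>R f'" w UNIV] that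
      by (simp add: has_vector_derivative_def)
    have "((\<lambda>z. (Phi z - R0 (snd z)) \<bullet> pp (snd z)) has_derivative
       (\<lambda>k. (Phi w - R0 (snd w)) \<bullet> (snd k *\<^sub>R (cc *\<^sub>R e (snd w))) + (D w k - snd k *\<^sub>R (ka (snd w) *\<^sub>R e (snd w))) \<bullet> pp (snd w))) (at w)"
      using Phi_deriv[OF w] unfolding D_def
      by (intro has_derivative_inner has_derivative_diff s[OF R0'[OF v]] s[OF pp(1)])
    then show ?thesis
      using PhiR0[of "fst w" "snd w"] w pp(2) by (simp add: inner_diff_left)
  qed
  have Y1d: "(Y1 has_derivative (\<lambda>k. D w k \<bullet> p1 (snd w))) (at w)" if "w \<in> W" for w
    unfolding Y1_def using that ip(4) by (intro Yd[OF that p1']) auto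
  have Y2d: "(Y2 has_derivative (\<lambda>k. D w k \<bullet> p2 (snd w))) (at w)" if "w \<in> W" for w
    unfolding Y2_def using that ip(5) by (intro Yd[OF that p2']) auto
  define g where "g w = pd1 Phi w \<bullet> p1 (snd w)" for w
  define l where "l w = pd2 Phi w \<bullet> p1 (snd w)" for w
  have D_p1: "D w k \<bullet> p1 (snd w) = fst k * g w + snd k * l w" for w k
    by (simp add: D_def g_def l_def inner_add_left)
  have w0: "(u0, v0) \<in> W" using u0 v0 by simp
  have Y0: "Y1 (u0, v0) = 0" "Y2 (u0, v0) = 0"
    by (simp_all add: Y1_def Y2_def R0_def rho_def A B)
  \<comment> \<open>The frame starts with \<open>p1 v0\<close> equal to the unit leaf tangent, so
    near the centre \<open>Y1\<close> can replace the leaf parameter.\<close>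
  have g0: "g (u0, v0) > 0"
  proof -
    have "g (u0, v0) = norm (pd1 Phi (u0, v0))"
      using pd_nonzero[OF w0] by (simp add: g_def p1_v0 t0_def tau_def norm_eq_sqrt_inner real_div_sqrt)
    then show ?thesis using pd_nonzero[OF w0] by simp
  qed
  have gc: "continuous_on W g"
    unfolding g_def
    by (intro continuous_on_inner smooth_on_imp_continuous_on[OF pd_smooth(1)]
       continuous_on_compose2[OF smooth_on_imp_continuous_on[OF sm(1)]] continuous_on_snd continuous_on_id) auto
  obtain r \<delta> k where r: "r > 0" "\<delta> > 0" "\<delta> \<le> r" "{u0-r<..<u0+r} \<times> {v0-r<..<v0+r} \<subseteq> W"
    and gpos: "\<And>w. w \<in> {u0-r<..<u0+r} \<times> {v0-r<..<v0+r} \<Longrightarrow> g w > 0"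
    and k: "\<And>y v. \<bar>y\<bar> < \<delta> \<Longrightarrow> \<bar>v - v0\<bar> < \<delta> \<Longrightarrow> k y v \<in> {u0-r<..<u0+r} \<and> Y1 (k y v, v) = y"
    and k_unique: "\<And>u v. \<bar>Y1 (u, v)\<bar> < \<delta> \<Longrightarrow> \<bar>v - v0\<bar> < \<delta> \<Longrightarrow> u \<in> {u0-r<..<u0+r} \<Longrightarrow> u = k (Y1 (u, v)) v"
    and kd: "\<And>y v. \<bar>y\<bar> < \<delta> \<Longrightarrow> \<bar>v - v0\<bar> < \<delta> \<Longrightarrow> ((\<lambda>z. (k (fst z) (snd z), snd z)) has_derivative
        (\<lambda>j. ((fst j - snd j * l (k y v, v)) / g (k y v, v), snd j))) (at (y, v))"
    using implicit_function_plane[OF open_W w0 Y1d[unfolded D_p1] gc g0 Y0(1)] by auto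
  have kW: "(k y v, v) \<in> W" "g (k y v, v) > 0" "v \<in> ?J" if "\<bar>y\<bar> < \<delta>" "\<bar>v - v0\<bar> < \<delta>" for y v
  proof -
    have *: "(k y v, v) \<in> {u0-r<..<u0+r} \<times> {v0-r<..<v0+r}" using k[OF that] that r(3) by auto
    then show "(k y v, v) \<in> W" "g (k y v, v) > 0" using r(4) gpos by blast+
    then show "v \<in> ?J" by simp
  qed
  define K' where "K' y v j = ((fst j - snd j * l (k y v, v)) / g (k y v, v), snd j)" for y v and j :: "real \<times> real"
  define Z where "Z z = Y2 (k (fst z) (snd z), snd z)" for z
  have Zd: "(Z has_derivative (\<lambda>j. D (k y v, v) (K' y v j) \<bullet> p2 v)) (at (y, v))" if "\<bar>y\<bar> < \<delta>" "\<bar>v - v0\<bar> < \<delta>" for y v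
    using has_derivative_compose[OF kd[OF that, folded K'_def] Y2d] kW[OF that] unfolding Z_def by simp
  have DK1: "D (k y v, v) (K' y v j) \<bullet> p1 v = fst j" if "\<bar>y\<bar> < \<delta>" "\<bar>v - v0\<bar> < \<delta>" for y v j
    using D_p1[of "(k y v, v)"] kW(2)[OF that] by (simp add: K'_def)
  have nD: "n w \<bullet> D w j = 0" if "w \<in> W" for w j
    using n[OF that] by (simp add: D_def inner_add_right)
  have n_e: "n (u, v) \<bullet> e v = 0" if "(u, v) \<in> W" for u v
    using e_const[OF that] unfolding e_def by (metis dot_cross_self(2))
  have tau_e: "cross3 (e v) (tau (u, v)) = n (u, v)" if "(u, v) \<in> W" for u v
    using frame3(4)[OF tau(1)[OF that] n(1)[OF that] tau(2)[OF that]] e_const[OF that] by (simp add: e_def)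
  \<comment> \<open>The surface normal is orthogonal to \<open>e\<close>, so \<open>(Y1, Y2)\<close> has rank one and \<open>Y2\<close> depends on \<open>Y1\<close> alone.\<close>
  have nsplit: "n (k y v, v) \<bullet> p2 v \<noteq> 0"
      "(n (k y v, v) \<bullet> p1 v) * fst j + (n (k y v, v) \<bullet> p2 v) * (D (k y v, v) (K' y v j) \<bullet> p2 v) = 0"
    if yv: "\<bar>y\<bar> < \<delta>" "\<bar>v - v0\<bar> < \<delta>" for y v j
  proof -
    let ?n = "n (k y v, v)"
    have nn: "?n = (?n \<bullet> p1 v) *\<^sub>R p1 v + (?n \<bullet> p2 v) *\<^sub>R p2 v"
      using expand[OF kW(3)[OF yv], of ?n] n_e[OF kW(1)[OF yv]] by simp
    show eq: "(?n \<bullet> p1 v) * fst j + (?n \<bullet> p2 v) * (D (k y v, v) (K' y v j) \<bullet> p2 v) = 0" for j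
    proof -
      let ?x = "D (k y v, v) (K' y v j)"
      have "?n \<bullet> ?x = (?n \<bullet> p1 v) * (?x \<bullet> p1 v) + (?n \<bullet> p2 v) * (?x \<bullet> p2 v)"
      proof -
        have "?n \<bullet> ?x = ((?n \<bullet> p1 v) *\<^sub>R p1 v + (?n \<bullet> p2 v) *\<^sub>R p2 v) \<bullet> ?x"
          by (rule arg_cong[OF nn])
        then show ?thesis by (simp only: inner_add_left inner_scaleR_left inner_commute[of ?x])
      qed
      then show ?thesis using nD[OF kW(1)[OF yv]] DK1[OF yv] by simp
    qed
    show "?n \<bullet> p2 v \<noteq> 0"
    proof
      assume 0: "?n \<bullet> p2 v = 0"
      then have "?n \<bullet> p1 v = 0" using eq[of "(1, 0)"] by simp
      then have "?n = 0" using nn 0 by simp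
      then show False using n(1)[OF kW(1)[OF yv]] by simp
    qed
  qed
  define z where "z y = Z (y, v0)" for y
  \<comment> \<open>A step \<open>(0, h)\<close> keeps \<open>Y1\<close> fixed, so
    \<open>nsplit\<close> makes the \<open>v\<close>-derivative of \<open>Z\<close> vanish. This is
    the equality of all leaves of the chart as plane curves.\<close>
  have Zz: "Z (y, v) = z y" if "\<bar>y\<bar> < \<delta>" "\<bar>v - v0\<bar> < \<delta>" for y v
  proof -
    have *: "((\<lambda>v. Z (y, v)) has_derivative (\<lambda>h. 0)) (at v)" if v: "v \<in> ball v0 \<delta>" for v
    proof -
      have yv: "\<bar>y\<bar> < \<delta>" "\<bar>v - v0\<bar> < \<delta>" using v \<open>\<bar>y\<bar> < \<delta>\<close> by (auto simp: dist_real_def)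
      have "((\<lambda>v. (y, v)) has_derivative (\<lambda>h. (0, h))) (at v)"
        by (intro has_derivative_Pair has_derivative_ident has_derivative_const)
      from has_derivative_compose[OF this Zd[OF yv]]
      have d: "((\<lambda>v. Z (y, v)) has_derivative (\<lambda>h. D (k y v, v) (K' y v (0, h)) \<bullet> p2 v)) (at v)" .
      have "D (k y v, v) (K' y v (0, h)) \<bullet> p2 v = 0" for h
        using nsplit(2)[OF yv, of "(0, h)"] nsplit(1)[OF yv] by simp
      then show ?thesis using d by auto
    qed
    have "Z (y, v) = Z (y, v0)"
      by (rule has_derivative_zero_unique_connected[of "ball v0 \<delta>" "\<lambda>v. Z (y, v)", OF _ _ *])
        (use that r(2) in \<open>auto simp: dist_real_def\<close>)
    then show ?thesis by (simp add: z_def)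
  qed
  define z' where "z' y = D (k y v0, v0) (K' y v0 (1, 0)) \<bullet> p2 v0" for y
  have zd: "(z has_real_derivative D (k y v, v) (K' y v (1, 0)) \<bullet> p2 v) (at y)" if yv: "\<bar>y\<bar> < \<delta>" "\<bar>v - v0\<bar> < \<delta>" for y v
  proof -
    have "((\<lambda>y. (y, v)) has_derivative (\<lambda>h. (h, 0))) (at y)"
      by (intro has_derivative_Pair has_derivative_ident has_derivative_const)
    from has_derivative_compose[OF this Zd[OF yv]]
    have d: "((\<lambda>y. Z (y, v)) has_derivative (\<lambda>h. D (k y v, v) (K' y v (h, 0)) \<bullet> p2 v)) (at y)" .
    have eq: "(\<lambda>h. D (k y v, v) (K' y v (h, 0)) \<bullet> p2 v) = (*) (D (k y v, v) (K' y v (1, 0)) \<bullet> p2 v)"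
      by (rule ext) (simp add: D_def K'_def field_simps)
    have "((\<lambda>y. Z (y, v)) has_real_derivative D (k y v, v) (K' y v (1, 0)) \<bullet> p2 v) (at y)"
      using d unfolding eq has_field_derivative_def .
    then show ?thesis
      by (rule has_field_derivative_transform_within_open[of _ _ _ "{-\<delta><..<\<delta>}"]) (use yv Zz in auto)
  qed
  have z'_eq: "D (k y v, v) (K' y v (1, 0)) \<bullet> p2 v = z' y" if "\<bar>y\<bar> < \<delta>" "\<bar>v - v0\<bar> < \<delta>" for y v
    using DERIV_unique[OF zd[OF that] zd[of y v0]] that r(2) by (simp add: z'_def)
  have k00: "k 0 v0 = u0"
    using k_unique[of u0 v0] Y0 r by simp
  have z0: "z 0 = 0" by (simp add: z_def Z_def k00 Y0)
  \<comment> \<open>At the centre \<open>p2\<close> is the surface normal, so the plane curve starts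
    in direction \<open>p1\<close>; this becomes \<open>eta' 0 = 0\<close>.\<close>
  have z'0: "z' 0 = 0"
  proof -
    have "n (u0, v0) \<bullet> p1 v0 = 0" "n (u0, v0) \<bullet> p2 v0 = 1"
      using p1_v0 p2_v0 tau(3)[OF w0] n(1)[OF w0] by (simp_all add: t0_def norm_eq_1)
    then show ?thesis
      using nsplit(2)[of 0 v0 "(1, 0)"] r(2) by (simp add: z'_def k00)
  qed
  have z_smooth: "smooth_on {-\<delta>'<..<\<delta>'} z" if "smooth_on {-\<delta>'<..<\<delta>'} (\<lambda>y. k y v0)" "\<delta>' \<le> \<delta>" for \<delta>'
  proof -
    have "smooth_on {a<..<b} (\<lambda>u. Y2 (u, v0))"
      unfolding Y2_def using v0
      by (simp add: smooth_on_inner[OF smooth_on_diff[OF slice'[OF Phi] smooth_on_const] smooth_on_const])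
    from smooth_on_real_compose[OF this that(1)] show ?thesis
      using kW(1)[of _ v0] that(2) r(2) by (force simp: z_def[abs_def] Z_def)
  qed
  \<comment> \<open>If this factor vanished, moving in \<open>v\<close> at fixed \<open>Y1\<close>
    would leave \<open>Phi\<close> stationary to first order, so \<open>pd2 Phi\<close> would be a
    multiple of \<open>pd1 Phi\<close> and the chart would not be regular.\<close>
  have lam: "ka v + y * c1 v + z y * c2 v \<noteq> 0" if yv: "\<bar>y\<bar> < \<delta>" "\<bar>v - v0\<bar> < \<delta>" for y v
  proof
    assume 0: "ka v + y * c1 v + z y * c2 v = 0"
    let ?w = "(k y v, v)"
    have "((\<lambda>v. (y, v)) has_derivative (\<lambda>h. (0, h))) (at v)"
      by (intro has_derivative_Pair has_derivative_ident has_derivative_const)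
    from has_derivative_compose[OF has_derivative_compose[OF this kd[OF yv, folded K'_def]]] Phi_deriv[OF kW(1)[OF yv], folded D_def]
    have "((\<lambda>v. Phi (k y v, v)) has_derivative (\<lambda>h. D ?w (K' y v (0, h)))) (at v)"
      by auto
    moreover have dh: "(\<lambda>h. D ?w (K' y v (0, h))) = (\<lambda>h. h *\<^sub>R D ?w (K' y v (0, 1)))"
      by (rule ext) (simp add: D_def K'_def algebra_simps)
    ultimately have 1: "((\<lambda>v. Phi (k y v, v)) has_vector_derivative D ?w (K' y v (0, 1))) (at v)"
      unfolding has_vector_derivative_def by metis
    have eq: "Phi (k y v', v') = R0 v' + y *\<^sub>R p1 v' + z y *\<^sub>R p2 v'" if "v' \<in> {v0-\<delta><..<v0+\<delta>}" for v'
    proof -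
      have y: "\<bar>v' - v0\<bar> < \<delta>" using that by auto
      show ?thesis using Phi_eq[OF kW(1)[OF yv(1) y]] k[OF yv(1) y] Zz[OF yv(1) y] by (simp add: Z_def)
    qed
    have "((\<lambda>v. R0 v + y *\<^sub>R p1 v + z y *\<^sub>R p2 v) has_vector_derivative
        ka v *\<^sub>R e v + y *\<^sub>R (c1 v *\<^sub>R e v) + z y *\<^sub>R (c2 v *\<^sub>R e v)) (at v)"
      using R0'[OF kW(3)[OF yv]] p1'[OF kW(3)[OF yv]] p2'[OF kW(3)[OF yv]]
      by (intro has_vector_derivative_add bounded_linear.has_vector_derivative[OF bounded_linear_scaleR_right])
    moreover have "ka v *\<^sub>R e v + y *\<^sub>R (c1 v *\<^sub>R e v) + z y *\<^sub>R (c2 v *\<^sub>R e v) = (ka v + y * c1 v + z y * c2 v) *\<^sub>R e v"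
      by (simp add: algebra_simps)
    ultimately have "((\<lambda>v. R0 v + y *\<^sub>R p1 v + z y *\<^sub>R p2 v) has_vector_derivative 0) (at v)"
      using 0 by simp
    then have "((\<lambda>v. Phi (k y v, v)) has_vector_derivative 0) (at v)"
      by (rule has_vector_derivative_transform_within_open[of _ _ _ "{v0-\<delta><..<v0+\<delta>}"]) (use eq yv in auto)
    with 1 have "D ?w (K' y v (0, 1)) = 0" by (rule vector_derivative_unique_at)
    then have "pd2 Phi ?w = (l ?w / g ?w) *\<^sub>R pd1 Phi ?w"
      by (simp add: D_def K'_def add_eq_0_iff)
    then have "cross3 (pd1 Phi ?w) (pd2 Phi ?w) = 0" by (simp add: cross_mult_right)
    then show False using reg[OF kW(1)[OF yv]] by simp
  qed
  \<comment> \<open>The implicit function is so far only known to be differentiable. Along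
    \<open>v = v0\<close> it coincides with the smooth inverse \<open>G\<close> of a function of one
    variable, and \<open>z\<close> sees nothing but this slice.\<close>
  obtain e1 G where G: "e1 > 0" "G 0 = u0" "\<And>y. \<bar>y\<bar> < e1 \<Longrightarrow> G y \<in> {u0-r<..<u0+r} \<and> Y1 (G y, v0) = y" "smooth_on {-e1<..<e1} G"
  proof -
    have sub: "(u, v0) \<in> W" if "u \<in> {u0-r<..<u0+r}" for u
    proof -
      have "(u, v0) \<in> {u0-r<..<u0+r} \<times> {v0-r<..<v0+r}" using r(1) that by simp
      then show ?thesis using r(4) by blast
    qed
    have d: "((\<lambda>u. Y1 (u, v0)) has_real_derivative g (u, v0)) (at u)" if u: "u \<in> {u0-r<..<u0+r}" for u
    proof -
      have "((\<lambda>u. (u, v0)) has_derivative (\<lambda>h. (h, 0))) (at u)"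
        by (intro has_derivative_Pair has_derivative_ident has_derivative_const)
      from has_derivative_compose[OF this Y1d[OF sub[OF u]]] show ?thesis
        by (simp add: D_p1[of "(u, v0)", simplified] has_field_derivative_def mult_commute_abs)
    qed
    have "smooth_on {a<..<b} (\<lambda>u. g (u, v0))"
      unfolding g_def using v0 by (simp add: smooth_on_inner[OF slice'[OF pd_smooth(1)] smooth_on_const])
    moreover have "{u0-r<..<u0+r} \<subseteq> {a<..<b}" using sub by auto
    ultimately have sg: "smooth_on {u0-r<..<u0+r} (\<lambda>u. g (u, v0))" using smooth_on_subset open_greaterThanLessThan by metis
    have gn: "g (u, v0) \<noteq> 0" if "u \<in> {u0-r<..<u0+r}" for u using gpos[of "(u, v0)"] that r(1) by auto
    show thesis
      by (rule smooth_local_inverse[OF d sg gn]) (use r(1) Y0 in \<open>auto intro: that\<close>)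
  qed
  define \<delta>' where "\<delta>' = min e1 \<delta>"
  have \<delta>': "\<delta>' > 0" "\<delta>' \<le> \<delta>" "\<delta>' \<le> e1" using G(1) r(2) by (auto simp: \<delta>'_def)
  have kG: "G y = k y v0" if "\<bar>y\<bar> < \<delta>'" for y
    using k_unique[of "G y" v0] G(3)[of y] that \<delta>' r(2) by auto
  have "smooth_on {-\<delta>'<..<\<delta>'} (\<lambda>y. k y v0)"
    by (rule smooth_on_cong[OF smooth_on_subset[OF G(4)]]) (use kG \<delta>' in auto)
  then have zs: "smooth_on {-\<delta>'<..<\<delta>'} z" using z_smooth \<delta>' by blast
  have zd': "(z has_real_derivative z' y) (at y)" if "\<bar>y\<bar> < \<delta>'" for y
    using zd[of y v0] that \<delta>' r(2) by (simp add: z'_def)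
  have z's: "smooth_on {-\<delta>'<..<\<delta>'} z'"
    by (rule smooth_on_cong[OF smooth_on_deriv[OF zs]])
      (use zd' in \<open>auto intro!: vector_derivative_at simp: has_real_derivative_iff_has_vector_derivative[symmetric]\<close>)
  \<comment> \<open>The arc length density of the graph of \<open>z\<close>. Inverting its
    antiderivative \<open>L\<close> gives the unit speed parameter of the common plane
    curve.\<close>
  define f where "f y = (1 + z' y * z' y) powr (1/2)" for y
  have pos: "1 + t * t > 0" for t :: real by (smt (verit) zero_le_square)
  have f: "f y > 0" "f y * f y = 1 + z' y * z' y" for y
    using pos[of "z' y"] by (simp_all add: f_def powr_half_sqrt)
  have fs: "smooth_on {-\<delta>'<..<\<delta>'} f"
    unfolding f_def
    by (rule smooth_on_real_compose[OF smooth_on_powr smooth_on_add[OF smooth_on_const smooth_on_mult[OF z's z's]]]) (use pos in auto)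
  obtain L where L: "L 0 = 0" "\<And>x. x \<in> {-\<delta>'<..<\<delta>'} \<Longrightarrow> (L has_real_derivative f x) (at x)"
    using smooth_antiderivative[OF fs, of 0] \<delta>'(1) by auto
  obtain e2 yy where yy: "e2 > 0" "yy 0 = 0" "\<And>s. \<bar>s\<bar> < e2 \<Longrightarrow> yy s \<in> {-\<delta>'<..<\<delta>'} \<and> L (yy s) = s" "smooth_on {-e2<..<e2} yy"
      "\<And>s. \<bar>s\<bar> < e2 \<Longrightarrow> (yy has_real_derivative inverse (f (yy s))) (at s)"
    by (rule smooth_local_inverse[OF L(2) fs _ _ L(1)]) (use f(1) \<delta>'(1) in \<open>auto simp: less_imp_neq[symmetric]\<close>)
  have Jsub: "{v0-\<delta><..<v0+\<delta>} \<subseteq> ?J"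
    using kW(3)[of 0] r(2) by (auto simp: abs_less_iff)
  have ka_nz: "ka v \<noteq> 0" if "v \<in> {v0-\<delta><..<v0+\<delta>}" for v
    using lam[of 0 v] z0 r(2) that by fastforce
  have kas: "smooth_on {v0-\<delta><..<v0+\<delta>} ka" using smooth_on_subset[OF ka _ Jsub] by simp
  \<comment> \<open>\<open>M\<close> is the signed arc length of \<open>R0\<close>. After
    composition with its inverse \<open>om\<close>, the base curve has velocity exactly
    \<open>e\<close>, whatever the sign of \<open>ka\<close>.\<close>
  obtain M where M: "M v0 = 0" "\<And>x. x \<in> {v0-\<delta><..<v0+\<delta>} \<Longrightarrow> (M has_real_derivative ka x) (at x)"
    using smooth_antiderivative[OF kas, of v0] r(2) by auto
  obtain e3 om where om: "e3 > 0" "om 0 = v0" "\<And>w. \<bar>w\<bar> < e3 \<Longrightarrow> om w \<in> {v0-\<delta><..<v0+\<delta>} \<and> M (om w) = w" "smooth_on {-e3<..<e3} om"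
      "\<And>w. \<bar>w\<bar> < e3 \<Longrightarrow> (om has_real_derivative inverse (ka (om w))) (at w)"
    by (rule smooth_local_inverse[OF M(2) kas ka_nz _ M(1)]) (use r(2) in auto)
  define eps where "eps = min e2 e3"
  have eps: "eps > 0" "eps \<le> e2" "eps \<le> e3" using yy(1) om(1) by (auto simp: eps_def)
  have mem: "x \<in> {-e<..<e} \<longleftrightarrow> \<bar>x\<bar> < e" for x e :: real by auto
  have yb: "\<bar>yy s\<bar> < \<delta>" "\<bar>yy s\<bar> < \<delta>'" if "\<bar>s\<bar> < eps" for s using yy(3)[of s] that eps \<delta>' by auto
  have ob: "\<bar>om w - v0\<bar> < \<delta>" "om w \<in> ?J" if "\<bar>w\<bar> < eps" for w using om(3)[of w] that eps Jsub by auto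
  have yys: "smooth_on {-eps<..<eps} yy" and oms: "smooth_on {-eps<..<eps} om"
    by (rule smooth_on_subset[OF yy(4)], simp, use eps in force, rule smooth_on_subset[OF om(4)], simp, use eps in force)
  have comp: "smooth_on {-eps<..<eps} (\<lambda>w. F (om w))" if "smooth_on ?J F" for F :: "real \<Rightarrow> 'b::euclidean_space"
    by (rule smooth_on_real_compose[OF that oms]) (use ob in auto)
  have dcomp: "((\<lambda>w. F (om w)) has_vector_derivative inverse (ka (om w)) *\<^sub>R F') (at w)"
    if "\<bar>w\<bar> < eps" "(F has_vector_derivative F') (at (om w))" for F :: "real \<Rightarrow> real^3" and F' w
    using vector_diff_chain_at[of om "inverse (ka (om w))" w F F'] om(5)[of w] that eps
    by (simp add: o_def has_real_derivative_iff_has_vector_derivative)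
  have kao: "ka (om w) \<noteq> 0" if "\<bar>w\<bar> < eps" for w using ka_nz om(3)[of w] that eps by auto
  interpret nb: nbox eps "\<lambda>w. R0 (om w)" "\<lambda>w. e (om w)" "\<lambda>w. p1 (om w)" "\<lambda>w. p2 (om w)"
      "\<lambda>w. c1 (om w) * inverse (ka (om w))" "\<lambda>w. c2 (om w) * inverse (ka (om w))" yy "\<lambda>s. z (yy s)"
      "\<lambda>s. inverse (f (yy s))" "\<lambda>s. z' (yy s) * inverse (f (yy s))"
  proof
    show "smooth_on {-eps<..<eps} (\<lambda>s. z (yy s))"
      by (rule smooth_on_real_compose[OF zs yys]) (use yb(2) in \<open>simp add: mem del: greaterThanLessThan_iff\<close>)
    show "((\<lambda>w. R0 (om w)) has_vector_derivative e (om w)) (at w)" if "\<bar>w\<bar> < eps" for w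
      using dcomp[OF that R0'[OF ob(2)[OF that]]] kao[OF that] by simp
    show "((\<lambda>w. p1 (om w)) has_vector_derivative (c1 (om w) * inverse (ka (om w))) *\<^sub>R e (om w)) (at w)" if "\<bar>w\<bar> < eps" for w
      using dcomp[OF that p1'[OF ob(2)[OF that]]] by (simp add: mult.commute)
    show "((\<lambda>w. p2 (om w)) has_vector_derivative (c2 (om w) * inverse (ka (om w))) *\<^sub>R e (om w)) (at w)" if "\<bar>w\<bar> < eps" for w
      using dcomp[OF that p2'[OF ob(2)[OF that]]] by (simp add: mult.commute)
    show "((\<lambda>s. z (yy s)) has_real_derivative z' (yy s) * inverse (f (yy s))) (at s)" if "\<bar>s\<bar> < eps" for s
      using DERIV_chain2[OF zd'[OF yb(2)[OF that]] yy(5)] that eps by simp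
    show "(inverse (f (yy s)))\<^sup>2 + (z' (yy s) * inverse (f (yy s)))\<^sup>2 = 1" for s
    proof -
      have "(inverse (f (yy s)))\<^sup>2 + (z' (yy s) * inverse (f (yy s)))\<^sup>2 = (1 + z' (yy s) * z' (yy s)) / (f (yy s) * f (yy s))"
        by (simp add: divide_inverse power2_eq_square distrib_right)
      then show ?thesis using f[of "yy s"] by auto
    qed
    show "1 + yy s * (c1 (om w) * inverse (ka (om w))) + z (yy s) * (c2 (om w) * inverse (ka (om w))) \<noteq> 0"
      if "\<bar>s\<bar> < eps" "\<bar>w\<bar> < eps" for s w
    proof -
      have "1 + yy s * (c1 (om w) * inverse (ka (om w))) + z (yy s) * (c2 (om w) * inverse (ka (om w)))
          = (ka (om w) + yy s * c1 (om w) + z (yy s) * c2 (om w)) / ka (om w)"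
        using kao[OF that(2)] by (simp add: field_simps)
      then show ?thesis using lam[OF yb(1)[OF that(1)] ob(1)[OF that(2)]] kao[OF that(2)] by simp
    qed
  qed (use eps yys comp R0 e sm p on ob yy(5) yy(2) z0 z'0 f_def in auto)
  show thesis
  proof (rule that[OF nb.nbox_axioms, of "\<lambda>s w. k (yy s) (om w)" om])
    show "k (yy 0) (om 0) = u0" "om 0 = v0" using k00 yy(2) om(2) by simp_all
    show "e (om 0) = cross3 (tau (u0, v0)) (n (u0, v0))" by (simp add: om(2) e_def)
    have "isCont (\<lambda>z. (k (fst z) (snd z), snd z)) (yy s, om w)" if "\<bar>s\<bar> < eps" "\<bar>w\<bar> < eps" for s w
      using kd[OF yb(1)[OF that(1)] ob(1)[OF that(2)]] has_derivative_continuous by blast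
    moreover have "isCont yy s" "isCont om s" if "\<bar>s\<bar> < eps" for s
      using DERIV_isCont[OF yy(5)] DERIV_isCont[OF om(5)] that eps by auto
    ultimately have "isCont (\<lambda>z. (k (yy (fst z)) (om (snd z)), om (snd z))) (s, w)" if "\<bar>s\<bar> < eps" "\<bar>w\<bar> < eps" for s w
      using that isCont_o2[of "(s, w)" "\<lambda>z. (yy (fst z), om (snd z))" "\<lambda>z. (k (fst z) (snd z), snd z)"]
        isCont_o2[of "(s, w)" fst yy] isCont_o2[of "(s, w)" snd om] by (auto intro!: continuous_Pair continuous_fst continuous_snd)
    then show "continuous_on ({-eps<..<eps} \<times> {-eps<..<eps}) (\<lambda>z. (k (yy (fst z)) (om (snd z)), om (snd z)))"
      by (intro continuous_at_imp_continuous_on) auto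
    show "inj_on (\<lambda>z. (k (yy (fst z)) (om (snd z)), om (snd z))) ({-eps<..<eps} \<times> {-eps<..<eps})"
    proof (rule inj_onI, clarsimp)
      fix s w s' w' assume *: "- eps < s" "s < eps" "- eps < w" "w < eps" "- eps < s'" "s' < eps" "- eps < w'" "w' < eps"
        and eq: "k (yy s) (om w') = k (yy s') (om w')" "om w = om w'"
      have b: "\<bar>s\<bar> < eps" "\<bar>s'\<bar> < eps" "\<bar>w'\<bar> < eps" using * by auto
      have "\<bar>s\<bar> < e2" "\<bar>s'\<bar> < e2" "\<bar>w\<bar> < e3" "\<bar>w'\<bar> < e3" using * eps by auto
      note i = this
      have "w = w'" using om(3)[OF i(3)] om(3)[OF i(4)] eq(2) by metis
      have "yy s = yy s'" using k[OF yb(1) ob(1)] eq(1) b by metis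
      then have "s = s'" using yy(3)[OF i(1)] yy(3)[OF i(2)] by metis
      then show "s = s' \<and> w = w'" using \<open>w = w'\<close> by simp
    qed
  next
    fix s w assume sw: "\<bar>s\<bar> < eps" "\<bar>w\<bar> < eps"
    let ?y = "yy s" and ?v = "om w"
    let ?w = "(k ?y ?v, ?v)"
    note yv = yb(1)[OF sw(1)] ob(1)[OF sw(2)]
    note w = kW(1)[OF yv]
    have "Phi ?w = R0 ?v + ?y *\<^sub>R p1 ?v + z ?y *\<^sub>R p2 ?v"
      using Phi_eq[OF w] k[OF yv] Zz[OF yv] by (simp add: Z_def)
    \<comment> \<open>The leaf velocity is \<open>g\<close> times the tangent of the graph of
      \<open>z\<close>. Normalizing divides by \<open>g * f\<close> and leaves \<open>T\<close>, and
      the cross product of \<open>e\<close> with the unit leaf tangent is the normal.\<close>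
    moreover have "n ?w = cross3 (e ?v) (nb.T s w)"
    proof -
      have g: "g ?w > 0" using kW(2)[OF yv] .
      have "K' ?y ?v (g ?w, 0) = (1, 0)" using g by (simp add: K'_def)
      then have "pd1 Phi ?w = D ?w (K' ?y ?v (g ?w, 0))" by (simp add: D_def)
      also have "\<dots> = g ?w *\<^sub>R D ?w (K' ?y ?v (1, 0))" using g by (simp add: D_def K'_def)
      finally have 1: "pd1 Phi ?w = g ?w *\<^sub>R D ?w (K' ?y ?v (1, 0))" .
      have "tau ?w \<bullet> e ?v = 0" using e_const[OF w] by (metis dot_cross_self(1) e_def)
      then have "pd1 Phi ?w \<bullet> e ?v = 0" using pd_nonzero[OF w] by (simp add: tau_def)
      then have "pd1 Phi ?w = (pd1 Phi ?w \<bullet> p1 ?v) *\<^sub>R p1 ?v + (pd1 Phi ?w \<bullet> p2 ?v) *\<^sub>R p2 ?v"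
        using expand[OF kW(3)[OF yv], of "pd1 Phi ?w"] by simp
      moreover have "pd1 Phi ?w \<bullet> p1 ?v = g ?w" by (simp add: g_def)
      moreover have "pd1 Phi ?w \<bullet> p2 ?v = g ?w * z' ?y" using 1 z'_eq[OF yv] by simp
      ultimately have pd: "pd1 Phi ?w = g ?w *\<^sub>R (p1 ?v + z' ?y *\<^sub>R p2 ?v)" by (simp add: algebra_simps)
      have "(p1 ?v + z' ?y *\<^sub>R p2 ?v) \<bullet> (p1 ?v + z' ?y *\<^sub>R p2 ?v) = f ?y * f ?y"
        using ip[OF kW(3)[OF yv]] by (simp add: f(2) inner_add_left inner_add_right)
      then have "norm (p1 ?v + z' ?y *\<^sub>R p2 ?v) = f ?y"
        using f(1)[of ?y] by (simp add: norm_eq_sqrt_inner)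
      then have "norm (pd1 Phi ?w) = g ?w * f ?y" unfolding pd using g by simp
      then have "tau ?w = (1 / (g ?w * f ?y)) *\<^sub>R (g ?w *\<^sub>R (p1 ?v + z' ?y *\<^sub>R p2 ?v))" using pd by (simp add: tau_def)
      also have "\<dots> = inverse (f ?y) *\<^sub>R (p1 ?v + z' ?y *\<^sub>R p2 ?v)" using g by (simp add: field_simps)
      also have "\<dots> = nb.T s w" by (simp add: nb.T_def algebra_simps)
      finally show ?thesis using tau_e[OF w] by simp
    qed
    ultimately show "(k ?y ?v, ?v) \<in> W \<and> Phi (k ?y ?v, ?v) = nb.h s w \<and> n (k ?y ?v, ?v) = cross3 (e ?v) (nb.T s w)"
      using w by (simp add: nb.h_def)
  qed
qed

end

section \<open>Planar geodesic foliations in normal form\<close>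

text \<open>Here \<open>x\<close> is only continuous. The increments of \<open>x\<close> and of
  \<open>G \<circ> x\<close> differ by a small fraction of the increment of \<open>x\<close>; a
  first crude use of this bounds the increment of \<open>x\<close> by a multiple of
  \<open>t - t0\<close>, and a second use turns the error into little-o of
  \<open>t - t0\<close>.\<close>

lemma has_vector_derivative_lift:
  fixes G :: "'a::real_normed_vector \<Rightarrow> 'a" and x :: "real \<Rightarrow> 'a"
  assumes G: "(G has_derivative (\<lambda>k. k)) (at (x t0))" and x: "isCont x t0"
    and D: "((\<lambda>t. G (x t)) has_vector_derivative D) (at t0)"
  shows "(x has_vector_derivative D) (at t0)"
proof -
  \<comment> \<open>Error constants 1/2 for \<open>G\<close> and 1 for the curve give that the
    increment is at most half itself plus \<open>(norm D + 1) * norm (t - t0)\<close>; solving for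
    it yields this factor.\<close>
  define M where "M = 2 * (norm D + 1)"
  have M: "M > 0" by (simp add: M_def add_nonneg_pos)
  have A: "\<exists>d>0. \<forall>t. norm (t - t0) < d \<longrightarrow> norm (G (x t) - G (x t0) - (x t - x t0)) \<le> e * norm (x t - x t0)" if e: "e > 0" for e
  proof -
    obtain d where d: "d > 0" "\<And>y. norm (y - x t0) < d \<Longrightarrow> norm (G y - G (x t0) - (y - x t0)) \<le> e * norm (y - x t0)"
      using G e unfolding has_derivative_at_alt by blast
    obtain d' where d': "d' > 0" "\<And>t. dist t t0 < d' \<Longrightarrow> dist (x t) (x t0) < d"
      using x d(1) unfolding continuous_at_eps_delta by blast
    then show ?thesis using d by (auto simp: dist_norm)
  qed
  have B: "\<exists>d>0. \<forall>t. norm (t - t0) < d \<longrightarrow> norm (G (x t) - G (x t0) - (t - t0) *\<^sub>R D) \<le> e * norm (t - t0)" if "e > 0" for e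
    using D that unfolding has_vector_derivative_def has_derivative_at_alt by blast
  show ?thesis
    unfolding has_vector_derivative_def has_derivative_at_alt
  proof (intro conjI allI impI)
    show "bounded_linear (\<lambda>h. h *\<^sub>R D)" by (rule bounded_linear_scaleR_left)
    fix e :: real assume e: "e > 0"
    define e' where "e' = e / (M + 1)"
    have e': "e' > 0" using e M by (simp add: e'_def)
    obtain d1 where d1: "d1 > 0" "\<And>t. norm (t - t0) < d1 \<Longrightarrow> norm (G (x t) - G (x t0) - (x t - x t0)) \<le> e' * norm (x t - x t0)"
      using A[OF e'] by blast
    obtain d2 where d2: "d2 > 0" "\<And>t. norm (t - t0) < d2 \<Longrightarrow> norm (G (x t) - G (x t0) - (x t - x t0)) \<le> (1/2) * norm (x t - x t0)"
      using A[of "1/2"] by auto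
    obtain d3 where d3: "d3 > 0" "\<And>t. norm (t - t0) < d3 \<Longrightarrow> norm (G (x t) - G (x t0) - (t - t0) *\<^sub>R D) \<le> e' * norm (t - t0)"
      using B[OF e'] by blast
    obtain d4 where d4: "d4 > 0" "\<And>t. norm (t - t0) < d4 \<Longrightarrow> norm (G (x t) - G (x t0) - (t - t0) *\<^sub>R D) \<le> 1 * norm (t - t0)"
      using B[of 1] by auto
    show "\<exists>d>0. \<forall>t. norm (t - t0) < d \<longrightarrow> norm (x t - x t0 - (t - t0) *\<^sub>R D) \<le> e * norm (t - t0)"
    proof (intro exI conjI allI impI)
      show "min (min d1 d2) (min d3 d4) > 0" using d1 d2 d3 d4 by simp
      fix t assume "norm (t - t0) < min (min d1 d2) (min d3 d4)"
      then have t: "norm (t - t0) < d1" "norm (t - t0) < d2" "norm (t - t0) < d3" "norm (t - t0) < d4" by auto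
      let ?g = "G (x t) - G (x t0)" and ?y = "x t - x t0" and ?l = "(t - t0) *\<^sub>R D"
      have "norm ?y \<le> norm (?g - ?y) + norm ?g" using norm_triangle_ineq4[of ?g "?g - ?y"] by simp
      also have "norm ?g \<le> norm (?g - ?l) + norm ?l" using norm_triangle_ineq[of "?g - ?l" ?l] by simp
      finally have "norm ?y \<le> (1/2) * norm ?y + norm (t - t0) + norm (t - t0) * norm D"
        using d2(2)[OF t(2)] d4(2)[OF t(4)] by simp
      then have y: "norm ?y \<le> M * norm (t - t0)" by (simp add: M_def algebra_simps)
      have "norm (?y - ?l) \<le> norm (?g - ?y) + norm (?g - ?l)"
      proof -
        have "?y - ?l = (?g - ?l) - (?g - ?y)" by simp
        then show ?thesis by (metis norm_triangle_ineq4 add.commute)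
      qed
      also have "\<dots> \<le> e' * norm ?y + e' * norm (t - t0)" using d1(2)[OF t(1)] d3(2)[OF t(3)] by simp
      also have "\<dots> \<le> e' * (M * norm (t - t0)) + e' * norm (t - t0)" using y e' by simp
      also have "\<dots> = e' * (M + 1) * norm (t - t0)" by (simp add: algebra_simps)
      also have "e' * (M + 1) = e" using M by (simp add: e'_def)
      finally show "norm (?y - ?l) \<le> e * norm (t - t0)" .
    qed
  qed
qed

locale pgf =
  fixes f :: "'m::{t2_space, second_countable_topology} \<Rightarrow> real^3" and F :: "'m set set" and N :: "'m \<Rightarrow> real^3"
  assumes normal: "unit_normal f N" and complete: "complete_surface f" and pgf: "planar_geodesic_foliation f F"
    and conn: "connected (UNIV :: 'm set)"
begin

lemma norm_N: "norm (N p) = 1" and N_cont: "continuous_on UNIV N"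
  and N_orth: "local_param f W \<psi> \<Longrightarrow> w \<in> W \<Longrightarrow> N (\<psi> w) \<bullet> pd1 (f \<circ> \<psi>) w = 0 \<and> N (\<psi> w) \<bullet> pd2 (f \<circ> \<psi>) w = 0"
  using normal unfolding unit_normal_def by blast+

lemma fol: "foliation f F" using pgf by (simp add: planar_geodesic_foliation_def)

definition "leaf p = (THE L. L \<in> F \<and> p \<in> L)"

lemma leaf_unique: "L \<in> F \<Longrightarrow> p \<in> L \<Longrightarrow> leaf p = L"
proof -
  assume L: "L \<in> F" "p \<in> L"
  have "pairwise disjnt F" using fol by (simp add: foliation_def)
  then have "L' = L" if "L' \<in> F" "p \<in> L'" for L'
    using L that by (auto simp: pairwise_def disjnt_def)
  then show "leaf p = L" unfolding leaf_def by (rule the_equality[rotated]) (use L in auto)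
qed

lemma leaf_in: "leaf p \<in> F" "p \<in> leaf p"
proof -
  have "\<Union>F = UNIV" using fol by (simp add: foliation_def)
  then obtain L where "L \<in> F" "p \<in> L" by fastforce
  then show "leaf p \<in> F" "p \<in> leaf p" using leaf_unique by auto
qed

lemma leaf_eq: "q \<in> leaf p \<longleftrightarrow> leaf q = leaf p"
  using leaf_unique[OF leaf_in(1)] leaf_in(2) by metis

text \<open>The unit normals of the plane of the leaf through \<open>p\<close>: two opposite vectors. The foliation is
  not known to be orientable, so no continuous global choice is available.\<close>

definition "dir p e \<longleftrightarrow> norm e = 1 \<and> (\<forall>q\<in>leaf p. e \<bullet> N q = 0 \<and> (f q - f p) \<bullet> e = 0)"

lemma dir_neg: "dir p e \<Longrightarrow> dir p (- e)"
  by (simp add: dir_def)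

lemma dir_leaf: "leaf q = leaf p \<Longrightarrow> dir p e \<Longrightarrow> dir q e"
proof -
  assume "leaf q = leaf p" "dir p e"
  then have "(f x - f q) \<bullet> e = (f x - f p) \<bullet> e - (f q - f p) \<bullet> e" "(f q - f p) \<bullet> e = 0" for x
    using leaf_in(2)[of q] by (simp_all add: dir_def inner_diff_left)
  then show "dir q e" using \<open>dir p e\<close> \<open>leaf q = leaf p\<close> by (simp add: dir_def)
qed

lemma chart_at: "\<exists>a b c d \<psi> w. foliated_chart f F a b c d \<psi> \<and> w \<in> {a<..<b} \<times> {c<..<d} \<and> \<psi> w = p"
proof -
  have "\<forall>p. \<exists>a b c d \<psi>. foliated_chart f F a b c d \<psi> \<and> p \<in> \<psi> ` ({a<..<b} \<times> {c<..<d})"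
    using fol by (simp add: foliation_def)
  then obtain a b c d \<psi> where "foliated_chart f F a b c d \<psi>" "p \<in> \<psi> ` ({a<..<b} \<times> {c<..<d})" by metis
  then show ?thesis by blast
qed

lemma chart_leaf:
  assumes "foliated_chart f F a b c d \<psi>" "v \<in> {c<..<d}" "u \<in> {a<..<b}" "u' \<in> {a<..<b}"
  shows "leaf (\<psi> (u, v)) = leaf (\<psi> (u', v))"
proof -
  obtain L where "L \<in> F" "\<psi> ` ({a<..<b} \<times> {v}) \<subseteq> L" using assms(1,2) unfolding foliated_chart_def by blast
  moreover from this have "\<psi> (u, v) \<in> L" "\<psi> (u', v) \<in> L" using assms(3,4) by blast+
  ultimately show ?thesis using leaf_unique by metis
qed

text \<open>The foliation speaks of the plane through the cross product of chart derivatives;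
  \<open>unit_normal_unique\<close> transfers the orthogonality to \<open>N\<close>, and the plane
  normal is then normalized.\<close>

lemma dir_exists: "\<exists>e. dir p e"
proof -
  obtain p0 n where n: "n \<noteq> 0" "\<And>q. q \<in> leaf p \<Longrightarrow> (f q - p0) \<bullet> n = 0"
    and cr: "\<And>W \<psi> w. local_param f W \<psi> \<Longrightarrow> w \<in> W \<Longrightarrow> \<psi> w \<in> leaf p \<Longrightarrow> cross3 (pd1 (f \<circ> \<psi>) w) (pd2 (f \<circ> \<psi>) w) \<bullet> n = 0"
    using pgf leaf_in(1)[of p] unfolding planar_geodesic_foliation_def by metis
  have "n \<bullet> N q = 0" if q: "q \<in> leaf p" for q
  proof -
    obtain a b c d \<psi> w where "foliated_chart f F a b c d \<psi>" and w: "w \<in> {a<..<b} \<times> {c<..<d}" "\<psi> w = q"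
      using chart_at[of q] by blast
    then have lp: "local_param f ({a<..<b} \<times> {c<..<d}) \<psi>" by (simp add: foliated_chart_def)
    have "cross3 (pd1 (f \<circ> \<psi>) w) (pd2 (f \<circ> \<psi>) w) \<noteq> 0" using lp w(1) unfolding local_param_def by blast
    from unit_normal_unique[OF this, of "N q"] N_orth[OF lp w(1)] w norm_N
    have "N q = (1 / norm (cross3 (pd1 (f \<circ> \<psi>) w) (pd2 (f \<circ> \<psi>) w))) *\<^sub>R cross3 (pd1 (f \<circ> \<psi>) w) (pd2 (f \<circ> \<psi>) w)
      \<or> N q = - (1 / norm (cross3 (pd1 (f \<circ> \<psi>) w) (pd2 (f \<circ> \<psi>) w))) *\<^sub>R cross3 (pd1 (f \<circ> \<psi>) w) (pd2 (f \<circ> \<psi>) w)"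
      by auto
    then show ?thesis using cr[OF lp w(1)] w(2) q by (auto simp: inner_commute[of n])
  qed
  moreover have "(f q - f p) \<bullet> n = 0" if "q \<in> leaf p" for q
    using n(2)[OF that] n(2)[OF leaf_in(2)] by (simp add: inner_diff_left)
  ultimately have "dir p ((1 / norm n) *\<^sub>R n)" using n(1) by (simp add: dir_def)
  then show ?thesis by blast
qed

end

text \<open>A chart of the surface in which \<open>f\<close> is the swept surface of the normal
  form. \<open>leaf_box\<close> puts each horizontal line into one leaf; it does not say that
  different lines lie in different leaves, as a leaf may return to the box.\<close>

locale box = pgf f F N + nbox eps R E P Q p q xi eta xi' eta'
  for f :: "'m::{t2_space, second_countable_topology} \<Rightarrow> real^3" and F :: "'m set set" and N :: "'m \<Rightarrow> real^3"
    and eps :: real and R E P Q p q xi eta xi' eta' +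
  fixes chi :: "real \<times> real \<Rightarrow> 'm"
  assumes box_open: "open (chi ` ({-eps<..<eps} \<times> {-eps<..<eps}))"
    and box_homeo: "\<exists>g. homeomorphism ({-eps<..<eps} \<times> {-eps<..<eps}) (chi ` ({-eps<..<eps} \<times> {-eps<..<eps})) chi g"
    and f_box: "\<bar>s\<bar> < eps \<Longrightarrow> \<bar>w\<bar> < eps \<Longrightarrow> f (chi (s, w)) = h s w"
    and N_box: "\<bar>s\<bar> < eps \<Longrightarrow> \<bar>w\<bar> < eps \<Longrightarrow> N (chi (s, w)) = cross3 (E w) (T s w)"
    and leaf_box: "\<bar>s\<bar> < eps \<Longrightarrow> \<bar>w\<bar> < eps \<Longrightarrow> leaf (chi (s, w)) = leaf (chi (0, w))"

context pgf
begin

text \<open>Prescribing the sign of the direction at the centre, and not only the point, is what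
  later allows two curves with the same initial data to be compared in one box without a sign
  ambiguity.\<close>

lemma box_exists:
  assumes dir: "dir p0 e"
  obtains eps R E P Q p q xi eta xi' eta' chi where "box f F N eps R E P Q p q xi eta xi' eta' chi" "chi (0, 0) = p0" "E 0 = e"
proof -
  obtain a b c d \<psi> w0 where fch: "foliated_chart f F a b c d \<psi>" and w0: "w0 \<in> {a<..<b} \<times> {c<..<d}" "\<psi> w0 = p0"
    using chart_at[of p0] by blast
  obtain u0 v0 where uv: "w0 = (u0, v0)" by (metis surj_pair)
  have lp: "local_param f ({a<..<b} \<times> {c<..<d}) \<psi>" using fch by (simp add: foliated_chart_def)
  obtain g where g: "homeomorphism ({a<..<b} \<times> {c<..<d}) (\<psi> ` ({a<..<b} \<times> {c<..<d})) \<psi> g"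
    using lp by (auto simp: local_param_def)
  have \<psi>c: "continuous_on ({a<..<b} \<times> {c<..<d}) \<psi>" using g by (simp add: homeomorphism_def)
  interpret lc: leaf_chart "f \<circ> \<psi>" "N \<circ> \<psi>" a b c d u0 v0
  proof
    show "continuous_on ({a<..<b} \<times> {c<..<d}) (N \<circ> \<psi>)"
      using continuous_on_compose[OF \<psi>c] N_cont continuous_on_subset by blast
  qed (use w0 uv lp norm_N N_orth[OF lp] in \<open>auto simp: local_param_def\<close>)
  let ?e = "\<lambda>w. cross3 (lc.tau w) ((N \<circ> \<psi>) w)"
  \<comment> \<open>The leaf stays in a plane orthogonal to \<open>e'\<close>, so its tangent is
    orthogonal to \<open>e'\<close>, and so is \<open>N\<close>. In space this leaves two unit
    vectors.\<close>
  have pm: "e' = ?e (u, v) \<or> e' = - ?e (u, v)" if w: "(u, v) \<in> {a<..<b} \<times> {c<..<d}" and d: "dir (\<psi> (u, v)) e'" for u v e'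
  proof -
    have lf: "\<psi> (u', v) \<in> leaf (\<psi> (u, v))" if "u' \<in> {a<..<b}" for u'
      using chart_leaf[OF fch, of v u' u] w that by (auto simp: leaf_eq)
    have "((\<lambda>x. (x, v)) has_derivative (\<lambda>h. (h, 0))) (at u)"
      by (intro has_derivative_Pair has_derivative_ident has_derivative_const)
    from has_derivative_compose[OF this lc.Phi_deriv[OF w]]
    have hv: "((\<lambda>u. f (\<psi> (u, v))) has_vector_derivative pd1 (f \<circ> \<psi>) (u, v)) (at u)"
      by (simp add: has_vector_derivative_def)
        have eq: "f (\<psi> (y, v)) \<bullet> e' = f (\<psi> (u, v)) \<bullet> e'" if "y \<in> {a<..<b}" for y
      using d lf[OF that] by (simp add: dir_def inner_diff_left)
    have "pd1 (f \<circ> \<psi>) (u, v) \<bullet> e' = 0"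
      using inner_const_derivative[OF hv has_vector_derivative_const open_greaterThanLessThan _ eq] w by auto
    then have "e' \<bullet> lc.tau (u, v) = 0" by (simp add: lc.tau_def inner_commute)
    moreover have "e' \<bullet> (N \<circ> \<psi>) (u, v) = 0" using d leaf_in(2) by (simp add: dir_def)
    ultimately show ?thesis
      using unit_orthogonal_to_frame[OF lc.tau(1)[OF w] lc.n(1)[OF w] lc.tau(2)[OF w], of e'] d by (simp add: dir_def)
  qed
  \<comment> \<open>One direction \<open>e0\<close> serves the whole plaque. The cross product of
    tangent and normal equals it up to a sign at each point, and continuity makes the sign the same
    along the plaque.\<close>
  have ec: "?e (u, v) = ?e (u0, v) \<and> dir (\<psi> (u, v)) (?e (u0, v))" if w: "(u, v) \<in> {a<..<b} \<times> {c<..<d}" for u v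
  proof -
    obtain e0 where e0: "dir (\<psi> (u0, v)) e0" using dir_exists by blast
    have d: "dir (\<psi> (u, v)) e0" if "u \<in> {a<..<b}" for u
      using dir_leaf[OF chart_leaf[OF fch] e0] that w lc.u0 by simp
    have "\<exists>\<sigma>. (\<sigma> = 1 \<or> \<sigma> = -1) \<and> (\<forall>u\<in>{a<..<b}. ?e (u, v) \<bullet> e0 = \<sigma>)"
    proof (rule continuous_pm_one)
      have "continuous_on ({a<..<b} \<times> {c<..<d}) ?e"
        by (rule bounded_bilinear.continuous_on[OF bounded_bilinear_cross3 lc.tau_cont lc.n_cont])
      then have "continuous_on {a<..<b} (\<lambda>u. ?e (u, v))"
        by (rule continuous_on_compose2) (use w in \<open>auto intro!: continuous_intros\<close>)
      then show "continuous_on {a<..<b} (\<lambda>u. ?e (u, v) \<bullet> e0)" by (intro continuous_intros)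
      fix u assume u: "u \<in> {a<..<b}"
      have "e0 \<bullet> e0 = 1" using e0 by (simp add: dir_def norm_eq_1)
      then show "?e (u, v) \<bullet> e0 = 1 \<or> ?e (u, v) \<bullet> e0 = -1"
        using pm[OF _ d[OF u]] u w by auto
    qed simp
    then obtain \<sigma> where s: "\<And>u. u \<in> {a<..<b} \<Longrightarrow> ?e (u, v) \<bullet> e0 = \<sigma>" "\<sigma> = 1 \<or> \<sigma> = -1" by blast
    have "?e (u, v) = \<sigma> *\<^sub>R e0" if u: "u \<in> {a<..<b}" for u
    proof -
      have "e0 \<bullet> e0 = 1" using e0 by (simp add: dir_def norm_eq_1)
      moreover have "e0 = ?e (u, v) \<or> e0 = - ?e (u, v)" using pm[OF _ d[OF u]] u w by auto
      then have "?e (u, v) = e0 \<or> ?e (u, v) = - e0" by (metis add.inverse_inverse)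
      ultimately show ?thesis using s(1)[OF u] by (metis inner_minus_left scaleR_minus1_left scaleR_one)
    qed
    then have "?e (u, v) = \<sigma> *\<^sub>R e0" "?e (u0, v) = \<sigma> *\<^sub>R e0" using w lc.u0 by auto
    then show ?thesis using s(2) d[of u] w dir_neg by auto
  qed
  obtain eps R E P Q p q xi eta xi' eta' k om where nb: "nbox eps R E P Q p q xi eta xi' eta'"
    and cont: "continuous_on ({-eps<..<eps} \<times> {-eps<..<eps}) (\<lambda>z. (k (fst z) (snd z), om (snd z)))"
    and inj: "inj_on (\<lambda>z. (k (fst z) (snd z), om (snd z))) ({-eps<..<eps} \<times> {-eps<..<eps})"
    and at0: "k 0 0 = u0" "om 0 = v0" "E 0 = ?e (u0, v0)"
    and nf: "\<And>s w. \<bar>s\<bar> < eps \<Longrightarrow> \<bar>w\<bar> < eps \<Longrightarrow> (k s w, om w) \<in> {a<..<b} \<times> {c<..<d} \<and> (f \<circ> \<psi>) (k s w, om w) = nbox.h R P Q xi eta s w \<and>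
      (N \<circ> \<psi>) (k s w, om w) = cross3 (E w) (nbox.T P Q xi' eta' s w)"
  proof (rule lc.normal_form)
    fix u v assume w: "(u, v) \<in> {a<..<b} \<times> {c<..<d}"
    show "?e (u, v) = ?e (u0, v)" using ec[OF w] by blast
    have "\<psi> (u0, v) \<in> leaf (\<psi> (u, v))" using chart_leaf[OF fch, of v u0 u] w lc.u0 by (auto simp: leaf_eq)
    then have "(f (\<psi> (u0, v)) - f (\<psi> (u, v))) \<bullet> ?e (u0, v) = 0" using ec[OF w] by (simp add: dir_def)
    then show "((f \<circ> \<psi>) (u, v) - (f \<circ> \<psi>) (u0, v)) \<bullet> ?e (u0, v) = 0" by (simp add: inner_diff_left)
  qed (rule that)
  let ?sq = "{-eps<..<eps} \<times> {-eps<..<eps}"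
  define gg where "gg z = (k (fst z) (snd z), om (snd z))" for z
  have ggW: "gg ` ?sq \<subseteq> {a<..<b} \<times> {c<..<d}" 
  proof (rule image_subsetI)
    fix z assume "z \<in> ?sq"
    then have "\<bar>fst z\<bar> < eps" "\<bar>snd z\<bar> < eps" by (auto simp: mem_Times_iff)
    then show "gg z \<in> {a<..<b} \<times> {c<..<d}" using nf by (simp add: gg_def)
  qed
  have op: "open (gg ` ?sq)"
    by (rule invariance_of_domain) (use cont inj in \<open>auto simp: gg_def[abs_def] open_Times\<close>)
  obtain gi where gi: "homeomorphism ?sq (gg ` ?sq) gg gi"
    using invariance_of_domain_homeomorphism[of ?sq gg] cont inj by (auto simp: gg_def[abs_def] open_Times)
  define chi where "chi = \<psi> \<circ> gg"
  have "homeomorphism (gg ` ?sq) (\<psi> ` gg ` ?sq) \<psi> g"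
    by (rule homeomorphism_of_subsets[OF g ggW]) auto
  from homeomorphism_compose[OF gi this] have hom: "homeomorphism ?sq (chi ` ?sq) chi (gi \<circ> g)"
    by (simp add: chi_def image_comp)
  have "openin (top_of_set (\<psi> ` ({a<..<b} \<times> {c<..<d}))) (\<psi> ` gg ` ?sq)"
    using homeomorphism_imp_open_map[OF g] op ggW by (simp add: open_Times openin_open_eq)
  moreover have "open (\<psi> ` ({a<..<b} \<times> {c<..<d}))" using lp by (simp add: local_param_def)
  ultimately have opx: "open (chi ` ?sq)" by (simp add: chi_def image_comp openin_open_eq)
  have chi: "chi (s, w) = \<psi> (k s w, om w)" for s w by (simp add: chi_def gg_def)
  interpret nb: nbox eps R E P Q p q xi eta xi' eta' by (rule nb)
  have bx: "box f F N eps R E P Q p q xi eta xi' eta' chi"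
  proof
    show "leaf (chi (s, w)) = leaf (chi (0, w))" if "\<bar>s\<bar> < eps" "\<bar>w\<bar> < eps" for s w
      using chart_leaf[OF fch] nf[OF that] nf[of 0 w] that nb.eps by (simp add: chi)
  qed (use opx hom nf in \<open>auto simp: chi\<close>)
  have chi0: "chi (0, 0) = p0" using at0 w0 uv by (simp add: chi)
  have "e = E 0 \<or> e = - E 0" using pm[of u0 v0 e] dir w0 uv at0(3) by simp
  then show thesis
  proof
    assume "e = E 0" then show thesis using that[OF bx chi0] by simp
  next
    \<comment> \<open>The box came with the opposite direction; a half turn of its parameter square
      corrects this without changing its image.\<close>
    assume e: "e = - E 0"
    interpret bx: box f F N eps R E P Q p q xi eta xi' eta' chi by (rule bx)
    interpret nb': nbox eps "\<lambda>w. R (- w)" "\<lambda>w. - E (- w)" "\<lambda>w. - P (- w)" "\<lambda>w. Q (- w)"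
      "\<lambda>w. - p (- w)" "\<lambda>w. q (- w)" "\<lambda>s. - xi (- s)" "\<lambda>s. eta (- s)" "\<lambda>s. xi' (- s)" "\<lambda>s. - eta' (- s)"
      by (rule nbox_flip[OF nb])
    have m: "- z \<in> ?sq" if "z \<in> ?sq" for z :: "real \<times> real" using that by (auto simp: mem_Times_iff)
    have him: "uminus ` ?sq = ?sq"
    proof
      show "uminus ` ?sq \<subseteq> ?sq" using m by blast
      show "?sq \<subseteq> uminus ` ?sq"
      proof
        fix z assume "z \<in> ?sq"
        then show "z \<in> uminus ` ?sq" using m[of z] by (intro image_eqI[of _ _ "- z"]) auto
      qed
    qed
    have hu: "homeomorphism ?sq ?sq uminus uminus"
      using him by (auto simp: homeomorphism_def intro!: continuous_intros)
    have hom': "homeomorphism ?sq (chi ` ?sq) (chi \<circ> uminus) (uminus \<circ> (gi \<circ> g))"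
      by (rule homeomorphism_compose[OF hu hom])
    have im: "(chi \<circ> uminus) ` ?sq = chi ` ?sq" using him by (metis image_comp)
    have "box f F N eps (\<lambda>w. R (- w)) (\<lambda>w. - E (- w)) (\<lambda>w. - P (- w)) (\<lambda>w. Q (- w))
      (\<lambda>w. - p (- w)) (\<lambda>w. q (- w)) (\<lambda>s. - xi (- s)) (\<lambda>s. eta (- s)) (\<lambda>s. xi' (- s)) (\<lambda>s. - eta' (- s)) (chi \<circ> uminus)"
    proof
      show "open ((chi \<circ> uminus) ` ?sq)" unfolding im by (rule opx)
      show "\<exists>g. homeomorphism ?sq ((chi \<circ> uminus) ` ?sq) (chi \<circ> uminus) g" unfolding im using hom' by blast
      fix s w assume sw: "\<bar>s\<bar> < eps" "\<bar>w\<bar> < eps"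
      show "f ((chi \<circ> uminus) (s, w)) = nb'.h s w" using bx.f_box[of "- s" "- w"] sw by (simp add: nb.h_def nb'.h_def)
      have "nb'.T s w = - nb.T (- s) (- w)" by (simp add: nb.T_def nb'.T_def)
      then show "N ((chi \<circ> uminus) (s, w)) = cross3 (- E (- w)) (nb'.T s w)" using bx.N_box[of "- s" "- w"] sw by simp
      show "leaf ((chi \<circ> uminus) (s, w)) = leaf ((chi \<circ> uminus) (0, w))" using bx.leaf_box[of "- s" "- w"] sw by simp
    qed
    then show thesis by (rule that) (use chi0 e in auto)
  qed
qed

end

section \<open>Coordinates of curves in a box\<close>

context box
begin

abbreviation "sq \<equiv> {-eps<..<eps} \<times> {-eps<..<eps}"
definition "co = inv_into sq chi"

lemma center: "0 \<in> {-eps<..<eps}" "(0, 0) \<in> sq" "\<bar>0\<bar> < eps" using eps by auto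

lemma co_chi: "z \<in> sq \<Longrightarrow> co (chi z) = z"
proof -
  have "inj_on chi sq" using box_homeo by (auto simp: homeomorphism_def intro: inj_on_inverseI)
  then show "z \<in> sq \<Longrightarrow> co (chi z) = z" by (simp add: co_def)
qed

lemma chi_co: "x \<in> chi ` sq \<Longrightarrow> chi (co x) = x" "x \<in> chi ` sq \<Longrightarrow> co x \<in> sq"
  unfolding co_def by (simp_all add: f_inv_into_f inv_into_into)

lemma chi_cont: "continuous_on sq chi" using box_homeo by (auto simp: homeomorphism_def)

lemma co_cont: "continuous_on (chi ` sq) co"
proof -
  obtain g where g: "homeomorphism sq (chi ` sq) chi g" using box_homeo by blast
  then have "co x = g x" if "x \<in> chi ` sq" for x
    using that co_chi by (auto simp: homeomorphism_def)
  then show ?thesis using g by (simp add: homeomorphism_def cong: continuous_on_cong)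
qed

lemma E_nonzero: "\<bar>w\<bar> < eps \<Longrightarrow> E w \<noteq> - E w"
proof
  assume w: "\<bar>w\<bar> < eps" and "E w = - E w"
  then have "2 *\<^sub>R E w = 0" by (simp add: scaleR_2 eq_neg_iff_add_eq_0)
  then show False using frame(1)[OF w] by simp
qed

text \<open>A direction is orthogonal to the leaf tangent \<open>T\<close> and to the normal
  \<open>cross3 E T\<close>, which leaves only the two signs of \<open>E\<close>. Both occur,
  because some direction exists and its negative is one as well.\<close>

lemma dir_box:
  assumes "\<bar>s\<bar> < eps" "\<bar>w\<bar> < eps"
  shows "dir (chi (s, w)) e \<longleftrightarrow> e = E w \<or> e = - E w"
proof -
  have *: "e = E w \<or> e = - E w" if d: "dir (chi (s, w)) e" for e
  proof -
    have lf: "chi (s', w) \<in> leaf (chi (s, w))" if "\<bar>s'\<bar> < eps" for s'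
      using leaf_box[OF assms] leaf_box[OF that assms(2)] by (simp add: leaf_eq)
    have "((\<lambda>x. (x, w)) has_derivative (\<lambda>h. (h, 0))) (at s)"
      by (intro has_derivative_Pair has_derivative_ident has_derivative_const)
    from has_derivative_compose[OF this h_has_derivative[OF assms]]
    have hv: "((\<lambda>s. h s w) has_vector_derivative T s w) (at s)"
      by (simp add: has_vector_derivative_def)
    have eq: "h y w \<bullet> e = h s w \<bullet> e" if "y \<in> {-eps<..<eps}" for y
    proof -
      have y: "\<bar>y\<bar> < eps" using that by auto
      have "(f (chi (y, w)) - f (chi (s, w))) \<bullet> e = 0" using d lf[OF y] by (simp add: dir_def)
      then show ?thesis by (simp add: f_box[OF y assms(2)] f_box[OF assms] inner_diff_left)
    qed
    have Te: "T s w \<bullet> e = 0"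
      using inner_const_derivative[OF hv has_vector_derivative_const open_greaterThanLessThan[of "-eps" eps] _ eq] assms(1) by force
    have Ne: "e \<bullet> N (chi (s, w)) = 0" using d leaf_in(2) by (simp add: dir_def)
    note t = T_frame[OF assms]
    have EE: "cross3 (T s w) (cross3 (E w) (T s w)) = E w"
      using frame3(5)[OF frame(1)[OF assms(2)] t(1,2)] .
    have "norm (cross3 (E w) (T s w)) = 1" "T s w \<bullet> cross3 (E w) (T s w) = 0"
      using frame3[OF frame(1)[OF assms(2)] t(1,2)] by auto
    from unit_orthogonal_to_frame[OF t(1) this, of e] show ?thesis
      using d Te Ne EE by (simp add: dir_def N_box[OF assms] inner_commute)
  qed
  obtain e0 where "dir (chi (s, w)) e0" using dir_exists by blast
  then show ?thesis using * dir_neg by (metis add.inverse_inverse)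
qed

text \<open>\<open>A\<close> inverts the derivative of \<open>h\<close> at the point on the tangent
  plane, so \<open>G\<close> has the identity as derivative there. Composed with the continuous
  coordinates of the curve, \<open>G\<close> gives the differentiable function
  \<open>A (f (c t))\<close>, and the derivative is lifted through \<open>G\<close>.\<close>

lemma coordinates:
  assumes c: "isCont c t" "c t \<in> chi ` sq" and d: "((\<lambda>t. f (c t)) has_vector_derivative D) (at t)"
  defines "s \<equiv> \<lambda>t. fst (co (c t))" and "w \<equiv> \<lambda>t. snd (co (c t))"
  shows "(s has_real_derivative D \<bullet> T (s t) (w t)) (at t)"
    "(w has_real_derivative (D \<bullet> E (w t)) / Lam (s t) (w t)) (at t)"
proof -
  have sw: "\<bar>s t\<bar> < eps" "\<bar>w t\<bar> < eps" using chi_co(2)[OF c(2)] by (auto simp: s_def w_def mem_Times_iff)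
  define A where "A y = (y \<bullet> T (s t) (w t), (y \<bullet> E (w t)) / Lam (s t) (w t))" for y
  have A: "bounded_linear A"
    unfolding A_def by (intro bounded_linear_Pair bounded_linear_inner_left bounded_linear_compose[OF bounded_linear_divide bounded_linear_inner_left])
  have isc: "isCont (\<lambda>t. co (c t)) t"
    using isCont_o2[OF c(1)] co_cont box_open c(2) continuous_on_eq_continuous_at by blast
  define G where "G z = A (h (fst z) (snd z))" for z
  have Gd: "(G has_derivative (\<lambda>k. k)) (at (co (c t)))"
  proof -
    have "(G has_derivative (\<lambda>k. A (fst k *\<^sub>R T (s t) (w t) + snd k *\<^sub>R Lam (s t) (w t) *\<^sub>R E (w t)))) (at (s t, w t))"
      unfolding G_def by (rule bounded_linear.has_derivative[OF A h_has_derivative[OF sw]])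
    then show ?thesis
      using T_frame[OF sw] frame_more[OF sw(2)] Lam_nonzero[OF sw]
      by (simp add: A_def inner_add_left s_def w_def)
  qed
  have "\<forall>\<^sub>F t' in at t. c t' \<in> chi ` sq"
    using topological_tendstoD[OF c(1)[unfolded isCont_def] box_open c(2)] .
  then have "\<forall>\<^sub>F t' in nhds t. c t' \<in> chi ` sq"
    using c(2) by (simp add: eventually_nhds_conv_at)
  then obtain S where S: "open S" "t \<in> S" "\<And>t'. t' \<in> S \<Longrightarrow> c t' \<in> chi ` sq"
    unfolding eventually_nhds by blast
  have eq: "A (f (c t')) = G (co (c t'))" if "c t' \<in> chi ` sq" for t'
  proof -
    have "\<bar>fst (co (c t'))\<bar> < eps" "\<bar>snd (co (c t'))\<bar> < eps" using chi_co(2)[OF that] by (auto simp: mem_Times_iff)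
    from f_box[OF this] chi_co(1)[OF that] show ?thesis by (simp add: G_def)
  qed
  have "((\<lambda>t. A (f (c t))) has_vector_derivative A D) (at t)"
    by (rule bounded_linear.has_vector_derivative[OF A d])
  then have "((\<lambda>t. G (co (c t))) has_vector_derivative A D) (at t)"
    by (rule has_vector_derivative_transform_within_open[OF _ S(1,2)]) (use eq S(3) in simp)
  from has_vector_derivative_lift[OF Gd isc this]
  have v: "((\<lambda>t. co (c t)) has_vector_derivative A D) (at t)" .
  show "(s has_real_derivative D \<bullet> T (s t) (w t)) (at t)"
    using bounded_linear.has_vector_derivative[OF bounded_linear_fst v]
    by (simp add: s_def has_real_derivative_iff_has_vector_derivative A_def)
  show "(w has_real_derivative (D \<bullet> E (w t)) / Lam (s t) (w t)) (at t)"
    using bounded_linear.has_vector_derivative[OF bounded_linear_snd v]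
    by (simp add: w_def has_real_derivative_iff_has_vector_derivative A_def)
qed

end

section \<open>Leaf curves and trajectories\<close>

lemma at_within_Ioo_nontrivial:
  fixes a b c :: real
  assumes "a < b" "c \<in> {a..b}"
  shows "at c within {a<..<b} \<noteq> bot"
proof -
  have "c islimpt {a<..<b}"
    using assms islimpt_greaterThanLessThan1[of a b] islimpt_greaterThanLessThan2[of a b]
      interior_limit_point[of c "{a<..<b}"]
    by (cases "c = a \<or> c = b") (auto simp: interior_open)
  then show ?thesis using trivial_limit_within by blast
qed

text \<open>The point \<open>c\<close> may be an end point of the interval, where only a limit of
  \<open>F\<close> is known. This is the situation in which a curve has to be continued.\<close>

lemma has_derivative_zero_limit:
  fixes F :: "real \<Rightarrow> real"
  assumes "a < b" "c \<in> {a..b}" "\<And>t. t \<in> {a<..<b} \<Longrightarrow> (F has_real_derivative 0) (at t)"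
    and "(F \<longlongrightarrow> l) (at c within {a<..<b})" "t \<in> {a<..<b}"
  shows "F t = l"
proof -
  have "F t' = F t" if "t' \<in> {a<..<b}" for t'
  proof (rule has_derivative_zero_unique_connected[of "{a<..<b}" F, OF _ _ _ that assms(5)])
    show "(F has_derivative (\<lambda>x. 0)) (at x)" if "x \<in> {a<..<b}" for x
      using assms(3)[OF that] by (simp add: has_field_derivative_def lambda_zero)
  qed simp_all
  then have "\<forall>\<^sub>F t' in at c within {a<..<b}. F t' = F t"
    by (auto simp: eventually_at_filter)
  then have "((\<lambda>_. F t) \<longlongrightarrow> l) (at c within {a<..<b})"
    by (rule Lim_transform_eventually[OF assms(4)])
  from tendsto_unique[OF at_within_Ioo_nontrivial[OF assms(1,2)] tendsto_const this] show ?thesis .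
qed

lemma connected_local_iff:
  assumes "connected I" "t0 \<in> I" "P t0"
    and "\<And>t. t \<in> I \<Longrightarrow> \<exists>U. open U \<and> t \<in> U \<and> (\<forall>t'\<in>U \<inter> I. P t' \<longleftrightarrow> P t)"
    and "t \<in> I"
  shows "P t"
proof -
  have "eventually (\<lambda>t'. P t = P t') (at t within I)" if *: "t \<in> I" for t
  proof -
    obtain U where "open U" "t \<in> U" "\<forall>t'\<in>U \<inter> I. P t' \<longleftrightarrow> P t" using assms(4)[OF *] by blast
    then show ?thesis unfolding eventually_at_topological by blast
  qed
  then have "P t0 = P t" using connected_local_const[OF assms(1,2,5), of P] by blast
  then show ?thesis using assms(3) by simp
qed

text \<open>The set of coincidence is closed because the space is Hausdorff, and open by the last
  hypothesis on local agreement.\<close>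

lemma isCont_agree:
  fixes x y :: "real \<Rightarrow> 'a::t2_space"
  assumes "a < b" "t0 \<in> {a<..<b}" "x t0 = y t0"
    and "\<And>t. t \<in> {a<..<b} \<Longrightarrow> isCont x t" "\<And>t. t \<in> {a<..<b} \<Longrightarrow> isCont y t"
    and "\<And>t. t \<in> {a<..<b} \<Longrightarrow> x t = y t \<Longrightarrow> \<exists>d>0. \<forall>t'\<in>{a<..<b}. \<bar>t' - t\<bar> < d \<longrightarrow> x t' = y t'"
    and "t \<in> {a<..<b}"
  shows "x t = y t"
proof (rule connected_local_iff[where P = "\<lambda>t. x t = y t", OF _ assms(2,3) _ assms(7)])
  fix t assume t: "t \<in> {a<..<b}"
  show "\<exists>U. open U \<and> t \<in> U \<and> (\<forall>t'\<in>U \<inter> {a<..<b}. x t' = y t' \<longleftrightarrow> x t = y t)"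
  proof (cases "x t = y t")
    case True
    then obtain d where "d > 0" "\<forall>t'\<in>{a<..<b}. \<bar>t' - t\<bar> < d \<longrightarrow> x t' = y t'" using assms(6)[OF t] by blast
    then show ?thesis using True by (intro exI[of _ "ball t d"]) (auto simp: dist_real_def abs_minus_commute)
  next
    case False
    then obtain U V where UV: "open U" "open V" "x t \<in> U" "y t \<in> V" "U \<inter> V = {}" using hausdorff by metis
    have "\<forall>\<^sub>F t' in nhds t. x t' \<in> U" "\<forall>\<^sub>F t' in nhds t. y t' \<in> V"
      using topological_tendstoD[OF assms(4)[OF t, unfolded isCont_def] UV(1,3)]
        topological_tendstoD[OF assms(5)[OF t, unfolded isCont_def] UV(2,4)] UV
      by (simp_all add: eventually_nhds_conv_at)
    then have "\<forall>\<^sub>F t' in nhds t. x t' \<in> U \<and> y t' \<in> V" by (rule eventually_conj)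
    then obtain S where "open S" "t \<in> S" "\<forall>t'\<in>S. x t' \<in> U \<and> y t' \<in> V" unfolding eventually_nhds by blast
    then show ?thesis using False UV(5) by (intro exI[of _ S]) auto
  qed
qed simp

lemma isCont_cong_open: "open S \<Longrightarrow> t \<in> S \<Longrightarrow> (\<And>t'. t' \<in> S \<Longrightarrow> x t' = y t') \<Longrightarrow> isCont x t \<longleftrightarrow> isCont y t"
  by (rule isCont_cong) (auto simp: eventually_nhds)

lemma vector_derivative_shift:
  fixes c d t :: real and H :: "real \<Rightarrow> 'a::real_normed_vector"
  assumes "(H has_vector_derivative D) (at (c + d * t))"
  shows "((\<lambda>t. H (c + d * t)) has_vector_derivative d *\<^sub>R D) (at t)"
proof -
  have "((\<lambda>t. c + d * t) has_vector_derivative d) (at t)"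
    by (auto intro!: derivative_eq_intros simp: has_real_derivative_iff_has_vector_derivative[symmetric])
  from vector_diff_chain_at[OF this assms] show ?thesis by (simp add: o_def)
qed

lemma isCont_shift: "isCont H (c + d * t :: real) \<Longrightarrow> isCont (\<lambda>t. H (c + d * t)) t"
  by (rule isCont_o2[where g = H]) (auto intro!: continuous_intros)

context pgf
begin

text \<open>Traversing a leaf with unit speed: the velocity is tangent to the surface and orthogonal
  to \<open>e\<close>. One vector \<open>e\<close> serves for all times, since the plane of a leaf
  does not change. Stated at a single time so that curves can be glued.\<close>

definition "leaf_at e \<gamma> t \<longleftrightarrow> isCont \<gamma> t \<and> dir (\<gamma> t) e \<and>
  ((\<lambda>t. f (\<gamma> t)) has_vector_derivative cross3 (N (\<gamma> t)) e) (at t)"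

text \<open>The curve carries its direction along, since only continuity of the pair singles out one
  of the two signs. The factor \<open>g\<close> admits trajectories with variable speed, as they
  arise by moving along the leaves.\<close>

definition "traj_at g \<Gamma> t \<longleftrightarrow> isCont (\<lambda>t. fst (\<Gamma> t)) t \<and> isCont (\<lambda>t. snd (\<Gamma> t)) t \<and> dir (fst (\<Gamma> t)) (snd (\<Gamma> t)) \<and>
  ((\<lambda>t. f (fst (\<Gamma> t))) has_vector_derivative (g t :: real) *\<^sub>R snd (\<Gamma> t)) (at t)"

lemma leaf_at_cong:
  assumes "open S" "t \<in> S" "\<And>t'. t' \<in> S \<Longrightarrow> \<gamma> t' = \<gamma>' t'" "leaf_at e \<gamma> t"
  shows "leaf_at e \<gamma>' t"
  using assms has_vector_derivative_transform_within_open[of "\<lambda>t. f (\<gamma> t)" _ t S "\<lambda>t. f (\<gamma>' t)"] isCont_cong_open[of S t \<gamma> \<gamma>']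
  by (simp add: leaf_at_def)

lemma traj_at_cong:
  assumes "open S" "t \<in> S" "\<And>t'. t' \<in> S \<Longrightarrow> \<Gamma> t' = \<Gamma>' t'" "traj_at g \<Gamma> t"
  shows "traj_at g \<Gamma>' t"
  using assms has_vector_derivative_transform_within_open[of "\<lambda>t. f (fst (\<Gamma> t))" _ t S "\<lambda>t. f (fst (\<Gamma>' t))"]
    isCont_cong_open[of S t "\<lambda>t. fst (\<Gamma> t)" "\<lambda>t. fst (\<Gamma>' t)"] isCont_cong_open[of S t "\<lambda>t. snd (\<Gamma> t)" "\<lambda>t. snd (\<Gamma>' t)"]
  by (simp add: traj_at_def)

lemma leaf_at_shift: "leaf_at e \<gamma> (c + t) \<Longrightarrow> leaf_at e (\<lambda>t. \<gamma> (c + t)) t"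
  using vector_derivative_shift[of "\<lambda>t. f (\<gamma> t)" _ c 1 t] isCont_shift[where H = \<gamma> and c = c and d = 1 and t = t] by (simp add: leaf_at_def)

lemma leaf_at_reverse: "leaf_at e \<gamma> (- t) \<Longrightarrow> leaf_at (- e) (\<lambda>t. \<gamma> (- t)) t"
  using vector_derivative_shift[of "\<lambda>t. f (\<gamma> t)" _ 0 "-1" t] isCont_shift[where H = \<gamma> and c = 0 and d = "-1" and t = t] dir_neg by (simp add: leaf_at_def)

end

context box
begin

lemma chi_isCont: "\<bar>s\<bar> < eps \<Longrightarrow> \<bar>w\<bar> < eps \<Longrightarrow> isCont chi (s, w)"
proof -
  assume "\<bar>s\<bar> < eps" "\<bar>w\<bar> < eps"
  then have "(s, w) \<in> sq" by auto
  moreover have "open sq" by (simp add: open_Times)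
  ultimately show ?thesis using continuous_on_eq_continuous_at[of sq chi] chi_cont by metis
qed

lemma co_isCont: "x \<in> chi ` sq \<Longrightarrow> isCont co x"
  using continuous_on_eq_continuous_at[OF box_open, of co] co_cont by metis

lemma leaf_at_box:
  assumes \<sigma>: "\<sigma> = 1 \<or> \<sigma> = -1" and "e = \<sigma> *\<^sub>R E w" "\<bar>w\<bar> < eps" "\<bar>c + \<sigma> * t\<bar> < eps"
  shows "leaf_at e (\<lambda>t. chi (c + \<sigma> * t, w)) t"
proof -
  have "((\<lambda>x. (x, w)) has_derivative (\<lambda>h. (h, 0))) (at (c + \<sigma> * t))"
    by (intro has_derivative_Pair has_derivative_ident has_derivative_const)
  from has_derivative_compose[OF this h_has_derivative[OF assms(4,3)]]
  have "((\<lambda>s. h s w) has_vector_derivative T (c + \<sigma> * t) w) (at (c + \<sigma> * t))"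
    by (simp add: has_vector_derivative_def)
  then have "((\<lambda>s. f (chi (s, w))) has_vector_derivative T (c + \<sigma> * t) w) (at (c + \<sigma> * t))"
    by (rule has_vector_derivative_transform_within_open[of _ _ _ "{-eps<..<eps}"]) (use assms f_box in \<open>auto simp: abs_less_iff\<close>)
  from vector_derivative_shift[OF this]
  have 1: "((\<lambda>t. f (chi (c + \<sigma> * t, w))) has_vector_derivative \<sigma> *\<^sub>R T (c + \<sigma> * t) w) (at t)" .
  have "cross3 (N (chi (c + \<sigma> * t, w))) e = \<sigma> *\<^sub>R T (c + \<sigma> * t) w"
    using T_frame(5)[OF assms(4,3)] by (simp add: N_box[OF assms(4,3)] assms(2) cross_mult_right)
  moreover have "isCont chi (c + \<sigma> * t, w)"
    by (rule chi_isCont[OF assms(4,3)])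
  then have "isCont (\<lambda>t. chi (c + \<sigma> * t, w)) t"
    using isCont_o2[of t "\<lambda>t. (c + \<sigma> * t, w)" chi] by (simp add: isCont_Pair)
  moreover have "dir (chi (c + \<sigma> * t, w)) e"
    using dir_box[OF assms(4,3), of e] \<sigma> assms(2) by (metis scaleR_minus1_left scaleR_one)
  ultimately show ?thesis using 1 by (simp add: leaf_at_def)
qed

lemma traj_at_box:
  assumes \<sigma>: "\<sigma> = 1 \<or> \<sigma> = -1" and "\<bar>c + \<sigma> * t\<bar> < eps"
  shows "traj_at (\<lambda>_. 1) (\<lambda>t. (chi (0, c + \<sigma> * t), \<sigma> *\<^sub>R E (c + \<sigma> * t))) t"
proof -
  note z = center(3) assms(2)
  have "((\<lambda>w. f (chi (0, w))) has_vector_derivative E (c + \<sigma> * t)) (at (c + \<sigma> * t))"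
    by (rule has_vector_derivative_transform_within_open[OF R'[OF assms(2)], of "{-eps<..<eps}"])
      (use assms f_box[OF center(3)] init_simps in \<open>auto simp: abs_less_iff\<close>)
  from vector_derivative_shift[OF this]
  have 1: "((\<lambda>t. f (chi (0, c + \<sigma> * t))) has_vector_derivative \<sigma> *\<^sub>R E (c + \<sigma> * t)) (at t)" .
  have "isCont chi (0, c + \<sigma> * t)"
    by (rule chi_isCont[OF z])
  then have "isCont (\<lambda>t. chi (0, c + \<sigma> * t)) t"
    using isCont_o2[of t "\<lambda>t. (0, c + \<sigma> * t)" chi] by (simp add: isCont_Pair)
  moreover have "isCont E (c + \<sigma> * t)"
    using smooth_on_imp_continuous_on[OF smooth(2)] assms(2) by (simp add: continuous_on_eq_continuous_at abs_less_iff)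
  then have "isCont (\<lambda>t. \<sigma> *\<^sub>R E (c + \<sigma> * t)) t"
    using isCont_shift by (intro continuous_intros) auto
  ultimately show ?thesis using 1 dir_box[OF z] \<sigma> by (fastforce simp: traj_at_def)
qed

text \<open>Shrinks the interval around \<open>c\<close>, which may be interior or an end point,
  until the curve lies in the box. Only its limit at \<open>c\<close> is prescribed, so the lemma
  also applies to a curve that is not yet defined at \<open>c\<close>.\<close>

lemma curve_enters_box:
  fixes a b c :: real
  assumes "a < b" "c \<in> {a..b}" "\<And>t. t \<in> {a<..<b} \<Longrightarrow> isCont \<gamma> t" "(\<gamma> \<longlongrightarrow> chi (0, 0)) (at c within {a<..<b})"
  obtains d a' b' where "d > 0" "a' < b'" "c \<in> {a'..b'}" "{a'<..<b'} \<subseteq> {a<..<b}"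
    "\<And>t. t \<in> {a'<..<b'} \<Longrightarrow> \<gamma> t \<in> chi ` sq" "\<And>t. t \<in> {a<..<b} \<Longrightarrow> \<bar>t - c\<bar> < d \<Longrightarrow> t \<in> {a'<..<b'}"
    "((\<lambda>t. fst (co (\<gamma> t))) \<longlongrightarrow> 0) (at c within {a'<..<b'})" "((\<lambda>t. snd (co (\<gamma> t))) \<longlongrightarrow> 0) (at c within {a'<..<b'})"
proof -
  have 0: "chi (0, 0) \<in> chi ` sq" using center by blast
  have "\<forall>\<^sub>F t in at c within {a<..<b}. \<gamma> t \<in> chi ` sq"
    using topological_tendstoD[OF assms(4) box_open 0] .
  then obtain d where d: "d > 0" "\<And>t. t \<in> {a<..<b} \<Longrightarrow> t \<noteq> c \<Longrightarrow> \<bar>t - c\<bar> < d \<Longrightarrow> \<gamma> t \<in> chi ` sq"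
    unfolding eventually_at dist_real_def by blast
  have c: "\<gamma> c \<in> chi ` sq" if "c \<in> {a<..<b}"
  proof -
    have "(\<gamma> \<longlongrightarrow> \<gamma> c) (at c)" using assms(3)[OF that] by (simp add: isCont_def)
    then have "(\<gamma> \<longlongrightarrow> \<gamma> c) (at c within {a<..<b})" by (rule tendsto_within_subset) simp
    from tendsto_unique[OF at_within_Ioo_nontrivial[OF assms(1,2)] this assms(4)] have "\<gamma> c = chi (0, 0)" .
    then show ?thesis using 0 by simp
  qed
  define a' b' where "a' = max a (c - d)" and "b' = min b (c + d)"
  have sub: "{a'<..<b'} \<subseteq> {a<..<b}" by (auto simp: a'_def b'_def)
  have lim: "((\<lambda>t. co (\<gamma> t)) \<longlongrightarrow> (0, 0)) (at c within {a'<..<b'})"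
  proof -
    have "(\<gamma> \<longlongrightarrow> chi (0, 0)) (at c within {a'<..<b'})" using assms(4) sub by (rule tendsto_within_subset)
    moreover have "isCont co (chi (0, 0))" by (rule co_isCont[OF 0])
    ultimately have "((\<lambda>t. co (\<gamma> t)) \<longlongrightarrow> co (chi (0, 0))) (at c within {a'<..<b'})"
      by (rule isCont_tendsto_compose[rotated])
    then show ?thesis using co_chi[OF center(2)] by simp
  qed
  show thesis
  proof (rule that[of d a' b'])
    show "a' < b'" "c \<in> {a'..b'}" using assms(1,2) d(1) by (auto simp: a'_def b'_def)
    show "\<gamma> t \<in> chi ` sq" if "t \<in> {a'<..<b'}" for t
      using d(2)[of t] c that by (cases "t = c") (auto simp: a'_def b'_def)
    show "t \<in> {a'<..<b'}" if "t \<in> {a<..<b}" "\<bar>t - c\<bar> < d" for t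
      using that by (auto simp: a'_def b'_def abs_less_iff)
    show "((\<lambda>t. fst (co (\<gamma> t))) \<longlongrightarrow> 0) (at c within {a'<..<b'})" "((\<lambda>t. snd (co (\<gamma> t))) \<longlongrightarrow> 0) (at c within {a'<..<b'})"
      using tendsto_fst[OF lim] tendsto_snd[OF lim] by simp_all
  qed (use sub d(1) in auto)
qed

lemma co_bounds:
  assumes "x \<in> chi ` sq"
  shows "\<bar>fst (co x)\<bar> < eps" "\<bar>snd (co x)\<bar> < eps" "chi (fst (co x), snd (co x)) = x"
  using chi_co[OF assms] by (auto simp: mem_Times_iff)

text \<open>Applied with a constant direction for leaf curves and with the transported direction for
  trajectories.\<close>

lemma direction_sign:
  fixes a' b' :: real
  assumes "a' < b'" "\<And>t. t \<in> {a'<..<b'} \<Longrightarrow> \<gamma> t \<in> chi ` sq" "\<And>t. t \<in> {a'<..<b'} \<Longrightarrow> isCont \<gamma> t"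
    and "\<And>t. t \<in> {a'<..<b'} \<Longrightarrow> isCont \<epsilon> t" "\<And>t. t \<in> {a'<..<b'} \<Longrightarrow> dir (\<gamma> t) (\<epsilon> t)"
  obtains \<sigma> where "\<sigma> = 1 \<or> \<sigma> = -1" "\<And>t. t \<in> {a'<..<b'} \<Longrightarrow> \<epsilon> t = \<sigma> *\<^sub>R E (snd (co (\<gamma> t)))"
proof -
  let ?w = "\<lambda>t. snd (co (\<gamma> t))"
  have pm: "\<epsilon> t = E (?w t) \<or> \<epsilon> t = - E (?w t)" "E (?w t) \<bullet> E (?w t) = 1" if "t \<in> {a'<..<b'}" for t
    using dir_box[OF co_bounds(1,2)[OF assms(2)[OF that]], of "\<epsilon> t"] co_bounds(3)[OF assms(2)[OF that]] assms(5)[OF that]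
      frame_more(6)[OF co_bounds(2)[OF assms(2)[OF that]]] by auto
  have "isCont ?w t" "isCont (\<lambda>t. E (?w t)) t" if "t \<in> {a'<..<b'}" for t
  proof -
    have "isCont co (\<gamma> t)" by (rule co_isCont[OF assms(2)[OF that]])
    then show w: "isCont ?w t" using isCont_o2[OF assms(3)[OF that], of co] by (intro continuous_intros) auto
    have "?w t \<in> {-eps<..<eps}" using co_bounds(2)[OF assms(2)[OF that]] by auto
    then have "isCont E (?w t)"
      using smooth_on_imp_continuous_on[OF smooth(2)] by (simp add: continuous_on_eq_continuous_at)
    then show "isCont (\<lambda>t. E (?w t)) t" by (rule isCont_o2[OF w])
  qed
  then have 1: "continuous_on {a'<..<b'} (\<lambda>t. \<epsilon> t \<bullet> E (?w t))"
    using assms(4) by (intro continuous_at_imp_continuous_on ballI continuous_intros) auto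
  have 2: "\<epsilon> t \<bullet> E (?w t) = 1 \<or> \<epsilon> t \<bullet> E (?w t) = -1" if "t \<in> {a'<..<b'}" for t
    using pm[OF that] by auto
  have "\<exists>\<sigma>. (\<sigma> = 1 \<or> \<sigma> = -1) \<and> (\<forall>t\<in>{a'<..<b'}. \<epsilon> t \<bullet> E (?w t) = \<sigma>)"
    by (rule continuous_pm_one[OF connected_Ioo 1 2])
  then obtain \<sigma> where s: "\<sigma> = 1 \<or> \<sigma> = -1" "\<And>t. t \<in> {a'<..<b'} \<Longrightarrow> \<epsilon> t \<bullet> E (?w t) = \<sigma>"
    by blast
  have "\<epsilon> t = \<sigma> *\<^sub>R E (?w t)" if "t \<in> {a'<..<b'}" for t
    using pm[OF that] s(2)[OF that] by auto
  then show thesis using that s(1) by blast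
qed

text \<open>The velocity is \<open>\<sigma>\<close> times \<open>T\<close>, which in box coordinates
  reads \<open>s' = \<sigma>\<close> and \<open>w' = 0\<close>. Integrating from the limit at
  \<open>c\<close> gives a horizontal segment.\<close>

lemma leaf_form:
  assumes ab: "a < b" "c \<in> {a..b}" and lf: "\<And>t. t \<in> {a<..<b} \<Longrightarrow> leaf_at e \<gamma> t" and lim: "(\<gamma> \<longlongrightarrow> chi (0, 0)) (at c within {a<..<b})"
  obtains d \<sigma> where "d > 0" "\<sigma> = 1 \<or> \<sigma> = -1" "e = \<sigma> *\<^sub>R E 0"
    "\<And>t. t \<in> {a<..<b} \<Longrightarrow> \<bar>t - c\<bar> < d \<Longrightarrow> \<bar>t - c\<bar> < eps \<and> \<gamma> t = chi (\<sigma> * (t - c), 0)"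
proof -
  have cont: "isCont \<gamma> t" if "t \<in> {a<..<b}" for t using lf[OF that] by (simp add: leaf_at_def)
  obtain d a' b' where d: "d > 0" "a' < b'" "c \<in> {a'..b'}" "{a'<..<b'} \<subseteq> {a<..<b}"
    "\<And>t. t \<in> {a'<..<b'} \<Longrightarrow> \<gamma> t \<in> chi ` sq" "\<And>t. t \<in> {a<..<b} \<Longrightarrow> \<bar>t - c\<bar> < d \<Longrightarrow> t \<in> {a'<..<b'}"
    "((\<lambda>t. fst (co (\<gamma> t))) \<longlongrightarrow> 0) (at c within {a'<..<b'})" "((\<lambda>t. snd (co (\<gamma> t))) \<longlongrightarrow> 0) (at c within {a'<..<b'})"
    using curve_enters_box[OF ab cont lim] by blast
  let ?s = "\<lambda>t. fst (co (\<gamma> t))" and ?w = "\<lambda>t. snd (co (\<gamma> t))"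
  have in_ab: "t \<in> {a<..<b}" if "t \<in> {a'<..<b'}" for t using d(4) that by blast
  obtain \<sigma> where \<sigma>: "\<sigma> = 1 \<or> \<sigma> = -1" "\<And>t. t \<in> {a'<..<b'} \<Longrightarrow> e = \<sigma> *\<^sub>R E (?w t)"
    using direction_sign[where \<gamma> = \<gamma> and \<epsilon> = "\<lambda>_. e", OF d(2,5)] cont lf in_ab unfolding leaf_at_def by auto
  have der: "(?s has_real_derivative \<sigma>) (at t)" "(?w has_real_derivative 0) (at t)" if t: "t \<in> {a'<..<b'}" for t
  proof -
    note b = co_bounds[OF d(5)[OF t]]
    have "N (\<gamma> t) = cross3 (E (?w t)) (T (?s t) (?w t))" using N_box[OF b(1,2)] b(3) by simp
    then have "cross3 (N (\<gamma> t)) e = \<sigma> *\<^sub>R T (?s t) (?w t)"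
      using T_frame(5)[OF b(1,2)] \<sigma>(2)[OF t] by (metis cross_mult_right)
    then have "((\<lambda>t. f (\<gamma> t)) has_vector_derivative \<sigma> *\<^sub>R T (?s t) (?w t)) (at t)"
      using lf[OF in_ab[OF t]] by (simp add: leaf_at_def)
    from coordinates[OF cont[OF in_ab[OF t]] d(5)[OF t] this] T_frame[OF b(1,2)]
    show "(?s has_real_derivative \<sigma>) (at t)" "(?w has_real_derivative 0) (at t)" by simp_all
  qed
  have w: "?w t = 0" if "t \<in> {a'<..<b'}" for t
    by (rule has_derivative_zero_limit[OF d(2,3) der(2) d(8) that])
  have "?s t - \<sigma> * (t - c) = 0" if "t \<in> {a'<..<b'}" for t
  proof (rule has_derivative_zero_limit[OF d(2,3) _ _ that])
    show "((\<lambda>t. ?s t - \<sigma> * (t - c)) has_real_derivative 0) (at t)" if "t \<in> {a'<..<b'}" for t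
      using der(1)[OF that] by (auto intro!: derivative_eq_intros)
    have "((\<lambda>t. ?s t - \<sigma> * (t - c)) \<longlongrightarrow> 0 - \<sigma> * (c - c)) (at c within {a'<..<b'})"
      by (intro tendsto_intros d(7))
    then show "((\<lambda>t. ?s t - \<sigma> * (t - c)) \<longlongrightarrow> 0) (at c within {a'<..<b'})" by simp
  qed
  then have s: "?s t = \<sigma> * (t - c)" if "t \<in> {a'<..<b'}" for t using that by fastforce
  obtain t1 where t1: "t1 \<in> {a'<..<b'}" using d(2) dense by (metis greaterThanLessThan_iff)
  show thesis
  proof (rule that[OF d(1) \<sigma>(1)])
    show "e = \<sigma> *\<^sub>R E 0" using \<sigma>(2)[OF t1] w[OF t1] by simp
    fix t assume "t \<in> {a<..<b}" "\<bar>t - c\<bar> < d"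
    then have t: "t \<in> {a'<..<b'}" using d(6) by blast
    have "\<bar>\<sigma> * (t - c)\<bar> < eps" using co_bounds(1)[OF d(5)[OF t]] s[OF t] by simp
    then show "\<bar>t - c\<bar> < eps \<and> \<gamma> t = chi (\<sigma> * (t - c), 0)"
      using \<sigma>(1) co_bounds(3)[OF d(5)[OF t]] s[OF t] w[OF t] by (auto simp: abs_mult)
  qed
qed

text \<open>The velocity is a multiple of \<open>E\<close>, so \<open>s' = 0\<close> and
  \<open>s\<close> keeps its limit 0. There \<open>Lam\<close> is 1, so \<open>w\<close> grows at
  the rate \<open>\<sigma> * g\<close> and equals \<open>\<sigma> * \<theta>\<close>.\<close>

lemma traj_form:
  assumes ab: "a < b" "c \<in> {a..b}" and lf: "\<And>t. t \<in> {a<..<b} \<Longrightarrow> traj_at g \<Gamma> t"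
    and \<theta>: "\<And>t. t \<in> {a<..<b} \<Longrightarrow> (\<theta> has_real_derivative g t) (at t)" "(\<theta> \<longlongrightarrow> 0) (at c within {a<..<b})"
    and lim: "((\<lambda>t. fst (\<Gamma> t)) \<longlongrightarrow> chi (0, 0)) (at c within {a<..<b})"
  obtains d \<sigma> where "d > 0" "\<sigma> = 1 \<or> \<sigma> = -1"
    "\<And>t. t \<in> {a<..<b} \<Longrightarrow> \<bar>t - c\<bar> < d \<Longrightarrow> \<bar>\<theta> t\<bar> < eps \<and> \<Gamma> t = (chi (0, \<sigma> * \<theta> t), \<sigma> *\<^sub>R E (\<sigma> * \<theta> t))"
proof -
  let ?\<gamma> = "\<lambda>t. fst (\<Gamma> t)"
  have cont: "isCont ?\<gamma> t" "isCont (\<lambda>t. snd (\<Gamma> t)) t" if "t \<in> {a<..<b}" for t using lf[OF that] by (simp_all add: traj_at_def)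
  obtain d a' b' where d: "d > 0" "a' < b'" "c \<in> {a'..b'}" "{a'<..<b'} \<subseteq> {a<..<b}"
    "\<And>t. t \<in> {a'<..<b'} \<Longrightarrow> ?\<gamma> t \<in> chi ` sq" "\<And>t. t \<in> {a<..<b} \<Longrightarrow> \<bar>t - c\<bar> < d \<Longrightarrow> t \<in> {a'<..<b'}"
    "((\<lambda>t. fst (co (?\<gamma> t))) \<longlongrightarrow> 0) (at c within {a'<..<b'})" "((\<lambda>t. snd (co (?\<gamma> t))) \<longlongrightarrow> 0) (at c within {a'<..<b'})"
    using curve_enters_box[OF ab cont(1) lim] by blast
  let ?s = "\<lambda>t. fst (co (?\<gamma> t))" and ?w = "\<lambda>t. snd (co (?\<gamma> t))"
  have in_ab: "t \<in> {a<..<b}" if "t \<in> {a'<..<b'}" for t using d(4) that by blast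
  obtain \<sigma> where \<sigma>: "\<sigma> = 1 \<or> \<sigma> = -1" "\<And>t. t \<in> {a'<..<b'} \<Longrightarrow> snd (\<Gamma> t) = \<sigma> *\<^sub>R E (?w t)"
    using direction_sign[where \<gamma> = ?\<gamma> and \<epsilon> = "\<lambda>t. snd (\<Gamma> t)", OF d(2,5)] cont lf in_ab unfolding traj_at_def by auto
  have der: "(?s has_real_derivative 0) (at t)" "(?w has_real_derivative (\<sigma> * g t) / Lam (?s t) (?w t)) (at t)" if t: "t \<in> {a'<..<b'}" for t
  proof -
    note b = co_bounds[OF d(5)[OF t]]
    have "((\<lambda>t. f (?\<gamma> t)) has_vector_derivative (\<sigma> * g t) *\<^sub>R E (?w t)) (at t)"
      using lf[OF in_ab[OF t]] \<sigma>(2)[OF t] by (simp add: traj_at_def mult.commute)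
    from coordinates[OF cont(1)[OF in_ab[OF t]] d(5)[OF t] this] T_frame[OF b(1,2)] frame_more[OF b(2)]
    show "(?s has_real_derivative 0) (at t)" "(?w has_real_derivative (\<sigma> * g t) / Lam (?s t) (?w t)) (at t)" by simp_all
  qed
  have s: "?s t = 0" if "t \<in> {a'<..<b'}" for t
    by (rule has_derivative_zero_limit[OF d(2,3) der(1) d(7) that])
  have "?w t - \<sigma> * \<theta> t = 0" if "t \<in> {a'<..<b'}" for t
  proof (rule has_derivative_zero_limit[OF d(2,3) _ _ that])
    show "((\<lambda>t. ?w t - \<sigma> * \<theta> t) has_real_derivative 0) (at t)" if "t \<in> {a'<..<b'}" for t
      using der(2)[OF that] \<theta>(1)[OF in_ab[OF that]] s[OF that] by (auto intro!: derivative_eq_intros simp: init_simps)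
    have "(\<theta> \<longlongrightarrow> 0) (at c within {a'<..<b'})" using \<theta>(2) d(4) by (rule tendsto_within_subset)
    then have "((\<lambda>t. ?w t - \<sigma> * \<theta> t) \<longlongrightarrow> 0 - \<sigma> * 0) (at c within {a'<..<b'})"
      by (intro tendsto_intros d(8))
    then show "((\<lambda>t. ?w t - \<sigma> * \<theta> t) \<longlongrightarrow> 0) (at c within {a'<..<b'})" by simp
  qed
  then have w: "?w t = \<sigma> * \<theta> t" if "t \<in> {a'<..<b'}" for t using that by fastforce
  show thesis
  proof (rule that[OF d(1) \<sigma>(1)])
    fix t assume "t \<in> {a<..<b}" "\<bar>t - c\<bar> < d"
    then have t: "t \<in> {a'<..<b'}" using d(6) by blast
    have "\<bar>\<sigma> * \<theta> t\<bar> < eps" using co_bounds(2)[OF d(5)[OF t]] w[OF t] by simp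
    then show "\<bar>\<theta> t\<bar> < eps \<and> \<Gamma> t = (chi (0, \<sigma> * \<theta> t), \<sigma> *\<^sub>R E (\<sigma> * \<theta> t))"
      using \<sigma>(1) co_bounds(3)[OF d(5)[OF t]] s[OF t] w[OF t] \<sigma>(2)[OF t] by (auto simp: abs_mult prod_eq_iff)
  qed
qed

end

text \<open>Maximal continuation for a local property \<open>P\<close>, shared by leaf curves and
  trajectories. Uniqueness glues the solutions on symmetric intervals; if their lengths were
  bounded, the glued curve would live on the largest interval, and extending it at both ends would
  contradict maximality.\<close>

lemma global_extension:
  fixes P :: "(real \<Rightarrow> 's) \<Rightarrow> real \<Rightarrow> bool"
  assumes cong: "\<And>S t \<Gamma> \<Gamma>'. open S \<Longrightarrow> t \<in> S \<Longrightarrow> (\<And>t'. t' \<in> S \<Longrightarrow> \<Gamma> t' = \<Gamma>' t') \<Longrightarrow> P \<Gamma> t \<Longrightarrow> P \<Gamma>' t"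
    and start: "del > 0" "\<And>t. \<bar>t\<bar> < del \<Longrightarrow> P \<Gamma>s t"
    and unique: "\<And>T \<Gamma> \<Gamma>' t. T > 0 \<Longrightarrow> (\<And>t. t \<in> {-T<..<T} \<Longrightarrow> P \<Gamma> t \<and> P \<Gamma>' t) \<Longrightarrow> \<Gamma> 0 = \<Gamma>' 0 \<Longrightarrow> t \<in> {-T<..<T} \<Longrightarrow> \<Gamma> t = \<Gamma>' t"
    and extend: "\<And>T \<Gamma> c. T > 0 \<Longrightarrow> (\<And>t. t \<in> {-T<..<T} \<Longrightarrow> P \<Gamma> t) \<Longrightarrow> c = T \<or> c = -T \<Longrightarrow>
        \<exists>d>0. \<exists>\<Gamma>'. (\<forall>t. \<bar>t - c\<bar> < d \<longrightarrow> P \<Gamma>' t) \<and> (\<forall>t\<in>{-T<..<T}. \<bar>t - c\<bar> < d \<longrightarrow> \<Gamma>' t = \<Gamma> t)"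
  shows "\<exists>\<Gamma>. \<Gamma> 0 = \<Gamma>s 0 \<and> (\<forall>t. P \<Gamma> t)"
proof -
  define ok where "ok T \<Gamma> \<longleftrightarrow> T > 0 \<and> \<Gamma> 0 = \<Gamma>s 0 \<and> (\<forall>t\<in>{-T<..<T}. P \<Gamma> t)" for T \<Gamma>
  define A where "A = {T. \<exists>\<Gamma>. ok T \<Gamma>}"
  have A0: "del \<in> A" using start by (auto simp: A_def ok_def intro!: exI[of _ \<Gamma>s])
  have agree: "\<Gamma> t = \<Gamma>' t" if "ok T \<Gamma>" "ok T' \<Gamma>'" "\<bar>t\<bar> < T" "\<bar>t\<bar> < T'" for T T' \<Gamma> \<Gamma>' t
    by (rule unique[of "min T T'"]) (use that in \<open>auto simp: ok_def\<close>)
  define H where "H T = (SOME \<Gamma>. ok T \<Gamma>)" for T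
  have H: "ok T (H T)" if "T \<in> A" for T 
  proof -
    have "\<exists>\<Gamma>. ok T \<Gamma>" using that by (simp add: A_def)
    then show ?thesis unfolding H_def by (rule someI_ex)
  qed
  define G where "G t = H (SOME T. T \<in> A \<and> \<bar>t\<bar> < T) t" for t
  have G: "G t = H T t" if "T \<in> A" "\<bar>t\<bar> < T" for T t
  proof -
    have "(SOME T. T \<in> A \<and> \<bar>t\<bar> < T) \<in> A \<and> \<bar>t\<bar> < (SOME T. T \<in> A \<and> \<bar>t\<bar> < T)"
      by (rule someI[of _ T]) (use that in auto)
    then show ?thesis unfolding G_def using agree[OF H H] that by blast
  qed
  have PG: "P G t" if "T \<in> A" "\<bar>t\<bar> < T" for T t
  proof (rule cong[of "{-T<..<T}"])
    show "P (H T) t" using H[OF that(1)] that(2) by (auto simp: ok_def abs_less_iff)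
    show "H T t' = G t'" if "t' \<in> {-T<..<T}" for t' using G[OF \<open>T \<in> A\<close>] that by (simp add: abs_less_iff)
  qed (use that in auto)
  have G0: "G 0 = \<Gamma>s 0" using G[OF A0] H[OF A0] start(1) by (simp add: ok_def)
  have step: "\<exists>d>0. T + d \<in> A" if *: "T \<in> A" for T
  proof -
    obtain \<Gamma> where ok: "ok T \<Gamma>" using * by (auto simp: A_def)
    then have T: "T > 0" and P: "\<And>t. t \<in> {-T<..<T} \<Longrightarrow> P \<Gamma> t" by (auto simp: ok_def)
    obtain d1 \<Gamma>1 where 1: "d1 > 0" "\<And>t. \<bar>t - T\<bar> < d1 \<Longrightarrow> P \<Gamma>1 t" "\<And>t. t \<in> {-T<..<T} \<Longrightarrow> \<bar>t - T\<bar> < d1 \<Longrightarrow> \<Gamma>1 t = \<Gamma> t"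
      using extend[OF T P, of T] by fastforce
    obtain d2 \<Gamma>2 where 2: "d2 > 0" "\<And>t. \<bar>t - (-T)\<bar> < d2 \<Longrightarrow> P \<Gamma>2 t" "\<And>t. t \<in> {-T<..<T} \<Longrightarrow> \<bar>t - (-T)\<bar> < d2 \<Longrightarrow> \<Gamma>2 t = \<Gamma> t"
      using extend[OF T P, of "-T"] by fastforce
    \<comment> \<open>The bound by \<open>T\<close> keeps the overlap of each extension with
      \<open>{-T<..<T}\<close> on its own side of 0, so that only two of the three branches of
      \<open>K\<close> meet there.\<close>
    define d where "d = min T (min d1 d2)"
    define K where "K t = (if t \<le> -T then \<Gamma>2 t else if t \<ge> T then \<Gamma>1 t else \<Gamma> t)" for t
    have d: "d > 0" "d \<le> d1" "d \<le> d2" "d \<le> T" using T 1(1) 2(1) by (auto simp: d_def)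
    have "P K t" if t: "t \<in> {-(T+d)<..<T+d}" for t
    proof -
      consider "\<bar>t\<bar> < T" | "T \<le> t" | "t \<le> -T" by linarith
      then show ?thesis
      proof cases
        case 1
        then have t: "t \<in> {-T<..<T}" by auto
        show ?thesis
        proof (rule cong[of "{-T<..<T}" t \<Gamma>])
          show "P \<Gamma> t" by (rule P[OF t])
          show "\<Gamma> t' = K t'" if "t' \<in> {-T<..<T}" for t' using that by (simp add: K_def)
        qed (use t in auto)
      next
        case 2
        show ?thesis
        proof (rule cong[of "{T-d<..<T+d}" t \<Gamma>1])
          show "P \<Gamma>1 t" using \<open>\<And>t. \<bar>t - T\<bar> < d1 \<Longrightarrow> P \<Gamma>1 t\<close>[of t] 2 t d by auto
          fix t' assume "t' \<in> {T-d<..<T+d}"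
          then show "\<Gamma>1 t' = K t'" using 1(3)[of t'] T d by (auto simp: K_def abs_less_iff)
        qed (use 2 t d in auto)
      next
        case 3
        show ?thesis
        proof (rule cong[of "{-T-d<..<-T+d}" t \<Gamma>2])
          show "P \<Gamma>2 t" using \<open>\<And>t. \<bar>t - (-T)\<bar> < d2 \<Longrightarrow> P \<Gamma>2 t\<close>[of t] 3 t d by auto
          fix t' assume "t' \<in> {-T-d<..<-T+d}"
          then show "\<Gamma>2 t' = K t'" using 2(3)[of t'] T d by (auto simp: K_def abs_less_iff)
        qed (use 3 t d in auto)
      qed
    qed
    moreover have "K 0 = \<Gamma>s 0" using T ok by (simp add: K_def ok_def)
    ultimately have "ok (T + d) K" using T d by (simp add: ok_def)
    then show ?thesis using d(1) by (auto simp: A_def)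
  qed
  have "P G t" for t
  proof (cases "bdd_above A")
    case False
    then obtain T where "T \<in> A" "\<bar>t\<bar> < T" unfolding bdd_above_def by (meson not_le)
    then show ?thesis by (rule PG)
  next
    case True
    define S where "S = Sup A"
    have "S \<ge> del" unfolding S_def by (rule cSup_upper[OF A0 True])
    moreover have "P G t" if t: "t \<in> {-S<..<S}" for t
    proof -
      have "\<bar>t\<bar> < S" using t by auto
      then obtain T where "T \<in> A" "\<bar>t\<bar> < T"
        unfolding S_def using less_cSup_iff[of A "\<bar>t\<bar>"] A0 True by blast
      then show ?thesis by (rule PG)
    qed
    ultimately have "ok S G" using G0 start(1) by (simp add: ok_def)
    then have "S \<in> A" by (auto simp: A_def)
    then obtain d where "d > 0" "S + d \<in> A" using step by blast
    then have "S + d \<le> S" unfolding S_def using True by (intro cSup_upper) (auto simp: S_def)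
    then show ?thesis using \<open>d > 0\<close> by simp
  qed
  then show ?thesis using G0 by blast
qed

lemma curve_length_le:
  fixes g :: "real \<Rightarrow> 'b::real_normed_vector"
  assumes "L \<ge> 0" "\<And>x y. x \<in> {0..1} \<Longrightarrow> y \<in> {0..1} \<Longrightarrow> x \<le> y \<Longrightarrow> norm (g y - g x) \<le> L * (y - x)"
  shows "curve_length g 0 1 \<le> ereal L"
  unfolding curve_length_def
proof (rule SUP_least)
  fix ts :: "real list" assume "ts \<in> {ts. ts \<noteq> [] \<and> sorted ts \<and> hd ts = 0 \<and> last ts = 1}"
  then have ts: "ts \<noteq> []" "sorted ts" "hd ts = 0" "last ts = 1" by auto
  then have e: "ts ! 0 = 0" "ts ! (length ts - 1) = 1" by (simp_all add: hd_conv_nth last_conv_nth)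
  have mono: "ts ! i \<le> ts ! j" if "i \<le> j" "j < length ts" for i j
    using ts(2) that sorted_iff_nth_mono by blast
  have r: "ts ! i \<in> {0..1}" if "i < length ts" for i
    using mono[of 0 i] mono[of i "length ts - 1"] e that by auto
  have "(\<Sum>i<length ts - 1. norm (g (ts ! Suc i) - g (ts ! i))) \<le> (\<Sum>i<length ts - 1. L * (ts ! Suc i - ts ! i))"
    by (rule sum_mono, rule assms(2)) (use r mono in auto)
  also have "\<dots> = L * (ts ! (length ts - 1) - ts ! 0)"
    by (simp add: sum_distrib_left[symmetric] sum_lessThan_telescope)
  finally show "ereal (\<Sum>i<length ts - 1. norm (g (ts ! Suc i) - g (ts ! i))) \<le> ereal L"
    using e by simp
qed

lemma idist_curve_le:
  fixes f :: "'m::topological_space \<Rightarrow> real^3" and \<gamma> :: "real \<Rightarrow> 'm"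
  assumes t: "t1 \<in> {a<..<b}" "t2 \<in> {a<..<b}" and c: "\<And>t. t \<in> {a<..<b} \<Longrightarrow> isCont \<gamma> t"
    and d: "\<And>t. t \<in> {a<..<b} \<Longrightarrow> ((\<lambda>t. f (\<gamma> t)) has_vector_derivative D t) (at t)" "\<And>t. t \<in> {a<..<b} \<Longrightarrow> norm (D t) \<le> 1"
  shows "idist f (\<gamma> t1) (\<gamma> t2) \<le> ereal \<bar>t1 - t2\<bar>"
proof -
  define p where "p u = \<gamma> (t1 + u * (t2 - t1))" for u
  have mem: "t1 + u * (t2 - t1) \<in> {a<..<b}" if "u \<in> {0..1}" for u
  proof -
    have "convex {a<..<b}" by simp
    then have "(1 - u) *\<^sub>R t1 + u *\<^sub>R t2 \<in> {a<..<b}" using t that by (intro convexD) auto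
    then show ?thesis by (simp add: algebra_simps)
  qed
  have lip: "norm (f (\<gamma> y) - f (\<gamma> x)) \<le> \<bar>y - x\<bar>" if "x \<in> {a<..<b}" "y \<in> {a<..<b}" for x y
  proof -
    have "norm (f (\<gamma> y) - f (\<gamma> x)) \<le> 1 * norm (y - x)"
    proof (rule differentiable_bound[of "{a<..<b}" _ "\<lambda>t h. h *\<^sub>R D t"])
      show "((\<lambda>t. f (\<gamma> t)) has_derivative (\<lambda>h. h *\<^sub>R D t)) (at t within {a<..<b})" if "t \<in> {a<..<b}" for t
        using d(1)[OF that] has_derivative_at_withinI by (auto simp: has_vector_derivative_def)
      show "onorm (\<lambda>h. h *\<^sub>R D t) \<le> 1" if "t \<in> {a<..<b}" for t
        by (rule onorm_le) (use d(2)[OF that] in \<open>simp add: mult_left_le\<close>)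
    qed (use that in auto)
    then show ?thesis by simp
  qed
  have "continuous_on {0..1} p"
  proof -
    have "continuous_on {a<..<b} \<gamma>" using c by (simp add: continuous_at_imp_continuous_on)
    moreover have "continuous_on {0..1} (\<lambda>u. t1 + u * (t2 - t1))" by (intro continuous_intros)
    ultimately show ?thesis unfolding p_def by (rule continuous_on_compose2) (use mem in auto)
  qed
  then have "idist f (\<gamma> t1) (\<gamma> t2) \<le> curve_length (f \<circ> p) 0 1"
    unfolding idist_def by (intro INF_lower) (simp add: p_def)
  also have "\<dots> \<le> ereal \<bar>t1 - t2\<bar>"
  proof (rule curve_length_le)
    fix x y :: real assume xy: "x \<in> {0..1}" "y \<in> {0..1}" "x \<le> y"
    have "(t1 + y * (t2 - t1)) - (t1 + x * (t2 - t1)) = (y - x) * (t2 - t1)" by (simp add: algebra_simps)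
    then have "\<bar>(t1 + y * (t2 - t1)) - (t1 + x * (t2 - t1))\<bar> = \<bar>t1 - t2\<bar> * (y - x)" using xy(3) by (simp only: abs_mult) (simp add: abs_minus_commute)
    then show "norm ((f \<circ> p) y - (f \<circ> p) x) \<le> \<bar>t1 - t2\<bar> * (y - x)"
      using lip[OF mem[OF xy(1)] mem[OF xy(2)]] by (simp add: p_def)
  qed simp
  finally show ?thesis .
qed

section \<open>Completeness, uniqueness and global existence of the curves\<close>

context pgf
begin

text \<open>The intrinsic distance of two points of the curve is at most their difference in time,
  so every sequence of times tending to \<open>c\<close> yields an intrinsic Cauchy
  sequence.\<close>

lemma complete_curve_limit:
  fixes \<gamma> :: "real \<Rightarrow> 'm"
  assumes ab: "a < b" "c \<in> {a..b}" and c: "\<And>t. t \<in> {a<..<b} \<Longrightarrow> isCont \<gamma> t"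
    and d: "\<And>t. t \<in> {a<..<b} \<Longrightarrow> ((\<lambda>t. f (\<gamma> t)) has_vector_derivative D t) (at t)" "\<And>t. t \<in> {a<..<b} \<Longrightarrow> norm (D t) \<le> 1"
  obtains q where "(\<gamma> \<longlongrightarrow> q) (at c within {a<..<b})"
proof -
  have conv: "\<exists>l. (\<gamma> \<circ> X) \<longlonglongrightarrow> l" if X: "\<And>i. X i \<in> {a<..<b}" "X \<longlonglongrightarrow> c" for X :: "nat \<Rightarrow> real"
  proof -
    have "\<exists>K. \<forall>m\<ge>K. \<forall>n\<ge>K. idist f ((\<gamma> \<circ> X) m) ((\<gamma> \<circ> X) n) < ereal e" if e: "e > 0" for e
    proof -
      have "Cauchy X" using X(2) LIMSEQ_imp_Cauchy by blast
      then obtain K where K: "\<forall>m\<ge>K. \<forall>n\<ge>K. dist (X m) (X n) < e" using metric_CauchyD[OF _ e] by metis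
      have "idist f (\<gamma> (X m)) (\<gamma> (X n)) < ereal e" if "m \<ge> K" "n \<ge> K" for m n
        using idist_curve_le[OF X(1) X(1) c d, of m n] K that by (auto simp: dist_real_def intro: le_less_trans)
      then show ?thesis by auto
    qed
    then show ?thesis using complete unfolding complete_surface_def by blast
  qed
  have "c islimpt {a<..<b}" using at_within_Ioo_nontrivial[OF ab] trivial_limit_within by blast
  then obtain X0 where X0: "\<And>i. X0 i \<in> {a<..<b} - {c}" "X0 \<longlonglongrightarrow> c" using islimpt_sequential by metis
  then obtain q where q: "(\<gamma> \<circ> X0) \<longlonglongrightarrow> q" using conv[of X0] by auto
  have "(\<gamma> \<longlongrightarrow> q) (at c within {a<..<b})"
    unfolding tendsto_at_iff_sequentially
  proof (intro allI impI)
    fix X assume X: "\<forall>i. X i \<in> {a<..<b} - {c}" "X \<longlonglongrightarrow> c"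
    \<comment> \<open>Completeness gives each sequence a limit of its own. Interleaving the two
      sequences forces both to share the limit of \<open>Z\<close>.\<close>
    define Z where "Z n = (if even n then X0 (n div 2) else X (n div 2))" for n
    have Z2: "(\<lambda>n. Z (2 * n)) = X0" "(\<lambda>n. Z (2 * n + 1)) = X" by (simp_all add: Z_def fun_eq_iff)
    have "Z \<longlonglongrightarrow> c"
    proof (rule LIMSEQ_I)
      fix r :: real assume r: "r > 0"
      obtain n1 where n1: "\<And>n. n \<ge> n1 \<Longrightarrow> norm (X0 n - c) < r" using LIMSEQ_D[OF X0(2) r] by blast
      obtain n2 where n2: "\<And>n. n \<ge> n2 \<Longrightarrow> norm (X n - c) < r" using LIMSEQ_D[OF X(2) r] by blast
      have "norm (Z n - c) < r" if "n \<ge> 2 * (n1 + n2)" for n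
        using n1[of "n div 2"] n2[of "n div 2"] that by (simp add: Z_def)
      then show "\<exists>no. \<forall>n\<ge>no. norm (Z n - c) < r" by blast
    qed
    moreover have "Z i \<in> {a<..<b}" for i using X0 X by (simp add: Z_def)
    ultimately obtain l where l: "(\<gamma> \<circ> Z) \<longlonglongrightarrow> l" using conv by blast
    have sm: "strict_mono (\<lambda>n::nat. 2 * n)" "strict_mono (\<lambda>n::nat. 2 * n + 1)" by (auto simp: strict_mono_def)
    have "(\<gamma> \<circ> X0) \<longlonglongrightarrow> l" "(\<gamma> \<circ> X) \<longlonglongrightarrow> l"
      using LIMSEQ_subseq_LIMSEQ[OF l sm(1)] LIMSEQ_subseq_LIMSEQ[OF l sm(2)] Z2 by (simp_all add: o_def fun_eq_iff)
    then show "(\<gamma> \<circ> X) \<longlonglongrightarrow> q" using q LIMSEQ_unique by blast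
  qed
  then show thesis by (rule that)
qed

lemma dir_N: "dir p e \<Longrightarrow> e \<bullet> N p = 0" "dir p e \<Longrightarrow> norm e = 1"
  using leaf_in(2) by (auto simp: dir_def)

lemma norm_leaf_velocity: "dir p e \<Longrightarrow> norm (cross3 (N p) e) = 1"
  using frame3(1)[OF norm_N, of e p] dir_N by (simp add: inner_commute)

lemma traj_isCont: "traj_at g \<Gamma> t \<Longrightarrow> isCont \<Gamma> t"
  using isCont_Pair[of t "\<lambda>t. fst (\<Gamma> t)" "\<lambda>t. snd (\<Gamma> t)"] by (simp add: traj_at_def)

text \<open>Uniqueness and change of speed in one statement; \<open>\<theta> t = t\<close> gives
  plain uniqueness. At a common point both curves are put into one box with \<open>E 0\<close> equal
  to their direction. This forces both signs to be 1, and \<open>traj_form\<close> gives the two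
  curves the same expression in \<open>\<theta>\<close>.\<close>

lemma traj_reparametrize:
  assumes I: "a < b" "t0 \<in> {a<..<b}" and G: "\<And>t. t \<in> {a<..<b} \<Longrightarrow> traj_at g \<Gamma> t"
    and th: "\<And>t. t \<in> {a<..<b} \<Longrightarrow> (\<theta> has_real_derivative g t) (at t)"
    and D: "\<And>t. t \<in> {a<..<b} \<Longrightarrow> \<exists>r>0. \<forall>u. \<bar>u - \<theta> t\<bar> < r \<longrightarrow> traj_at (\<lambda>_. 1) \<Delta> u" and eq: "\<Gamma> t0 = \<Delta> (\<theta> t0)" and t: "t \<in> {a<..<b}"
  shows "\<Gamma> t = \<Delta> (\<theta> t)"
proof (rule isCont_agree[OF I(1,2), of \<Gamma> "\<lambda>t. \<Delta> (\<theta> t)", OF eq _ _ _ t])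
  show "isCont \<Gamma> t" if "t \<in> {a<..<b}" for t using traj_isCont G that by blast
  have D0: "traj_at (\<lambda>_. 1) \<Delta> (\<theta> t)" if "t \<in> {a<..<b}" for t using D[OF that] by fastforce
  show ct: "isCont (\<lambda>t. \<Delta> (\<theta> t)) t" if "t \<in> {a<..<b}" for t
    by (rule isCont_o2[OF DERIV_isCont[OF th[OF that]] traj_isCont[OF D0[OF that]]])
  fix t assume t: "t \<in> {a<..<b}" and eq: "\<Gamma> t = \<Delta> (\<theta> t)"
  have dir: "dir (fst (\<Gamma> t)) (snd (\<Gamma> t))" using G[OF t] by (simp add: traj_at_def)
  obtain eps R E P Q p q xi eta xi' eta' chi where "box f F N eps R E P Q p q xi eta xi' eta' chi"
    and b: "chi (0, 0) = fst (\<Gamma> t)" "E 0 = snd (\<Gamma> t)" using box_exists[OF dir] by metis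
  then interpret box f F N eps R E P Q p q xi eta xi' eta' chi by simp
  have lim1: "((\<lambda>t. fst (\<Gamma> t)) \<longlongrightarrow> chi (0, 0)) (at t within {a<..<b})"
    using G[OF t] unfolding b traj_at_def isCont_def by (auto intro: tendsto_within_subset)
  have c1: "((\<lambda>t'. \<theta> t' - \<theta> t) \<longlongrightarrow> 0) (at t within {a<..<b})"
    using DERIV_isCont[OF th[OF t]] unfolding isCont_def by (auto intro!: LIM_zero intro: tendsto_within_subset)
  obtain r where r: "r > 0" "\<And>u. \<bar>u - \<theta> t\<bar> < r \<Longrightarrow> traj_at (\<lambda>_. 1) \<Delta> u" using D[OF t] by blast
  define a' b' where "a' = \<theta> t - r" and "b' = \<theta> t + r"
  have D': "traj_at (\<lambda>_. 1) \<Delta> u" if "u \<in> {a'<..<b'}" for u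
    by (rule r(2)) (use that in \<open>auto simp: a'_def b'_def abs_less_iff\<close>)
  have tt: "t \<in> {a..b}" "\<theta> t \<in> {a'..b'}" "a' < b'" using t r(1) by (auto simp: a'_def b'_def)
  have th2: "\<theta> t \<in> {a'<..<b'}" using r(1) by (auto simp: a'_def b'_def)
  have dd1: "((\<lambda>t'. \<theta> t' - \<theta> t) has_real_derivative g t') (at t')" if "t' \<in> {a<..<b}" for t'
    using th[OF that] by (auto intro!: derivative_eq_intros)
  obtain d1 \<sigma>1 where 1: "d1 > 0" "\<sigma>1 = 1 \<or> \<sigma>1 = -1"
    "\<And>t'. t' \<in> {a<..<b} \<Longrightarrow> \<bar>t' - t\<bar> < d1 \<Longrightarrow> \<bar>\<theta> t' - \<theta> t\<bar> < eps \<and> \<Gamma> t' = (chi (0, \<sigma>1 * (\<theta> t' - \<theta> t)), \<sigma>1 *\<^sub>R E (\<sigma>1 * (\<theta> t' - \<theta> t)))"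
    using traj_form[OF I(1) tt(1) G dd1 c1 lim1] by blast
  have s1: "\<sigma>1 = 1" using 1(2) 1(3)[OF t] 1(1) b(2) E_nonzero[OF center(3)] by fastforce
  have lim2: "((\<lambda>t. fst (\<Delta> t)) \<longlongrightarrow> chi (0, 0)) (at (\<theta> t) within {a'<..<b'})"
    using D0[OF t] unfolding b eq traj_at_def isCont_def by (auto intro: tendsto_within_subset)
  have c2: "((\<lambda>u. u - \<theta> t) \<longlongrightarrow> 0) (at (\<theta> t) within {a'<..<b'})"
    by (rule LIM_zero) (rule tendsto_ident_at)
  have dd2: "((\<lambda>u. u - \<theta> t) has_real_derivative 1) (at u)" for u by (auto intro!: derivative_eq_intros)
  obtain d2 \<sigma>2 where 2: "d2 > 0" "\<sigma>2 = 1 \<or> \<sigma>2 = -1"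
    "\<And>u. u \<in> {a'<..<b'} \<Longrightarrow> \<bar>u - \<theta> t\<bar> < d2 \<Longrightarrow> \<bar>u - \<theta> t\<bar> < eps \<and> \<Delta> u = (chi (0, \<sigma>2 * (u - \<theta> t)), \<sigma>2 *\<^sub>R E (\<sigma>2 * (u - \<theta> t)))"
    using traj_form[OF tt(3,2) D' dd2 c2 lim2] by blast
  have s2: "\<sigma>2 = 1" using 2(2) 2(3)[OF th2] 2(1) b(2) eq E_nonzero[OF center(3)] by fastforce
  obtain d3 where 3: "d3 > 0" "\<And>t'. \<bar>t' - t\<bar> < d3 \<Longrightarrow> \<bar>\<theta> t' - \<theta> t\<bar> < min d2 r"
    using DERIV_isCont[OF th[OF t]] 2(1) r(1) unfolding continuous_at_eps_delta dist_real_def by (metis min_less_iff_conj)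
  show "\<exists>d>0. \<forall>t'\<in>{a<..<b}. \<bar>t' - t\<bar> < d \<longrightarrow> \<Gamma> t' = \<Delta> (\<theta> t')"
  proof (intro exI[of _ "min d1 d3"] conjI ballI impI)
    fix t' assume t': "t' \<in> {a<..<b}" "\<bar>t' - t\<bar> < min d1 d3"
    have "\<bar>\<theta> t' - \<theta> t\<bar> < min d2 r" using 3(2)[of t'] t'(2) by simp
    then have "\<theta> t' \<in> {a'<..<b'}" "\<bar>\<theta> t' - \<theta> t\<bar> < d2" by (auto simp: a'_def b'_def abs_less_iff)
    then show "\<Gamma> t' = \<Delta> (\<theta> t')" using 1(3)[OF t'(1)] 2(3) t'(2) s1 s2 by simp
  qed (use 1(1) 3(1) in simp)
qed

lemma leaf_curve_unique:
  assumes I: "a < b" "t0 \<in> {a<..<b}" and G: "\<And>t. t \<in> {a<..<b} \<Longrightarrow> leaf_at e \<gamma> t" "\<And>t. t \<in> {a<..<b} \<Longrightarrow> leaf_at e \<gamma>' t"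
    and eq: "\<gamma> t0 = \<gamma>' t0" and t: "t \<in> {a<..<b}"
  shows "\<gamma> t = \<gamma>' t"
proof (rule isCont_agree[where x = \<gamma> and y = \<gamma>', OF I(1,2) eq _ _ _ t])
  show "isCont \<gamma> t" "isCont \<gamma>' t" if "t \<in> {a<..<b}" for t using G that by (auto simp: leaf_at_def)
  fix t assume t: "t \<in> {a<..<b}" and eq: "\<gamma> t = \<gamma>' t"
  have dir: "dir (\<gamma> t) e" using G(1)[OF t] by (simp add: leaf_at_def)
  obtain eps R E P Q p q xi eta xi' eta' chi where "box f F N eps R E P Q p q xi eta xi' eta' chi"
    and b: "chi (0, 0) = \<gamma> t" "E 0 = e" using box_exists[OF dir] by metis
  then interpret box f F N eps R E P Q p q xi eta xi' eta' chi by simp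
  have s: "\<exists>d>0. \<forall>t'\<in>{a<..<b}. \<bar>t' - t\<bar> < d \<longrightarrow> \<gamma>1 t' = chi (t' - t, 0)"
    if lf: "\<And>t. t \<in> {a<..<b} \<Longrightarrow> leaf_at e \<gamma>1 t" "\<gamma>1 t = \<gamma> t" for \<gamma>1
  proof -
    have lim: "(\<gamma>1 \<longlongrightarrow> chi (0, 0)) (at t within {a<..<b})"
      using lf(1)[OF t] unfolding b lf(2)[symmetric] leaf_at_def isCont_def by (auto intro: tendsto_within_subset)
    have "t \<in> {a..b}" using t by auto
    then obtain d \<sigma> where "d > 0" "\<sigma> = 1 \<or> \<sigma> = -1" "e = \<sigma> *\<^sub>R E 0"
      "\<And>t'. t' \<in> {a<..<b} \<Longrightarrow> \<bar>t' - t\<bar> < d \<Longrightarrow> \<bar>t' - t\<bar> < eps \<and> \<gamma>1 t' = chi (\<sigma> * (t' - t), 0)"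
      using leaf_form[OF I(1) _ lf(1) lim] by blast
    moreover from this have "\<sigma> = 1" using b(2) E_nonzero[OF center(3)] by auto
    ultimately show ?thesis by auto
  qed
  obtain d1 where 1: "d1 > 0" "\<forall>t'\<in>{a<..<b}. \<bar>t' - t\<bar> < d1 \<longrightarrow> \<gamma> t' = chi (t' - t, 0)" using s[OF G(1)] by auto
  obtain d2 where 2: "d2 > 0" "\<forall>t'\<in>{a<..<b}. \<bar>t' - t\<bar> < d2 \<longrightarrow> \<gamma>' t' = chi (t' - t, 0)" using s[OF G(2)] eq by auto
  show "\<exists>d>0. \<forall>t'\<in>{a<..<b}. \<bar>t' - t\<bar> < d \<longrightarrow> \<gamma> t' = \<gamma>' t'"
    using 1 2 by (intro exI[of _ "min d1 d2"]) auto
qed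

text \<open>Near a finite end point the curve has a limit by completeness, and in a box around the
  limit it is a horizontal segment ending at the centre. The segment itself continues past the
  centre.\<close>

lemma leaf_curve_exists:
  assumes dir: "dir p e"
  shows "\<exists>\<gamma>. \<gamma> 0 = p \<and> (\<forall>t. leaf_at e \<gamma> t)"
proof -
  obtain eps R E P Q p' q xi eta xi' eta' chi where bx: "box f F N eps R E P Q p' q xi eta xi' eta' chi"
    and b: "chi (0, 0) = p" "E 0 = e" using box_exists[OF dir] by metis
  interpret b0: box f F N eps R E P Q p' q xi eta xi' eta' chi by (rule bx)
  have "\<exists>\<gamma>. \<gamma> 0 = chi (0 + 1 * 0, 0) \<and> (\<forall>t. leaf_at e \<gamma> t)"
  proof (rule global_extension[where P = "leaf_at e" and del = eps and \<Gamma>s = "\<lambda>t. chi (0 + 1 * t, 0)"])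
    show "leaf_at e \<gamma>' t" if "open S" "t \<in> S" "\<And>t'. t' \<in> S \<Longrightarrow> \<gamma> t' = \<gamma>' t'" "leaf_at e \<gamma> t" for S t \<gamma> \<gamma>'
      using leaf_at_cong that by blast
    show "leaf_at e (\<lambda>t. chi (0 + 1 * t, 0)) t" if "\<bar>t\<bar> < eps" for t
      by (rule b0.leaf_at_box) (use that b b0.eps in auto)
    show "\<gamma> t = \<gamma>' t" if "T > 0" "\<And>t. t \<in> {-T<..<T} \<Longrightarrow> leaf_at e \<gamma> t \<and> leaf_at e \<gamma>' t" "\<gamma> 0 = \<gamma>' 0" "t \<in> {-T<..<T}" for T \<gamma> \<gamma>' t
      by (rule leaf_curve_unique[of "-T" T 0 e]) (use that in auto)
    fix T \<gamma> and c :: real assume T: "T > 0" and lf: "\<And>t. t \<in> {-T<..<T} \<Longrightarrow> leaf_at e \<gamma> t" and c: "c = T \<or> c = -T"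
    have ab: "-T < T" "c \<in> {-T..T}" using T c by auto
    obtain q1 where q1: "(\<gamma> \<longlongrightarrow> q1) (at c within {-T<..<T})"
      by (rule complete_curve_limit[OF ab, of \<gamma> "\<lambda>t. cross3 (N (\<gamma> t)) e"])
        (use lf norm_leaf_velocity in \<open>auto simp: leaf_at_def\<close>)
    \<comment> \<open>Either direction at the limit point will do: \<open>leaf_form\<close> supplies
      the sign relating \<open>E 0\<close> to \<open>e\<close>, and thereby shows that
      \<open>e\<close> is a direction there too.\<close>
    obtain e1 where "dir q1 e1" using dir_exists by blast
    then obtain eps R E P Q p' q xi eta xi' eta' chi where bx: "box f F N eps R E P Q p' q xi eta xi' eta' chi"
      and b: "chi (0, 0) = q1" using box_exists by metis
    interpret box f F N eps R E P Q p' q xi eta xi' eta' chi by (rule bx)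
    obtain d \<sigma> where d: "d > 0" "\<sigma> = 1 \<or> \<sigma> = -1" "e = \<sigma> *\<^sub>R E 0"
      "\<And>t. t \<in> {-T<..<T} \<Longrightarrow> \<bar>t - c\<bar> < d \<Longrightarrow> \<bar>t - c\<bar> < eps \<and> \<gamma> t = chi (\<sigma> * (t - c), 0)"
      using leaf_form[OF ab lf, unfolded b, OF _ q1] by blast
    have "leaf_at e (\<lambda>t. chi (- \<sigma> * c + \<sigma> * t, 0)) t" if "\<bar>t - c\<bar> < min d eps" for t
    proof (rule leaf_at_box[OF d(2,3) center(3)])
      have "\<bar>- \<sigma> * c + \<sigma> * t\<bar> = \<bar>t - c\<bar>" using d(2) by auto
      then show "\<bar>- \<sigma> * c + \<sigma> * t\<bar> < eps" using that by simp
    qed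
    then show "\<exists>d>0. \<exists>\<gamma>'. (\<forall>t. \<bar>t - c\<bar> < d \<longrightarrow> leaf_at e \<gamma>' t) \<and> (\<forall>t\<in>{-T<..<T}. \<bar>t - c\<bar> < d \<longrightarrow> \<gamma>' t = \<gamma> t)"
      using d eps by (intro exI[of _ "min d eps"] conjI exI[of _ "\<lambda>t. chi (- \<sigma> * c + \<sigma> * t, 0)"]) (auto simp: algebra_simps)
  qed (use b0.eps in auto)
  then show ?thesis using b by simp
qed

lemma traj_exists:
  assumes dir: "dir p e"
  shows "\<exists>\<Gamma>. \<Gamma> 0 = (p, e) \<and> (\<forall>t. traj_at (\<lambda>_. 1) \<Gamma> t)"
proof -
  obtain eps R E P Q p' q xi eta xi' eta' chi where bx: "box f F N eps R E P Q p' q xi eta xi' eta' chi"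
    and b: "chi (0, 0) = p" "E 0 = e" using box_exists[OF dir] by metis
  interpret b0: box f F N eps R E P Q p' q xi eta xi' eta' chi by (rule bx)
  have "\<exists>\<Gamma>. \<Gamma> 0 = (chi (0, 0 + 1 * 0), 1 *\<^sub>R E (0 + 1 * 0)) \<and> (\<forall>t. traj_at (\<lambda>_. 1) \<Gamma> t)"
  proof (rule global_extension[where P = "traj_at (\<lambda>_. 1)" and del = eps and \<Gamma>s = "\<lambda>t. (chi (0, 0 + 1 * t), 1 *\<^sub>R E (0 + 1 * t))"])
    show "traj_at (\<lambda>_. 1) \<gamma>' t" if "open S" "t \<in> S" "\<And>t'. t' \<in> S \<Longrightarrow> \<gamma> t' = \<gamma>' t'" "traj_at (\<lambda>_. 1) \<gamma> t" for S t \<gamma> \<gamma>'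
      using traj_at_cong that by blast
    show "traj_at (\<lambda>_. 1) (\<lambda>t. (chi (0, 0 + 1 * t), 1 *\<^sub>R E (0 + 1 * t))) t" if "\<bar>t\<bar> < eps" for t
      by (rule b0.traj_at_box) (use that in auto)
    show "\<gamma> t = \<gamma>' t" if "T > 0" "\<And>t. t \<in> {-T<..<T} \<Longrightarrow> traj_at (\<lambda>_. 1) \<gamma> t \<and> traj_at (\<lambda>_. 1) \<gamma>' t" "\<gamma> 0 = \<gamma>' 0" "t \<in> {-T<..<T}" for T \<gamma> \<gamma>' t
    proof (rule traj_reparametrize[of "-T" T 0 "\<lambda>_. 1" \<gamma> "\<lambda>t. t" \<gamma>' t])
      fix t assume t: "t \<in> {-T<..<T}"
      have "u \<in> {-T<..<T}" if "\<bar>u - t\<bar> < min (T - t) (T + t)" for u using that by (auto simp: abs_less_iff)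
      then show "\<exists>r>0. \<forall>u. \<bar>u - t\<bar> < r \<longrightarrow> traj_at (\<lambda>_. 1) \<gamma>' u"
        using that(2) t by (intro exI[of _ "min (T - t) (T + t)"]) auto
    qed (use that in auto)
    fix T \<Gamma> and c :: real assume T: "T > 0" and lf: "\<And>t. t \<in> {-T<..<T} \<Longrightarrow> traj_at (\<lambda>_. 1) \<Gamma> t" and c: "c = T \<or> c = -T"
    have ab: "-T < T" "c \<in> {-T..T}" using T c by auto
    have n1: "norm (snd (\<Gamma> t)) = 1" if "t \<in> {-T<..<T}" for t
      using lf[OF that] dir_N(2)[of "fst (\<Gamma> t)"] by (simp add: traj_at_def)
    obtain q1 where q1: "((\<lambda>t. fst (\<Gamma> t)) \<longlongrightarrow> q1) (at c within {-T<..<T})"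
      by (rule complete_curve_limit[OF ab, of "\<lambda>t. fst (\<Gamma> t)" "\<lambda>t. snd (\<Gamma> t)"])
        (use lf n1 in \<open>auto simp: traj_at_def\<close>)
    obtain e1 where "dir q1 e1" using dir_exists by blast
    then obtain eps R E P Q p' q xi eta xi' eta' chi where bx: "box f F N eps R E P Q p' q xi eta xi' eta' chi"
      and b: "chi (0, 0) = q1" using box_exists by metis
    interpret box f F N eps R E P Q p' q xi eta xi' eta' chi by (rule bx)
    have dd: "((\<lambda>t. t - c) has_real_derivative 1) (at t)" for t by (auto intro!: derivative_eq_intros)
    have lim: "((\<lambda>t. t - c) \<longlongrightarrow> 0) (at c within {-T<..<T})"
      by (rule LIM_zero) (rule tendsto_ident_at)
    obtain d \<sigma> where d: "d > 0" "\<sigma> = 1 \<or> \<sigma> = -1"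
      "\<And>t. t \<in> {-T<..<T} \<Longrightarrow> \<bar>t - c\<bar> < d \<Longrightarrow> \<bar>t - c\<bar> < eps \<and> \<Gamma> t = (chi (0, \<sigma> * (t - c)), \<sigma> *\<^sub>R E (\<sigma> * (t - c)))"
      using traj_form[OF ab lf dd lim, unfolded b, OF _ q1] by blast
    have "traj_at (\<lambda>_. 1) (\<lambda>t. (chi (0, - \<sigma> * c + \<sigma> * t), \<sigma> *\<^sub>R E (- \<sigma> * c + \<sigma> * t))) t" if "\<bar>t - c\<bar> < min d eps" for t
    proof (rule traj_at_box[OF d(2)])
      have "\<bar>- \<sigma> * c + \<sigma> * t\<bar> = \<bar>t - c\<bar>" using d(2) by auto
      then show "\<bar>- \<sigma> * c + \<sigma> * t\<bar> < eps" using that by simp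
    qed
    then show "\<exists>d>0. \<exists>\<gamma>'. (\<forall>t. \<bar>t - c\<bar> < d \<longrightarrow> traj_at (\<lambda>_. 1) \<gamma>' t) \<and> (\<forall>t\<in>{-T<..<T}. \<bar>t - c\<bar> < d \<longrightarrow> \<gamma>' t = \<Gamma> t)"
      using d eps by (intro exI[of _ "min d eps"] conjI exI[of _ "\<lambda>t. (chi (0, - \<sigma> * c + \<sigma> * t), \<sigma> *\<^sub>R E (- \<sigma> * c + \<sigma> * t))"]) (auto simp: algebra_simps)
  qed (use b0.eps in auto)
  then show ?thesis using b by simp
qed

section \<open>The leaf flow, the trajectory flow and the leaves as orbits\<close>

definition "Lf p e = (SOME \<gamma>. \<gamma> 0 = p \<and> (\<forall>t. leaf_at e \<gamma> t))"
definition "Tr p e = (SOME \<Gamma>. \<Gamma> 0 = (p, e) \<and> (\<forall>t. traj_at (\<lambda>_. 1) \<Gamma> t))"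

lemma Lf: "dir p e \<Longrightarrow> Lf p e 0 = p" "dir p e \<Longrightarrow> leaf_at e (Lf p e) t"
  using someI_ex[OF leaf_curve_exists[of p e]] by (auto simp: Lf_def)

lemma Tr: "dir p e \<Longrightarrow> Tr p e 0 = (p, e)" "dir p e \<Longrightarrow> traj_at (\<lambda>_. 1) (Tr p e) t"
  using someI_ex[OF traj_exists[of p e]] by (auto simp: Tr_def)

lemma Lf_dir: "dir p e \<Longrightarrow> dir (Lf p e t) e" using Lf(2) by (simp add: leaf_at_def)

lemma Lf_unique:
  assumes "t0 \<in> {a<..<b}" "\<And>t. t \<in> {a<..<b} \<Longrightarrow> leaf_at e \<gamma> t" "t \<in> {a<..<b}"
  shows "\<gamma> t = Lf (\<gamma> t0) e (t - t0)"
proof -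
  have d: "dir (\<gamma> t0) e" using assms(1,2) by (simp add: leaf_at_def)
  have "leaf_at e (\<lambda>t. Lf (\<gamma> t0) e (- t0 + t)) t" for t
    by (rule leaf_at_shift) (rule Lf(2)[OF d])
  from leaf_curve_unique[OF _ assms(1,2) this _ assms(3)] show ?thesis
    using assms(1) Lf(1)[OF d] by simp
qed

lemma Lf_add: "dir p e \<Longrightarrow> Lf (Lf p e s) e t = Lf p e (s + t)"
  using Lf_unique[of s "min s (s + t) - 1" "max s (s + t) + 1" e "Lf p e" "s + t"] Lf(2) by fastforce

text \<open>\<open>leaf_at\<close> prescribes velocity and direction, but does not mention the leaf
  itself. Staying in it is seen in boxes, where the curve is a horizontal line.\<close>

lemma Lf_leaf:
  assumes d: "dir p e"
  shows "leaf (Lf p e t) = leaf p"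
proof (rule connected_local_iff[of UNIV 0])
  fix t
  obtain eps R E P Q p' q xi eta xi' eta' chi where bx: "box f F N eps R E P Q p' q xi eta xi' eta' chi"
    and b: "chi (0, 0) = Lf p e t" "E 0 = e" using box_exists[OF Lf_dir[OF d]] by metis
  interpret box f F N eps R E P Q p' q xi eta xi' eta' chi by (rule bx)
  have L: "leaf (Lf p e t') = leaf (Lf p e t)" if "\<bar>t' - t\<bar> < eps" for t'
  proof -
    have "leaf_at e (\<lambda>t. chi (0 + 1 * t, 0)) s" if "s \<in> {-eps<..<eps}" for s
      by (rule leaf_at_box) (use that b(2) eps in auto)
    from Lf_unique[OF center(1) this, of "t' - t"] that b
    have "chi (t' - t, 0) = Lf (Lf p e t) e (t' - t)" by (auto simp: abs_less_iff)
    also have "\<dots> = Lf p e t'" using Lf_add[OF d] by simp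
    finally show ?thesis using leaf_box[OF that center(3)] b by simp
  qed
  have "\<forall>t'\<in>ball t eps. leaf (Lf p e t') = leaf (Lf p e t)"
  proof
    fix t' assume "t' \<in> ball t eps"
    then have "\<bar>t' - t\<bar> < eps" by (simp add: dist_real_def abs_minus_commute)
    then show "leaf (Lf p e t') = leaf (Lf p e t)" by (rule L)
  qed
  then show "\<exists>U. open U \<and> t \<in> U \<and> (\<forall>t'\<in>U \<inter> UNIV. (leaf (Lf p e t') = leaf p) = (leaf (Lf p e t) = leaf p))"
    using eps by (metis Int_iff centre_in_ball open_ball)
qed (use Lf(1)[OF d] in auto)

lemma Tr_unique:
  assumes "t0 \<in> {a<..<b}" "\<And>t. t \<in> {a<..<b} \<Longrightarrow> traj_at g \<Gamma> t" "t \<in> {a<..<b}"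
    and th: "\<And>t. t \<in> {a<..<b} \<Longrightarrow> (\<theta> has_real_derivative g t) (at t)" and d: "dir p e" and eq: "\<Gamma> t0 = Tr p e (\<theta> t0)"
  shows "\<Gamma> t = Tr p e (\<theta> t)"
  by (rule traj_reparametrize[where \<Gamma> = \<Gamma> and \<Delta> = "Tr p e" and \<theta> = \<theta> and ?t0.0 = t0, OF _ assms(1,2) th _ eq assms(3)])
    (use assms(1) Tr(2)[OF d] in \<open>auto intro: exI[of _ 1]\<close>)

end

context pgf
begin

lemma dir_unique: "dir p a \<Longrightarrow> dir p b \<Longrightarrow> b = a \<or> b = - a"
proof -
  assume d: "dir p a" "dir p b"
  obtain eps R E P Q p' q xi eta xi' eta' chi where bx: "box f F N eps R E P Q p' q xi eta xi' eta' chi"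
    and b: "chi (0, 0) = p" "E 0 = a" using box_exists[OF d(1)] by metis
  interpret box f F N eps R E P Q p' q xi eta xi' eta' chi by (rule bx)
  show "b = a \<or> b = - a" using dir_box[OF center(3) center(3), of b] b d(2) by simp
qed

lemma Lf_minus:
  assumes "dir p e"
  shows "Lf p (- e) t = Lf p e (- t)"
proof -
  have "leaf_at (- e) (\<lambda>t. Lf p e (- t)) t" for t by (rule leaf_at_reverse) (rule Lf(2)[OF assms])
  from Lf_unique[of 0 "min 0 t - 1" "max 0 t + 1", OF _ this, of t] show ?thesis using Lf(1)[OF assms] by fastforce
qed

lemma Lf_range:
  assumes d: "dir p e" "dir q1 e1" and q1: "q1 \<in> range (Lf p e)"
  shows "Lf q1 e1 s \<in> range (Lf p e)"
proof -
  obtain t where t: "q1 = Lf p e t" using q1 by auto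
  have "dir q1 e" using Lf_dir[OF d(1)] t by simp
  then have "e1 = e \<or> e1 = - e" using dir_unique d(2) by blast
  then show ?thesis
  proof
    assume "e1 = e" then show ?thesis using t Lf_add[OF d(1)] by auto
  next
    assume "e1 = - e"
    then show ?thesis using t Lf_add[OF d(1)] Lf_minus[OF \<open>dir q1 e\<close>] by auto
  qed
qed

lemma plaque_velocity:
  assumes fch: "foliated_chart f F a b c d \<psi>" and w: "u \<in> {a<..<b}" "v \<in> {c<..<d}"
  shows "((\<lambda>u. f (\<psi> (u, v))) has_vector_derivative pd1 (f \<circ> \<psi>) (u, v)) (at u)"
    and "dir (\<psi> (u, v)) e \<Longrightarrow> pd1 (f \<circ> \<psi>) (u, v) \<bullet> e = 0"
    and "isCont (\<lambda>u. \<psi> (u, v)) u"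
proof -
  let ?W = "{a<..<b} \<times> {c<..<d}"
  have lp: "local_param f ?W \<psi>" using fch by (simp add: foliated_chart_def)
  have oW: "open ?W" "(u, v) \<in> ?W" using w by (simp_all add: open_Times)
  have "((f \<circ> \<psi>) has_derivative frechet_derivative (f \<circ> \<psi>) (at (u, v))) (at (u, v))"
    using lp oW(2) by (intro smooth_on_has_derivative) (auto simp: local_param_def)
  note D = this
  have "((\<lambda>x. (x, v)) has_derivative (\<lambda>h. (h, 0))) (at u)"
    by (intro has_derivative_Pair has_derivative_ident has_derivative_const)
  from has_derivative_compose[OF this D]
  have "((\<lambda>u. f (\<psi> (u, v))) has_derivative (\<lambda>h. frechet_derivative (f \<circ> \<psi>) (at (u, v)) (h, 0))) (at u)" by simp
  moreover have "(\<lambda>h. frechet_derivative (f \<circ> \<psi>) (at (u, v)) (h, 0)) = (\<lambda>h. h *\<^sub>R pd1 (f \<circ> \<psi>) (u, v))"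
  proof
    fix h :: real
    have "(h, 0::real) = h *\<^sub>R (1, 0)" by simp
    then show "frechet_derivative (f \<circ> \<psi>) (at (u, v)) (h, 0) = h *\<^sub>R pd1 (f \<circ> \<psi>) (u, v)"
      unfolding pd1_def using linear_scale[OF has_derivative_linear[OF D]] by metis
  qed
  ultimately show hv: "((\<lambda>u. f (\<psi> (u, v))) has_vector_derivative pd1 (f \<circ> \<psi>) (u, v)) (at u)"
    by (simp add: has_vector_derivative_def)
  show "pd1 (f \<circ> \<psi>) (u, v) \<bullet> e = 0" if e: "dir (\<psi> (u, v)) e"
  proof -
    have eq: "f (\<psi> (y, v)) \<bullet> e = f (\<psi> (u, v)) \<bullet> e" if y: "y \<in> {a<..<b}" for y
    proof -
      have "\<psi> (y, v) \<in> leaf (\<psi> (u, v))" using chart_leaf[OF fch w(2) w(1) y] by (simp add: leaf_eq)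
      then show ?thesis using e by (simp add: dir_def inner_diff_left)
    qed
    then show ?thesis
      using inner_const_derivative[OF hv has_vector_derivative_const open_greaterThanLessThan[of a b] _ eq] w by auto
  qed
  have "continuous_on ?W \<psi>" using lp by (auto simp: local_param_def homeomorphism_def)
  then have "isCont \<psi> (u, v)" using oW continuous_on_eq_continuous_at by metis
  then show "isCont (\<lambda>u. \<psi> (u, v)) u" using isCont_o2[of u "\<lambda>u. (u, v)" \<psi>] by (simp add: isCont_Pair)
qed

text \<open>The velocity of a plaque is orthogonal to the leaf direction, so in a box around one of
  its points the plaque stays on \<open>w = 0\<close>. That line is part of a leaf curve, so
  membership in the range is locally constant along the plaque.\<close>

lemma plaque_subset_range:
  assumes d: "dir p e" and fch: "foliated_chart f F a b c d \<psi>" and v: "v \<in> {c<..<d}"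
    and meet: "\<psi> ` ({a<..<b} \<times> {v}) \<inter> range (Lf p e) \<noteq> {}"
  shows "\<psi> ` ({a<..<b} \<times> {v}) \<subseteq> range (Lf p e)"
proof -
  obtain u0 where u0: "u0 \<in> {a<..<b}" "\<psi> (u0, v) \<in> range (Lf p e)" using meet by fastforce
  have "\<psi> (u, v) \<in> range (Lf p e)" if u: "u \<in> {a<..<b}" for u
  proof (rule connected_local_iff[where P = "\<lambda>u. \<psi> (u, v) \<in> range (Lf p e)", OF connected_Ioo u0 _ u])
    fix u1 assume u1: "u1 \<in> {a<..<b}"
    have ab: "a < b" "u1 \<in> {a..b}" using u1 by auto
    obtain e1 where e1: "dir (\<psi> (u1, v)) e1" using dir_exists by blast
    obtain eps R E P Q p' q xi eta xi' eta' chi where bx: "box f F N eps R E P Q p' q xi eta xi' eta' chi"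
      and b: "chi (0, 0) = \<psi> (u1, v)" "E 0 = e1" using box_exists[OF e1] by metis
    interpret box f F N eps R E P Q p' q xi eta xi' eta' chi by (rule bx)
    let ?g = "\<lambda>u. \<psi> (u, v)"
    have cont: "isCont ?g u" if "u \<in> {a<..<b}" for u by (rule plaque_velocity(3)[OF fch that v])
    have lim: "(?g \<longlongrightarrow> chi (0, 0)) (at u1 within {a<..<b})"
      using cont[OF u1] unfolding b isCont_def by (auto intro: tendsto_within_subset)
    obtain \<delta> a' b' where E: "\<delta> > 0" "a' < b'" "u1 \<in> {a'..b'}" "{a'<..<b'} \<subseteq> {a<..<b}"
      "\<And>t. t \<in> {a'<..<b'} \<Longrightarrow> ?g t \<in> chi ` sq" "\<And>t. t \<in> {a<..<b} \<Longrightarrow> \<bar>t - u1\<bar> < \<delta> \<Longrightarrow> t \<in> {a'<..<b'}"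
      "((\<lambda>t. fst (co (?g t))) \<longlongrightarrow> 0) (at u1 within {a'<..<b'})" "((\<lambda>t. snd (co (?g t))) \<longlongrightarrow> 0) (at u1 within {a'<..<b'})"
      using curve_enters_box[OF ab cont lim] by blast
    have w: "snd (co (?g t)) = 0" if t: "t \<in> {a'<..<b'}" for t
    proof (rule has_derivative_zero_limit[OF E(2,3) _ E(8) t])
      fix t assume t: "t \<in> {a'<..<b'}"
      then have tab: "t \<in> {a<..<b}" using E(4) by blast
      note cb = co_bounds[OF E(5)[OF t]]
      have "dir (?g t) (E (snd (co (?g t))))" using dir_box[OF cb(1,2)] cb(3) by metis
      then show "((\<lambda>t. snd (co (?g t))) has_real_derivative 0) (at t)"
        using coordinates(2)[OF cont[OF tab] E(5)[OF t] plaque_velocity(1)[OF fch tab v]] plaque_velocity(2)[OF fch tab v] by simp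
    qed
    have iff: "\<psi> (t, v) \<in> range (Lf p e) \<longleftrightarrow> \<psi> (u1, v) \<in> range (Lf p e)" if t: "t \<in> {a'<..<b'}" for t
    proof -
      let ?s = "fst (co (?g t))"
      note cb = co_bounds[OF E(5)[OF t]]
      have lf: "leaf_at e1 (\<lambda>t. chi (0 + 1 * t, 0)) s" if "s \<in> {-eps<..<eps}" for s
        by (rule leaf_at_box) (use that b(2) eps in auto)
      have 1: "\<psi> (t, v) = Lf (\<psi> (u1, v)) e1 ?s"
        using Lf_unique[OF center(1) lf, of ?s] cb w[OF t] b by (auto simp: abs_less_iff)
      have dt: "dir (\<psi> (t, v)) e1" using Lf_dir[OF e1] 1 by metis
      have 2: "Lf (\<psi> (t, v)) e1 (- ?s) = \<psi> (u1, v)" using Lf_add[OF e1, of ?s "- ?s"] 1 Lf(1)[OF e1] by simp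
      show ?thesis using Lf_range[OF d e1, of ?s] Lf_range[OF d dt, of "- ?s"] 1 2 by auto
    qed
    show "\<exists>U. open U \<and> u1 \<in> U \<and> (\<forall>t'\<in>U \<inter> {a<..<b}. (\<psi> (t', v) \<in> range (Lf p e)) = (\<psi> (u1, v) \<in> range (Lf p e)))"
    proof (intro exI[of _ "ball u1 \<delta>"] conjI ballI)
      fix t' assume "t' \<in> ball u1 \<delta> \<inter> {a<..<b}"
      then have "t' \<in> {a'<..<b'}" by (intro E(6)) (auto simp: dist_real_def abs_minus_commute)
      then show "(\<psi> (t', v) \<in> range (Lf p e)) = (\<psi> (u1, v) \<in> range (Lf p e))" by (rule iff)
    qed (use E(1) in auto)
  qed
  then show ?thesis by auto
qed

text \<open>Leaves are connected by chains of plaques; a chain starting at \<open>p\<close> can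
  never leave the range, because each plaque that meets it is contained in it.\<close>

lemma range_Lf:
  assumes d: "dir p e"
  shows "range (Lf p e) = leaf p"
proof
  show "range (Lf p e) \<subseteq> leaf p" using Lf_leaf[OF d] by (auto simp: leaf_eq)
  show "leaf p \<subseteq> range (Lf p e)"
  proof
    fix q assume q: "q \<in> leaf p"
    obtain Ps where Ps: "Ps \<noteq> []" "\<forall>P\<in>set Ps. plaque f F P" "p \<in> hd Ps" "q \<in> last Ps"
      "\<forall>i<length Ps - 1. Ps ! i \<inter> Ps ! Suc i \<noteq> {}"
      using fol leaf_in q unfolding foliation_def by metis
    have sub: "P \<subseteq> range (Lf p e)" if "plaque f F P" "P \<inter> range (Lf p e) \<noteq> {}" for P
      using that plaque_subset_range[OF d] unfolding plaque_def by metis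
    have "Ps ! i \<subseteq> range (Lf p e)" if "i < length Ps" for i
      using that
    proof (induction i)
      case 0
      have "p \<in> range (Lf p e)" using Lf(1)[OF d] by (metis rangeI)
      then have "Ps ! 0 \<inter> range (Lf p e) \<noteq> {}" using Ps(1,3) by (auto simp: hd_conv_nth)
      then show ?case using sub Ps(2) 0 by simp
    next
      case (Suc i)
      then have "Ps ! i \<subseteq> range (Lf p e)" "Ps ! i \<inter> Ps ! Suc i \<noteq> {}" using Ps(5) by auto
      then have "Ps ! Suc i \<inter> range (Lf p e) \<noteq> {}" by blast
      then show ?case using sub Ps(2) Suc.prems by simp
    qed
    from this[of "length Ps - 1"] have "last Ps \<subseteq> range (Lf p e)" using Ps(1) by (simp add: last_conv_nth)
    then show "q \<in> range (Lf p e)" using Ps(4) by blast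
  qed
qed

end

section \<open>Strips of leaves along a trajectory\<close>

locale strip = pgf f F N for f :: "'m::{t2_space, second_countable_topology} \<Rightarrow> real^3" and F N +
  fixes p0 :: 'm and e0 :: "real^3"
  assumes dir0: "dir p0 e0"
begin

definition "base v = fst (Tr p0 e0 v)"
definition "ev v = snd (Tr p0 e0 v)"
definition "X z = Lf (base (snd z)) (ev (snd z)) (fst z)"
definition "r v = f (base v)"
text \<open>The leaf velocity at the base point. Together with the normal \<open>q2\<close> it is
  the pair \<open>P\<close>, \<open>Q\<close> of a box centred there in direction
  \<open>ev v\<close>, which is the source of the rotation minimizing property.\<close>

definition "q1 v = cross3 (N (base v)) (ev v)"
definition "q2 v = N (base v)"

lemma dir_base: "dir (base v) (ev v)"
  using Tr(2)[OF dir0, of v] by (simp add: traj_at_def base_def ev_def)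

lemma base0: "base 0 = p0" "ev 0 = e0"
  using Tr(1)[OF dir0] by (simp_all add: base_def ev_def)

lemma X0: "X (0, v) = base v" by (simp add: X_def Lf(1)[OF dir_base])

lemma dir_X: "dir (X (u, v)) (ev v)" by (simp add: X_def Lf_dir[OF dir_base])

lemma X_add: "Lf (X (u, v)) (ev v) t = X (u + t, v)" by (simp add: X_def Lf_add[OF dir_base])

lemma frame_base: "norm (ev v) = 1" "norm (q2 v) = 1" "ev v \<bullet> q2 v = 0" "norm (q1 v) = 1" "q1 v \<bullet> q2 v = 0" "ev v \<bullet> q1 v = 0"
  "cross3 (ev v) (q1 v) = q2 v"
proof -
  show 1: "norm (ev v) = 1" "norm (q2 v) = 1" "ev v \<bullet> q2 v = 0"
    using dir_N[OF dir_base] norm_N by (auto simp: q2_def)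
  have 2: "q2 v \<bullet> ev v = 0" using 1 by (simp add: inner_commute)
  have q: "q1 v = cross3 (q2 v) (ev v)" by (simp add: q1_def q2_def)
  note fr = frame3[OF 1(2,1) 2, folded q]
  show "norm (q1 v) = 1" "q1 v \<bullet> q2 v = 0" "ev v \<bullet> q1 v = 0" "cross3 (ev v) (q1 v) = q2 v"
    using fr by (simp_all add: inner_commute)
qed

lemma base_in_box:
  assumes bx: "box f F N eps R E P Q p' q xi eta xi' eta' chi" and b: "chi (0, 0) = base v0" "E 0 = ev v0"
  shows "\<exists>d>0. \<forall>v. \<bar>v - v0\<bar> < d \<longrightarrow> \<bar>v - v0\<bar> < eps \<and> base v = chi (0, v - v0) \<and> ev v = E (v - v0)"
proof -
  interpret box f F N eps R E P Q p' q xi eta xi' eta' chi by (rule bx)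
  have I: "v0 - 1 < v0 + 1" "v0 \<in> {v0 - 1..v0 + 1}" by auto
  have dd: "((\<lambda>u. u - v0) has_real_derivative 1) (at u)" for u by (auto intro!: derivative_eq_intros)
  have c2: "((\<lambda>u. u - v0) \<longlongrightarrow> 0) (at v0 within {v0 - 1<..<v0 + 1})"
    by (rule LIM_zero) (rule tendsto_ident_at)
  have "isCont (\<lambda>t. fst (Tr p0 e0 t)) v0" using Tr(2)[OF dir0] by (simp add: traj_at_def)
  then have lim: "((\<lambda>t. fst (Tr p0 e0 t)) \<longlongrightarrow> chi (0, 0)) (at v0 within {v0 - 1<..<v0 + 1})"
    unfolding b base_def isCont_def by (rule tendsto_within_subset) simp
  obtain d \<sigma> where d: "d > 0" "\<sigma> = 1 \<or> \<sigma> = -1"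
    "\<And>u. u \<in> {v0 - 1<..<v0 + 1} \<Longrightarrow> \<bar>u - v0\<bar> < d \<Longrightarrow> \<bar>u - v0\<bar> < eps \<and> Tr p0 e0 u = (chi (0, \<sigma> * (u - v0)), \<sigma> *\<^sub>R E (\<sigma> * (u - v0)))"
    using traj_form[OF I Tr(2)[OF dir0] dd c2 lim] by blast
  have "ev v0 = \<sigma> *\<^sub>R E 0" using d(3)[of v0] d(1) by (simp add: ev_def)
  then have "\<sigma> = 1" using d(2) b(2) E_nonzero[OF center(3)] by fastforce
  then have "\<bar>v - v0\<bar> < eps \<and> base v = chi (0, v - v0) \<and> ev v = E (v - v0)" if "\<bar>v - v0\<bar> < min d 1" for v
    using d(3)[of v] that by (auto simp: base_def ev_def abs_less_iff)
  then show ?thesis using d(1) by (intro exI[of _ "min d 1"]) auto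
qed

text \<open>The regularity of \<open>X\<close> across the leaves that is to be carried from height 0
  to every height \<open>u\<close>. That the velocity is parallel to \<open>ev\<close> says that the
  curve at height \<open>u\<close> is a trajectory up to its speed.\<close>

definition "good u v0 \<longleftrightarrow> (\<exists>d>0. \<forall>v. \<bar>v - v0\<bar> < d \<longrightarrow> isCont (\<lambda>v. X (u, v)) v \<and>
   (\<exists>k. ((\<lambda>v. f (X (u, v))) has_vector_derivative k *\<^sub>R ev v) (at v)))"

lemma ev_cont: "isCont ev v"
  using Tr(2)[OF dir0, of v] by (simp add: traj_at_def ev_def[abs_def])

text \<open>At height \<open>u1\<close> the velocity across the leaves is along \<open>E\<close>, so
  the first box coordinate is constant in \<open>v\<close>. Flowing along the leaves only shifts
  that coordinate, so one and the same function \<open>w\<close> describes \<open>X\<close> at all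
  heights inside the box.\<close>

lemma good_box:
  assumes bx: "box f F N eps R E P Q p' q xi eta xi' eta' chi" and b: "chi (0, 0) = X (us, v0)" "E 0 = ev v0"
    and u1: "\<bar>u1 - us\<bar> < eps" and good: "good u1 v0"
  shows "\<exists>d>0. \<exists>w. w v0 = 0 \<and> (\<forall>v. \<bar>v - v0\<bar> < d \<longrightarrow> \<bar>w v\<bar> < eps \<and> ev v = E (w v) \<and> (\<exists>w'. (w has_real_derivative w') (at v)) \<and>
     (\<forall>u. \<bar>u - us\<bar> < eps \<longrightarrow> X (u, v) = chi (u - us, w v)))"
proof -
  interpret box f F N eps R E P Q p' q xi eta xi' eta' chi by (rule bx)
  let ?s1 = "u1 - us"
  have flow: "Lf (chi (s, w)) (E w) t = chi (s + t, w)" if "\<bar>s\<bar> < eps" "\<bar>w\<bar> < eps" "\<bar>s + t\<bar> < eps" for s t w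
  proof -
    have lf: "leaf_at (E w) (\<lambda>t. chi (0 + 1 * t, w)) t" if "t \<in> {-eps<..<eps}" for t
      by (rule leaf_at_box) (use that \<open>\<bar>w\<bar> < eps\<close> in auto)
    show ?thesis using Lf_unique[of s "-eps" eps, OF _ lf, of "s + t"] that by (simp add: abs_less_iff)
  qed
  have start: "X (u1, v0) = chi (?s1, 0)"
    using flow[of 0 0 ?s1] X_add[of us v0 ?s1] b u1 eps by simp
  obtain d0 where d0: "d0 > 0" "\<And>v. \<bar>v - v0\<bar> < d0 \<Longrightarrow> isCont (\<lambda>v. X (u1, v)) v"
    "\<And>v. \<bar>v - v0\<bar> < d0 \<Longrightarrow> \<exists>k. ((\<lambda>v. f (X (u1, v))) has_vector_derivative k *\<^sub>R ev v) (at v)"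
    using good by (auto simp: good_def)
  have s1sq: "(?s1, 0) \<in> sq" using u1 eps by auto
  have "isCont (\<lambda>v. X (u1, v)) v0" using d0(1,2) by simp
  then have "\<forall>\<^sub>F v in at v0. X (u1, v) \<in> chi ` sq"
    unfolding isCont_def by (rule topological_tendstoD) (use box_open s1sq start in auto)
  then obtain d1 where d1: "d1 > 0" "\<And>v. v \<noteq> v0 \<Longrightarrow> \<bar>v - v0\<bar> < d1 \<Longrightarrow> X (u1, v) \<in> chi ` sq"
    unfolding eventually_at dist_real_def by blast
  define d where "d = min d0 d1"
  define J where "J = {v0 - d<..<v0 + d}"
  have J: "v \<in> J \<longleftrightarrow> \<bar>v - v0\<bar> < d" for v by (auto simp: J_def abs_less_iff)
  have dpos: "d > 0" using d0 d1 by (simp add: d_def)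
  have inb: "X (u1, v) \<in> chi ` sq" if "v \<in> J" for v
    using that d1(2)[of v] start s1sq by (cases "v = v0") (auto simp: J d_def)
  have cont: "isCont (\<lambda>v. X (u1, v)) v" if "v \<in> J" for v using d0(2)[of v] that by (simp add: J d_def)
  define s where "s v = fst (co (X (u1, v)))" for v
  define w where "w v = snd (co (X (u1, v)))" for v
  have sw: "\<bar>s v\<bar> < eps" "\<bar>w v\<bar> < eps" "chi (s v, w v) = X (u1, v)" if "v \<in> J" for v
    using co_bounds[OF inb[OF that]] by (simp_all add: s_def w_def)
  have v0J: "v0 \<in> J" using dpos by (simp add: J)
  have sw0: "s v0 = ?s1" "w v0 = 0" using co_chi[OF s1sq] start by (simp_all add: s_def w_def)
  obtain \<sigma> where \<sigma>: "\<sigma> = 1 \<or> \<sigma> = -1" "\<And>v. v \<in> J \<Longrightarrow> ev v = \<sigma> *\<^sub>R E (w v)"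
    unfolding w_def J_def
    using direction_sign[of "v0 - d" "v0 + d" "\<lambda>v. X (u1, v)" ev] inb cont ev_cont dir_X dpos unfolding J_def by auto
  have "\<sigma> = 1" using \<sigma>(1) \<sigma>(2)[OF v0J] sw0 b(2) E_nonzero[OF center(3)] by fastforce
  then have evE: "ev v = E (w v)" if "v \<in> J" for v using \<sigma>(2)[OF that] by simp
  have der: "(s has_real_derivative 0) (at v)" "\<exists>w'. (w has_real_derivative w') (at v)" if v: "v \<in> J" for v
  proof -
    obtain k where "((\<lambda>v. f (X (u1, v))) has_vector_derivative k *\<^sub>R ev v) (at v)"
      using d0(3)[of v] v by (auto simp: J d_def)
    from coordinates[OF cont[OF v] inb[OF v] this] evE[OF v] T_frame[OF sw(1,2)[OF v]]
    show "(s has_real_derivative 0) (at v)" "\<exists>w'. (w has_real_derivative w') (at v)"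
      unfolding s_def[abs_def] w_def[abs_def] by auto
  qed
  have s: "s v = ?s1" if v: "v \<in> J" for v
  proof -
    have "s v = s v0"
      by (rule has_derivative_zero_unique_connected[of J s, OF _ _ _ v v0J])
        (use der(1) in \<open>auto simp: J_def has_field_derivative_def lambda_zero\<close>)
    then show ?thesis using sw0 by simp
  qed
  have "X (u, v) = chi (u - us, w v)" if v: "v \<in> J" and u: "\<bar>u - us\<bar> < eps" for u v
  proof -
    have "X (u, v) = Lf (X (u1, v)) (ev v) (u - u1)" using X_add by simp
    also have "\<dots> = Lf (chi (?s1, w v)) (E (w v)) (u - u1)" using sw(3)[OF v] s[OF v] evE[OF v] by simp
    also have "\<dots> = chi (u - us, w v)" using flow[of ?s1 "w v" "u - u1"] sw(2)[OF v] u u1 by simp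
    finally show ?thesis .
  qed
  then show ?thesis
    using dpos sw0(2) sw(2) evE der(2) by (intro exI[of _ d] conjI exI[of _ w]) (auto simp: J)
qed

text \<open>At height 0 the curve is the base trajectory itself. Within a box goodness passes from
  one height to every other one: there \<open>X (u, v)\<close> is \<open>chi (u - us, w v)\<close>,
  whose image under \<open>f\<close> moves along \<open>E\<close> at the rate
  \<open>w' * Lam\<close>. This is the statement that the leaf flow takes trajectories to
  reparametrized trajectories.\<close>

lemma good_all: "good u v0"
proof (rule connected_local_iff[where P = "\<lambda>u. good u v0" and I = UNIV and ?t0.0 = 0])
  show "good 0 v0"
  proof -
    have "isCont base v" "((\<lambda>v. f (base v)) has_vector_derivative 1 *\<^sub>R ev v) (at v)" for v
      using Tr(2)[OF dir0, of v] by (simp_all add: traj_at_def base_def[abs_def] ev_def)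
    then show ?thesis unfolding good_def X0 by (intro exI[of _ 1] conjI allI impI exI[of _ 1]) auto
  qed
  fix us
  obtain eps R E P Q p' q xi eta xi' eta' chi where bx: "box f F N eps R E P Q p' q xi eta xi' eta' chi"
    and b: "chi (0, 0) = X (us, v0)" "E 0 = ev v0" using box_exists[OF dir_X] by metis
  interpret box f F N eps R E P Q p' q xi eta xi' eta' chi by (rule bx)
  have *: "good u v0" if u1: "\<bar>u1 - us\<bar> < eps" "good u1 v0" and u: "\<bar>u - us\<bar> < eps" for u u1
  proof -
    obtain d w where d: "d > 0" "\<And>v. \<bar>v - v0\<bar> < d \<Longrightarrow> \<bar>w v\<bar> < eps \<and> ev v = E (w v) \<and> (\<exists>w'. (w has_real_derivative w') (at v)) \<and>
     (\<forall>u. \<bar>u - us\<bar> < eps \<longrightarrow> X (u, v) = chi (u - us, w v))"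
      using good_box[OF bx b u1] by blast
    have "isCont (\<lambda>v. X (u, v)) v \<and> (\<exists>k. ((\<lambda>v. f (X (u, v))) has_vector_derivative k *\<^sub>R ev v) (at v))" if v: "\<bar>v - v0\<bar> < d" for v
    proof -
      define J where "J = {v0 - d<..<v0 + d}"
      have J: "open J" "v \<in> J" "\<And>v. v \<in> J \<longleftrightarrow> \<bar>v - v0\<bar> < d" using v by (auto simp: J_def abs_less_iff)
      obtain w' where w': "(w has_real_derivative w') (at v)" and wb: "\<bar>w v\<bar> < eps" and evE: "ev v = E (w v)" using d(2)[OF v] by blast
      have Xeq: "chi (u - us, w v) = X (u, v)" if "v \<in> J" for v using d(2)[of v] that u J(3) by simp
      have "isCont (\<lambda>v. (u - us, w v)) v" using DERIV_isCont[OF w'] by (intro isCont_Pair) auto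
      from isCont_o2[OF this chi_isCont[OF u wb]] have 1: "isCont (\<lambda>v. X (u, v)) v"
        using isCont_cong_open[OF J(1,2) Xeq] by simp
      have "((\<lambda>v. (u - us, w v)) has_derivative (\<lambda>k. (0, k * w'))) (at v)"
        using w' by (intro has_derivative_Pair has_derivative_const) (simp add: has_field_derivative_def mult_commute_abs)
      from has_derivative_compose[OF this h_has_derivative[OF u wb]]
      have "((\<lambda>v. h (u - us) (w v)) has_vector_derivative (w' * Lam (u - us) (w v)) *\<^sub>R ev v) (at v)"
        by (simp add: has_vector_derivative_def evE mult.assoc)
      then have "((\<lambda>v. f (X (u, v))) has_vector_derivative (w' * Lam (u - us) (w v)) *\<^sub>R ev v) (at v)"
      proof (rule has_vector_derivative_transform_within_open[OF _ J(1,2)])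
        fix v' assume "v' \<in> J"
        then show "h (u - us) (w v') = f (X (u, v'))" using f_box[OF u] d(2)[of v'] u J(3) by simp
      qed
      with 1 show ?thesis by blast
    qed
    then show ?thesis unfolding good_def using d(1) by blast
  qed
  have "\<forall>t'\<in>ball us eps \<inter> UNIV. good t' v0 = good us v0"
  proof
    fix t' assume "t' \<in> ball us eps \<inter> UNIV"
    then have "\<bar>t' - us\<bar> < eps" by (simp add: dist_real_def abs_minus_commute)
    then show "good t' v0 = good us v0" using *[of t' us] *[of us t'] eps by auto
  qed
  then show "\<exists>U. open U \<and> us \<in> U \<and> (\<forall>t'\<in>U \<inter> UNIV. good t' v0 = good us v0)"
    using eps by (metis centre_in_ball open_ball)
qed auto

lemma strip_box:
  assumes bx: "box f F N eps R E P Q p' q xi eta xi' eta' chi" and b: "chi (0, 0) = X (us, v0)" "E 0 = ev v0"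
  shows "\<exists>d>0. \<exists>w. w v0 = 0 \<and> (\<forall>v. \<bar>v - v0\<bar> < d \<longrightarrow> \<bar>w v\<bar> < eps \<and> ev v = E (w v) \<and> (\<exists>w'. (w has_real_derivative w') (at v)) \<and>
     (\<forall>u. \<bar>u - us\<bar> < eps \<longrightarrow> X (u, v) = chi (u - us, w v)))"
proof -
  interpret box f F N eps R E P Q p' q xi eta xi' eta' chi by (rule bx)
  show ?thesis using good_box[OF bx b, of us] good_all eps by simp
qed

lemma X_isCont: "isCont X z"
proof -
  obtain us v0 where z: "z = (us, v0)" by (metis surj_pair)
  obtain eps R E P Q p' q xi eta xi' eta' chi where bx: "box f F N eps R E P Q p' q xi eta xi' eta' chi"
    and b: "chi (0, 0) = X (us, v0)" "E 0 = ev v0" using box_exists[OF dir_X] by metis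
  interpret box f F N eps R E P Q p' q xi eta xi' eta' chi by (rule bx)
  obtain d w where d: "d > 0" "w v0 = 0" "\<And>v. \<bar>v - v0\<bar> < d \<Longrightarrow> \<bar>w v\<bar> < eps \<and> (\<exists>w'. (w has_real_derivative w') (at v)) \<and>
     (\<forall>u. \<bar>u - us\<bar> < eps \<longrightarrow> X (u, v) = chi (u - us, w v))"
    using strip_box[OF bx b] by blast
  have "isCont w v0" using d(3)[of v0] d(1) DERIV_isCont by auto
  then have "isCont (\<lambda>z. (fst z - us, w (snd z))) (us, v0)"
    using isCont_o2[of "(us, v0)" snd w] by (intro isCont_Pair continuous_intros) auto
  moreover have "isCont chi ((\<lambda>z. (fst z - us, w (snd z))) (us, v0))" using chi_isCont[of 0 0] eps d(2) by simp
  ultimately have c: "isCont (\<lambda>z. chi (fst z - us, w (snd z))) (us, v0)"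
    using isCont_o2[of "(us, v0)" "\<lambda>z. (fst z - us, w (snd z))" chi] by simp
  let ?S = "{us - eps<..<us + eps} \<times> {v0 - d<..<v0 + d}"
  have "open ?S" "(us, v0) \<in> ?S" using eps d(1) by (auto simp: open_Times)
  moreover have "X z = chi (fst z - us, w (snd z))" if "z \<in> ?S" for z
  proof -
    have "\<bar>fst z - us\<bar> < eps" "\<bar>snd z - v0\<bar> < d" using that by (auto simp: abs_less_iff mem_Times_iff)
    then show ?thesis using d(3)[of "snd z"] by (metis prod.collapse)
  qed
  then have "\<forall>\<^sub>F z in nhds (us, v0). X z = chi (fst z - us, w (snd z))"
    using calculation unfolding eventually_nhds by blast
  from isCont_cong[OF this] show ?thesis using c z by simp
qed

lemma X_v_derivative: "\<exists>k. ((\<lambda>v. f (X (u, v))) has_vector_derivative k *\<^sub>R ev v) (at v)"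
proof -
  obtain d where "d > 0" "\<And>v'. \<bar>v' - v\<bar> < d \<Longrightarrow> \<exists>k. ((\<lambda>v. f (X (u, v))) has_vector_derivative k *\<^sub>R ev v') (at v')"
    using good_all[of u v] unfolding good_def by blast
  from this(2)[of v] this(1) show ?thesis by simp
qed

text \<open>Smoothness is local. In a box centred at \<open>base v0\<close> the curve and its frame
  are the translates of \<open>R\<close>, \<open>E\<close>, \<open>P\<close> and \<open>Q\<close>,
  so everything is inherited from the normal form.\<close>

lemma base_smooth: "smooth_on UNIV r" "smooth_on UNIV ev" "smooth_on UNIV q1" "smooth_on UNIV q2"
  and r': "(r has_vector_derivative ev v) (at v)"
  and q': "\<exists>k. (q1 has_vector_derivative k *\<^sub>R ev v) (at v)" "\<exists>k. (q2 has_vector_derivative k *\<^sub>R ev v) (at v)"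
proof -
  show r'': "(r has_vector_derivative ev v) (at v)" for v
    using Tr(2)[OF dir0, of v] by (simp add: traj_at_def r_def[abs_def] base_def[abs_def] ev_def)
  have *: "\<exists>J. open J \<and> v0 \<in> J \<and> smooth_on J r \<and> smooth_on J ev \<and> smooth_on J q1 \<and> smooth_on J q2 \<and>
     (\<exists>k. (q1 has_vector_derivative k *\<^sub>R ev v0) (at v0)) \<and> (\<exists>k. (q2 has_vector_derivative k *\<^sub>R ev v0) (at v0))" for v0
  proof -
    obtain eps R E P Q p' q xi eta xi' eta' chi where bx: "box f F N eps R E P Q p' q xi eta xi' eta' chi"
      and b: "chi (0, 0) = base v0" "E 0 = ev v0" using box_exists[OF dir_base] by metis
    interpret box f F N eps R E P Q p' q xi eta xi' eta' chi by (rule bx)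
    obtain d where d: "d > 0" "\<And>v. \<bar>v - v0\<bar> < d \<Longrightarrow> \<bar>v - v0\<bar> < eps \<and> base v = chi (0, v - v0) \<and> ev v = E (v - v0)"
      using base_in_box[OF bx b] by blast
    define J where "J = {v0 - d<..<v0 + d}"
    have J: "open J" "v0 \<in> J" "\<And>v. v \<in> J \<longleftrightarrow> \<bar>v - v0\<bar> < d" using d(1) by (auto simp: J_def abs_less_iff)
    have eq: "R (- v0 + v) = r v" "E (- v0 + v) = ev v" "P (- v0 + v) = q1 v" "Q (- v0 + v) = q2 v" if "v \<in> J" for v
    proof -
      have w: "\<bar>v - v0\<bar> < eps" "base v = chi (0, v - v0)" "ev v = E (v - v0)" using d(2) that J(3) by auto
      have n: "N (base v) = Q (v - v0)" using N_box[OF center(3) w(1)] w(2) frame(4)[OF w(1)] by (simp add: init_simps)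
      show "R (- v0 + v) = r v" using f_box[OF center(3) w(1)] w(2) by (simp add: r_def init_simps)
      show "E (- v0 + v) = ev v" using w(3) by simp
      show "P (- v0 + v) = q1 v" using n w(3) frame_more(4)[OF w(1)] by (simp add: q1_def)
      show "Q (- v0 + v) = q2 v" using n by (simp add: q2_def)
    qed
    have sh: "smooth_on J (\<lambda>v. H (- v0 + v))" if "smooth_on {-eps<..<eps} H" for H :: "real \<Rightarrow> real^3"
    proof (rule smooth_on_affine_compose[OF bounded_linear_ident J(1) that])
      fix v assume "v \<in> J"
      then have "\<bar>v - v0\<bar> < eps" using d(2) J(3) by blast
      then show "- v0 + v \<in> {-eps<..<eps}" by auto
    qed
    have dsh: "(H' has_vector_derivative k *\<^sub>R ev v0) (at v0)"
      if "(H has_vector_derivative k *\<^sub>R E 0) (at 0)" "\<And>v. v \<in> J \<Longrightarrow> H (- v0 + v) = H' v" for H H' k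
    proof (rule has_vector_derivative_transform_within_open[OF _ J(1,2) that(2)])
      show "((\<lambda>v. H (- v0 + v)) has_vector_derivative k *\<^sub>R ev v0) (at v0)"
        using vector_derivative_shift[of H "k *\<^sub>R E 0" "- v0" 1 v0] that(1) b(2) by simp
    qed
    show ?thesis
      using J(1,2) smooth_on_cong[OF sh[OF smooth(1)] eq(1)] smooth_on_cong[OF sh[OF smooth(2)] eq(2)]
        smooth_on_cong[OF sh[OF smooth(3)] eq(3)] smooth_on_cong[OF sh[OF smooth(4)] eq(4)]
        dsh[OF P'[OF center(3)] eq(3)] dsh[OF Q'[OF center(3)] eq(4)] by blast
  qed
  show "smooth_on UNIV r" "smooth_on UNIV ev" "smooth_on UNIV q1" "smooth_on UNIV q2"
    by (rule smooth_on_locally; use * in blast)+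
  show "\<exists>k. (q1 has_vector_derivative k *\<^sub>R ev v) (at v)" "\<exists>k. (q2 has_vector_derivative k *\<^sub>R ev v) (at v)"
    using *[of v] by blast+
qed

end

lemma has_derivative_scaleR_prod:
  fixes \<alpha> :: "real \<Rightarrow> real" and \<beta> :: "real \<Rightarrow> 'b::real_normed_vector"
  assumes "(\<alpha> has_vector_derivative \<alpha>') (at u)" "(\<beta> has_vector_derivative \<beta>') (at v)"
  shows "((\<lambda>z. \<alpha> (fst z) *\<^sub>R \<beta> (snd z)) has_derivative (\<lambda>k. fst k *\<^sub>R (\<alpha>' *\<^sub>R \<beta> v) + snd k *\<^sub>R (\<alpha> u *\<^sub>R \<beta>'))) (at (u, v))"
proof -
  have a: "((\<lambda>z. \<alpha> (fst z)) has_derivative (\<lambda>k. fst k *\<^sub>R \<alpha>')) (at (u, v))"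
    using has_derivative_compose[OF has_derivative_fst[OF has_derivative_ident], of \<alpha> "\<lambda>h. h *\<^sub>R \<alpha>'" "(u, v)" UNIV] assms(1)
    by (simp add: has_vector_derivative_def)
  have b: "((\<lambda>z. \<beta> (snd z)) has_derivative (\<lambda>k. snd k *\<^sub>R \<beta>')) (at (u, v))"
    using has_derivative_compose[OF has_derivative_snd[OF has_derivative_ident], of \<beta> "\<lambda>h. h *\<^sub>R \<beta>'" "(u, v)" UNIV] assms(2)
    by (simp add: has_vector_derivative_def)
  show ?thesis
    by (rule has_derivative_eq_rhs[OF has_derivative_scaleR[OF a b]]) (simp add: fun_eq_iff algebra_simps)
qed

section \<open>The explicit parameterization and its derivatives\<close>

context strip
begin

definition "x u = (f (X (u, 0)) - r 0) \<bullet> q1 0"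
definition "y u = (f (X (u, 0)) - r 0) \<bullet> q2 0"
definition "k1 v = vector_derivative q1 (at v) \<bullet> ev v"
definition "k2 v = vector_derivative q2 (at v) \<bullet> ev v"

lemma ev_ev: "ev v \<bullet> ev v = 1" using frame_base(1) by (simp add: norm_eq_1)

lemma q_deriv: "(q1 has_vector_derivative k1 v *\<^sub>R ev v) (at v)" "(q2 has_vector_derivative k2 v *\<^sub>R ev v) (at v)"
proof -
  obtain k k' where k: "(q1 has_vector_derivative k *\<^sub>R ev v) (at v)" "(q2 has_vector_derivative k' *\<^sub>R ev v) (at v)"
    using q' by blast
  have "k1 v = k" "k2 v = k'"
    unfolding k1_def k2_def vector_derivative_at[OF k(1)] vector_derivative_at[OF k(2)] by (simp_all add: ev_ev)
  then show "(q1 has_vector_derivative k1 v *\<^sub>R ev v) (at v)" "(q2 has_vector_derivative k2 v *\<^sub>R ev v) (at v)"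
    using k by simp_all
qed

lemma X_perp: "(f (X (u, v)) - r v) \<bullet> ev v = 0"
proof -
  have "X (u, v) \<in> leaf (base v)" using Lf_leaf[OF dir_base] by (simp add: X_def leaf_eq)
  then show ?thesis using dir_base by (simp add: dir_def r_def)
qed

text \<open>In the product rule, \<open>f (X (u, v))\<close> and \<open>r v\<close> both move along
  \<open>ev\<close>, to which \<open>H\<close> is orthogonal, while \<open>H\<close> moves along
  \<open>ev\<close>, to which their difference is orthogonal. So every leaf has the coordinates of
  the leaf at \<open>v = 0\<close>.\<close>

lemma coordinate_constant:
  assumes H: "\<And>v. (H has_vector_derivative k v *\<^sub>R ev v) (at v)" "\<And>v. ev v \<bullet> H v = 0"
  shows "(f (X (u, v)) - r v) \<bullet> H v = (f (X (u, 0)) - r 0) \<bullet> H 0"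
proof (rule has_derivative_zero_unique_connected[of UNIV "\<lambda>v. (f (X (u, v)) - r v) \<bullet> H v"])
  fix v
  obtain m where m: "((\<lambda>v. f (X (u, v))) has_vector_derivative m *\<^sub>R ev v) (at v)" using X_v_derivative by blast
  from has_vector_derivative_inner[OF has_vector_derivative_diff[OF m r'] H(1)]
  have "((\<lambda>v. (f (X (u, v)) - r v) \<bullet> H v) has_real_derivative 0) (at v)"
    using X_perp[of u v] H(2)[of v] by (simp add: inner_diff_left)
  then show "((\<lambda>v. (f (X (u, v)) - r v) \<bullet> H v) has_derivative (\<lambda>x. 0)) (at v)"
    by (simp add: has_field_derivative_def lambda_zero)
qed auto

lemma X_formula: "f (X (u, v)) = r v + x u *\<^sub>R q1 v + y u *\<^sub>R q2 v"
proof -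
  have "(f (X (u, v)) - r v) \<bullet> q1 v = x u" "(f (X (u, v)) - r v) \<bullet> q2 v = y u"
    using coordinate_constant[OF q_deriv(1), of u v] coordinate_constant[OF q_deriv(2), of u v] frame_base
    by (simp_all add: x_def y_def)
  then show ?thesis
    using frame3(6)[OF frame_base(1,4,6), of "f (X (u, v)) - r v" v] X_perp[of u v]
    by (simp add: frame_base(7) algebra_simps)
qed

lemma leaf_smooth: "smooth_on UNIV (\<lambda>u. f (X (u, 0)))"
proof (rule smooth_on_locally)
  fix us :: real
  obtain eps R E P Q p' q xi eta xi' eta' chi where bx: "box f F N eps R E P Q p' q xi eta xi' eta' chi"
    and b: "chi (0, 0) = X (us, 0)" "E 0 = ev 0" using box_exists[OF dir_X] by metis
  interpret box f F N eps R E P Q p' q xi eta xi' eta' chi by (rule bx)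
  obtain w where w: "w 0 = 0" "\<And>u. \<bar>u - us\<bar> < eps \<Longrightarrow> X (u, 0) = chi (u - us, w 0)"
    using strip_box[OF bx b] by fastforce
  let ?J = "{us - eps<..<us + eps}"
  have sh: "smooth_on ?J (\<lambda>u. H (- us + u))" if "smooth_on {-eps<..<eps} H" for H :: "real \<Rightarrow> real"
    by (rule smooth_on_affine_compose[OF bounded_linear_ident _ that]) auto
  have "smooth_on ?J (\<lambda>u. R 0 + xi (- us + u) *\<^sub>R P 0 + eta (- us + u) *\<^sub>R Q 0)"
    by (intro smooth_on_add smooth_on_scaleR sh smooth smooth_on_const) auto
  then have "smooth_on ?J (\<lambda>u. f (X (u, 0)))"
  proof (rule smooth_on_cong)
    fix u assume "u \<in> ?J"
    then have u: "\<bar>u - us\<bar> < eps" by auto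
    show "R 0 + xi (- us + u) *\<^sub>R P 0 + eta (- us + u) *\<^sub>R Q 0 = f (X (u, 0))"
      using w(2)[OF u] w(1) f_box[OF u center(3)] by (simp add: h_def)
  qed
  then show "\<exists>T. open T \<and> us \<in> T \<and> smooth_on T (\<lambda>u. f (X (u, 0)))"
    using eps by (intro exI[of _ ?J]) auto
qed simp

lemma xy_smooth: "smooth_on UNIV x" "smooth_on UNIV y"
  unfolding x_def[abs_def] y_def[abs_def]
  by (intro smooth_on_inner smooth_on_diff leaf_smooth smooth_on_const open_UNIV)+

lemma xy_deriv: "(x has_vector_derivative d1 x u) (at u)" "(y has_vector_derivative d1 y u) (at u)"
  using smooth_on_has_vector_derivative[OF xy_smooth(1)] smooth_on_has_vector_derivative[OF xy_smooth(2)]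
  by (simp_all add: d1_def)

lemma frame_inner: "q1 v \<bullet> q1 v = 1" "q2 v \<bullet> q2 v = 1" "q1 v \<bullet> q2 v = 0" "q2 v \<bullet> q1 v = 0"
  "ev v \<bullet> q1 v = 0" "q1 v \<bullet> ev v = 0" "ev v \<bullet> q2 v = 0" "q2 v \<bullet> ev v = 0"
  using frame_base[of v] by (simp_all add: norm_eq_1 inner_commute)

lemma unit_speed_xy: "(d1 x u)\<^sup>2 + (d1 y u)\<^sup>2 = 1"
proof -
  have "leaf_at (ev 0) (Lf (base 0) (ev 0)) u" by (rule Lf(2)[OF dir_base])
  then have 1: "((\<lambda>u. f (X (u, 0))) has_vector_derivative cross3 (N (X (u, 0))) (ev 0)) (at u)"
    by (simp add: leaf_at_def X_def)
  have "((\<lambda>u. r 0 + x u *\<^sub>R q1 0 + y u *\<^sub>R q2 0) has_vector_derivative 0 + (x u *\<^sub>R 0 + d1 x u *\<^sub>R q1 0) + (y u *\<^sub>R 0 + d1 y u *\<^sub>R q2 0)) (at u)"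
    using xy_deriv[of u]
    by (intro has_vector_derivative_add has_vector_derivative_scaleR has_vector_derivative_const)
      (simp_all add: has_real_derivative_iff_has_vector_derivative)
  then have "((\<lambda>u. f (X (u, 0))) has_vector_derivative d1 x u *\<^sub>R q1 0 + d1 y u *\<^sub>R q2 0) (at u)"
    unfolding X_formula by simp
  with 1 have "cross3 (N (X (u, 0))) (ev 0) = d1 x u *\<^sub>R q1 0 + d1 y u *\<^sub>R q2 0" by (rule vector_derivative_unique_at)
  then have "(d1 x u *\<^sub>R q1 0 + d1 y u *\<^sub>R q2 0) \<bullet> (d1 x u *\<^sub>R q1 0 + d1 y u *\<^sub>R q2 0) = 1"
    using norm_leaf_velocity[OF dir_X[of u 0]] by (simp add: norm_eq_1)
  then show ?thesis
    by (simp add: inner_add_left inner_add_right frame_inner power2_eq_square)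
qed

text \<open>The counterpart of \<open>Lam\<close> along the whole strip: the signed speed of the
  trajectory at height \<open>u\<close> when it is run in the time of the base trajectory.\<close>

definition "g u v = 1 + x u * k1 v + y u * k2 v"

lemma fX_eq: "f \<circ> X = (\<lambda>z. r (snd z) + x (fst z) *\<^sub>R q1 (snd z) + y (fst z) *\<^sub>R q2 (snd z))"
proof
  fix z :: "real \<times> real"
  show "(f \<circ> X) z = r (snd z) + x (fst z) *\<^sub>R q1 (snd z) + y (fst z) *\<^sub>R q2 (snd z)"
    using X_formula[of "fst z" "snd z"] by simp
qed

lemma fX_deriv:
  "((f \<circ> X) has_derivative (\<lambda>k. fst k *\<^sub>R (d1 x u *\<^sub>R q1 v + d1 y u *\<^sub>R q2 v) + snd k *\<^sub>R (g u v *\<^sub>R ev v))) (at (u, v))"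
proof -
  have c: "((\<lambda>_. 1::real) has_vector_derivative 0) (at u)" by (rule has_vector_derivative_const)
  have "((\<lambda>z. r (snd z)) has_derivative (\<lambda>k. snd k *\<^sub>R ev v)) (at (u, v))"
    using has_derivative_scaleR_prod[OF c r'[of v]] by simp
  from has_derivative_add[OF has_derivative_add[OF this has_derivative_scaleR_prod[OF xy_deriv(1) q_deriv(1)]]
      has_derivative_scaleR_prod[OF xy_deriv(2) q_deriv(2)]]
  show ?thesis unfolding fX_eq
    by (rule has_derivative_eq_rhs) (simp add: g_def fun_eq_iff algebra_simps)
qed

lemma pd_fX: "pd1 (f \<circ> X) (u, v) = d1 x u *\<^sub>R q1 v + d1 y u *\<^sub>R q2 v" "pd2 (f \<circ> X) (u, v) = g u v *\<^sub>R ev v"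
  unfolding pd1_def pd2_def frechet_derivative_at[OF fX_deriv, symmetric] by simp_all

lemma fX_smooth: "smooth_on UNIV (f \<circ> X)"
proof -
  have s: "smooth_on UNIV (\<lambda>z. H (snd z))" if "smooth_on UNIV H" for H :: "real \<Rightarrow> real^3"
    using smooth_on_affine_compose[OF bounded_linear_snd open_UNIV that, of 0] by simp
  have t: "smooth_on UNIV (\<lambda>z. H (fst z))" if "smooth_on UNIV H" for H :: "real \<Rightarrow> real"
    using smooth_on_affine_compose[OF bounded_linear_fst open_UNIV that, of 0] by simp
  show ?thesis unfolding fX_eq
    by (intro smooth_on_add smooth_on_scaleR s t base_smooth xy_smooth)
qed

text \<open>Differentiating the leaf velocity in \<open>v\<close> meets only \<open>q1'\<close> and
  \<open>q2'\<close>, both parallel to \<open>ev\<close>. The mixed derivative is therefore tangent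
  to the surface, which is the vanishing of the mixed coefficient of the second fundamental
  form.\<close>

lemma pd12: "\<exists>m. pd2 (pd1 (f \<circ> X)) (u, v) = m *\<^sub>R ev v"
proof -
  have "pd1 (f \<circ> X) = (\<lambda>z. d1 x (fst z) *\<^sub>R q1 (snd z) + d1 y (fst z) *\<^sub>R q2 (snd z))"
    using pd_fX(1) by (metis prod.collapse ext)
  moreover have "(d1 H has_vector_derivative d1 (d1 H) u) (at u)" if "smooth_on UNIV H" for H :: "real \<Rightarrow> real"
    using smooth_on_has_vector_derivative[OF smooth_on_deriv[OF that], of u] by (simp add: d1_def[abs_def])
  note dd = this[OF xy_smooth(1)] this[OF xy_smooth(2)]
  ultimately have "(pd1 (f \<circ> X) has_derivative (\<lambda>k. (fst k *\<^sub>R (d1 (d1 x) u *\<^sub>R q1 v) + snd k *\<^sub>R (d1 x u *\<^sub>R (k1 v *\<^sub>R ev v)))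
     + (fst k *\<^sub>R (d1 (d1 y) u *\<^sub>R q2 v) + snd k *\<^sub>R (d1 y u *\<^sub>R (k2 v *\<^sub>R ev v))))) (at (u, v))"
    using has_derivative_add[OF has_derivative_scaleR_prod[OF dd(1) q_deriv(1)] has_derivative_scaleR_prod[OF dd(2) q_deriv(2)]] by simp
  from frechet_derivative_at[OF this, symmetric]
  have "pd2 (pd1 (f \<circ> X)) (u, v) = (d1 x u * k1 v + d1 y u * k2 v) *\<^sub>R ev v"
    by (simp add: pd2_def algebra_simps)
  then show ?thesis by blast
qed

text \<open>Makes the speed at height \<open>u\<close> explicit. Since \<open>g u\<close> is smooth,
  its antiderivative exists and serves as the time change when trajectories at different heights are
  compared.\<close>

lemma traj_shifted: "traj_at (\<lambda>v. g u v) (\<lambda>v. (X (u, v), ev v)) v"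
proof -
  have "((\<lambda>v. (u, v)) has_derivative (\<lambda>h. (0, h))) (at v)"
    by (intro has_derivative_Pair has_derivative_ident has_derivative_const)
  from has_derivative_compose[OF this fX_deriv]
  have "((\<lambda>v. f (X (u, v))) has_vector_derivative g u v *\<^sub>R ev v) (at v)"
    by (simp add: has_vector_derivative_def)
  moreover have "isCont (\<lambda>v. X (u, v)) v"
    using isCont_o2[of v "\<lambda>v. (u, v)" X] X_isCont by (simp add: isCont_Pair)
  ultimately show ?thesis using ev_cont dir_X by (simp add: traj_at_def)
qed

lemma g_smooth: "smooth_on UNIV (g u)"
  unfolding g_def[abs_def] k1_def k2_def
  by (intro smooth_on_add smooth_on_mult smooth_on_const open_UNIV smooth_on_inner smooth_on_deriv base_smooth)

lemma X_image: "X ` (UNIV \<times> {v}) \<in> F"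
proof -
  have "X ` (UNIV \<times> {v}) = range (Lf (base v) (ev v))" by (auto simp: X_def image_iff)
  then show ?thesis using range_Lf[OF dir_base] leaf_in(1) by metis
qed

text \<open>Flow the centre trajectory of the box back along its leaves to the line \<open>u = 0\<close>: by uniqueness
  it is there a reparametrization of the base trajectory.\<close>

lemma box_lift:
  assumes bx: "box f F N eps R E P Q p' q xi eta xi' eta' chi" and s0: "\<bar>s0\<bar> < eps" and w0: "\<bar>w0\<bar> < eps"
    and X: "X (u0, v0) = chi (s0, w0)"
  obtains u1 \<sigma> \<kappa> where "\<sigma> = 1 \<or> \<sigma> = -1" "u1 + \<sigma> * s0 = u0" "\<kappa> w0 = v0"
    "\<And>w. \<bar>w\<bar> < eps \<Longrightarrow> \<exists>\<kappa>'. (\<kappa> has_real_derivative \<kappa>') (at w)"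
    "\<And>s w. \<bar>s\<bar> < eps \<Longrightarrow> \<bar>w\<bar> < eps \<Longrightarrow> X (u1 + \<sigma> * s, \<kappa> w) = chi (s, w)"
proof -
  interpret box f F N eps R E P Q p' q xi eta xi' eta' chi by (rule bx)
  obtain \<sigma> where \<sigma>: "\<sigma> = 1 \<or> \<sigma> = -1" "ev v0 = \<sigma> *\<^sub>R E w0"
    using dir_box[OF s0 w0, of "ev v0"] dir_X[of u0 v0] X by (metis scaleR_minus1_left scaleR_one)
  have \<sigma>2: "\<sigma> * \<sigma> = 1" "\<sigma> * (\<sigma> * t) = t" for t using \<sigma>(1) by auto
  have flow: "Lf (chi (s, w)) (\<sigma> *\<^sub>R E w) t = chi (s + \<sigma> * t, w)" if "\<bar>s\<bar> < eps" "\<bar>w\<bar> < eps" "\<bar>s + \<sigma> * t\<bar> < eps" for s t w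
  proof -
    have lf: "leaf_at (\<sigma> *\<^sub>R E w) (\<lambda>t. chi (s + \<sigma> * t, w)) t" if "t \<in> {-eps - \<sigma> * s<..<eps - \<sigma> * s}" for t
      by (rule leaf_at_box[OF \<sigma>(1) refl \<open>\<bar>w\<bar> < eps\<close>]) (use that \<sigma>(1) in auto)
    have "t \<in> {-eps - \<sigma> * s<..<eps - \<sigma> * s}" "0 \<in> {-eps - \<sigma> * s<..<eps - \<sigma> * s}" using that \<sigma>(1) by auto
    from Lf_unique[OF this(2) lf this(1)] show ?thesis by simp
  qed
  \<comment> \<open>Moves along the leaf to the centre line \<open>s = 0\<close> of the box, where
    the vertical line is a unit speed trajectory.\<close>
  define u1 where "u1 = u0 - \<sigma> * s0"
  have u1: "X (u1, v0) = chi (0, w0)"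
    using X_add[of u0 v0 "- \<sigma> * s0"] flow[OF s0 w0, of "- \<sigma> * s0"] eps X \<sigma> by (auto simp: u1_def)
  have dirc: "dir (chi (0, w0)) (ev v0)" using dir_X[of u1 v0] u1 by simp
  \<comment> \<open>A second strip, whose base trajectory runs along the centre line of the box in
    the direction carried by \<open>X\<close>. Its curve at height \<open>- u1\<close> starts at the
    point \<open>base v0\<close> of the original base trajectory.\<close>
  interpret S: strip f F N "chi (0, w0)" "ev v0" by unfold_locales (rule dirc)
  define a b where "a = - eps - \<sigma> * w0" and "b = eps - \<sigma> * w0"
  have ab: "t \<in> {a<..<b} \<longleftrightarrow> \<bar>w0 + \<sigma> * t\<bar> < eps" for t using \<sigma>(1) by (auto simp: a_def b_def)
  have z: "0 \<in> {a<..<b}" using ab[of 0] w0 by simp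
  have Sb: "S.base t = chi (0, w0 + \<sigma> * t)" "S.ev t = \<sigma> *\<^sub>R E (w0 + \<sigma> * t)" if t: "t \<in> {a<..<b}" for t
  proof -
    have tr: "traj_at (\<lambda>_. 1) (\<lambda>t. (chi (0, w0 + \<sigma> * t), \<sigma> *\<^sub>R E (w0 + \<sigma> * t))) t" if "t \<in> {a<..<b}" for t
      by (rule traj_at_box[OF \<sigma>(1)]) (use ab that in blast)
    have "(chi (0, w0 + \<sigma> * t), \<sigma> *\<^sub>R E (w0 + \<sigma> * t)) = Tr (chi (0, w0)) (ev v0) t"
      by (rule Tr_unique[where \<theta> = "\<lambda>t. t", OF z tr t _ dirc])
        (use Tr(1)[OF dirc] \<sigma>(2) in \<open>auto intro!: derivative_eq_intros\<close>)
    then show "S.base t = chi (0, w0 + \<sigma> * t)" "S.ev t = \<sigma> *\<^sub>R E (w0 + \<sigma> * t)"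
      by (metis S.base_def fst_conv, metis S.ev_def snd_conv)
  qed
  have SX: "S.X (u, t) = chi (\<sigma> * u, w0 + \<sigma> * t)" if "\<bar>\<sigma> * u\<bar> < eps" "t \<in> {a<..<b}" for u t
    using flow[of 0 "w0 + \<sigma> * t" u] Sb[OF that(2)] ab[of t] that eps by (simp add: S.X_def)
  have "smooth_on {a<..<b} (S.g (- u1))" using smooth_on_subset[OF S.g_smooth] by simp
  then obtain G where G: "G 0 = 0" "\<And>t. t \<in> {a<..<b} \<Longrightarrow> (G has_real_derivative S.g (- u1) t) (at t)"
    using smooth_antiderivative z by metis
  \<comment> \<open>The time on the original base trajectory that corresponds to time
    \<open>t\<close> in the second strip; its derivative is the speed of the second strip at height
    \<open>- u1\<close>.\<close>
  define \<theta> where "\<theta> t = v0 + G t" for t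
  have \<theta>: "\<theta> 0 = v0" "\<And>t. t \<in> {a<..<b} \<Longrightarrow> (\<theta> has_real_derivative S.g (- u1) t) (at t)"
    unfolding \<theta>_def using G by (auto intro!: derivative_eq_intros)
  have Tt: "(S.X (- u1, t), S.ev t) = Tr p0 e0 (\<theta> t)" if t: "t \<in> {a<..<b}" for t
  proof (rule Tr_unique[where \<Gamma> = "\<lambda>t. (S.X (- u1, t), S.ev t)" and \<theta> = \<theta>, OF z S.traj_shifted t \<theta>(2) dir0])
    have "S.X (- u1, 0) = X (0, v0)"
      using X_add[of u1 v0 "- u1"] S.base0 u1 by (simp add: S.X_def)
    then show "(S.X (- u1, 0), S.ev 0) = Tr p0 e0 (\<theta> 0)"
      using X0 S.base0 \<theta>(1) by (simp add: base_def ev_def)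
  qed
  have lift: "X (u1 + u, \<theta> t) = S.X (u, t)" if t: "t \<in> {a<..<b}" for u t
  proof -
    have "base (\<theta> t) = S.X (- u1, t)" "ev (\<theta> t) = S.ev t"
      using Tt[OF t] by (metis base_def fst_conv, metis ev_def snd_conv Tt[OF t])
    then show ?thesis using S.X_add[of "- u1" t "u1 + u"] by (simp add: X_def)
  qed
  define \<kappa> where "\<kappa> w = \<theta> (\<sigma> * (w - w0))" for w
  have tt: "\<sigma> * (w - w0) \<in> {a<..<b}" if "\<bar>w\<bar> < eps" for w
  proof -
    have "w0 + \<sigma> * (\<sigma> * (w - w0)) = w" using \<sigma>2(2)[of "w - w0"] by linarith
    then show ?thesis unfolding ab using that by presburger
  qed
  show thesis
  proof (rule that[OF \<sigma>(1)])
    show "u1 + \<sigma> * s0 = u0" "\<kappa> w0 = v0" by (simp_all add: u1_def \<kappa>_def \<theta>(1))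
    fix w assume w: "\<bar>w\<bar> < eps"
    have "((\<lambda>w. \<sigma> * (w - w0)) has_real_derivative \<sigma>) (at w)" by (auto intro!: derivative_eq_intros)
    from DERIV_chain2[OF \<theta>(2)[OF tt[OF w]] this] show "\<exists>\<kappa>'. (\<kappa> has_real_derivative \<kappa>') (at w)"
      unfolding \<kappa>_def by blast
    fix s assume s: "\<bar>s\<bar> < eps"
    show "X (u1 + \<sigma> * s, \<kappa> w) = chi (s, w)"
      using lift[OF tt[OF w], of "\<sigma> * s"] SX[OF _ tt[OF w], of "\<sigma> * s"] s \<sigma>2 by (simp add: \<kappa>_def)
  qed
qed

text \<open>If \<open>g\<close> vanished, \<open>f (X (u0, v))\<close> would be stationary at
  \<open>v0\<close>. But \<open>box_lift\<close> writes the centre line of a box, which has unit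
  speed, as \<open>X (u0, \<kappa> w)\<close> with \<open>\<kappa>\<close> differentiable, so the
  chain rule would give it velocity 0.\<close>

lemma g_nonzero: "g u0 v0 \<noteq> 0"
proof
  assume g0: "g u0 v0 = 0"
  obtain eps R E P Q p' q xi eta xi' eta' chi where bx: "box f F N eps R E P Q p' q xi eta xi' eta' chi"
    and b: "chi (0, 0) = X (u0, v0)" using box_exists[OF dir_X] by metis
  interpret box f F N eps R E P Q p' q xi eta xi' eta' chi by (rule bx)
  obtain u1 \<sigma> \<kappa> where l: "u1 + \<sigma> * 0 = u0" "\<kappa> 0 = v0" "\<And>w. \<bar>w\<bar> < eps \<Longrightarrow> \<exists>\<kappa>'. (\<kappa> has_real_derivative \<kappa>') (at w)"
    "\<And>s w. \<bar>s\<bar> < eps \<Longrightarrow> \<bar>w\<bar> < eps \<Longrightarrow> X (u1 + \<sigma> * s, \<kappa> w) = chi (s, w)"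
    using box_lift[OF bx center(3) center(3) b[symmetric]] by metis
  obtain \<kappa>' where \<kappa>': "(\<kappa> has_vector_derivative \<kappa>') (at 0)"
    using l(3)[OF center(3)] by (auto simp: has_real_derivative_iff_has_vector_derivative)
  have "((\<lambda>v. f (X (u0, v))) has_vector_derivative 0) (at (\<kappa> 0))"
    using traj_shifted[of u0 v0] g0 l(2) by (simp add: traj_at_def)
  from vector_diff_chain_at[OF \<kappa>' this]
  have "((\<lambda>w. f (X (u0, \<kappa> w))) has_vector_derivative 0) (at 0)" by (simp add: o_def)
  then have "(R has_vector_derivative 0) (at 0)"
  proof (rule has_vector_derivative_transform_within_open[of _ _ _ "{-eps<..<eps}"])
    fix w assume "w \<in> {-eps<..<eps}"
    then have w: "\<bar>w\<bar> < eps" by auto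
    show "f (X (u0, \<kappa> w)) = R w" using l(1) l(4)[OF center(3) w] f_box[OF center(3) w] by (simp add: init_simps)
  qed (use eps in auto)
  with R'[OF center(3)] have "E 0 = 0" by (rule vector_derivative_unique_at)
  then show False using frame(1)[OF center(3)] by simp
qed

lemma curvature_line: "curvature_line_coordinates (f \<circ> X)"
  unfolding curvature_line_coordinates_def
proof (intro conjI allI fX_smooth)
  fix w :: "real \<times> real"
  obtain u v where w: "w = (u, v)" by (metis surj_pair)
  let ?t = "d1 x u *\<^sub>R q1 v + d1 y u *\<^sub>R q2 v"
  have te: "?t \<bullet> ev v = 0" by (simp add: inner_add_left frame_inner)
  have "?t \<bullet> ?t = 1"
    using unit_speed_xy[of u] by (simp add: inner_add_left inner_add_right frame_inner power2_eq_square)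
  then have "norm ?t = 1" by (simp add: norm_eq_1)
  then have "norm (cross3 ?t (ev v)) = 1" using frame3(1) frame_base(1) te by blast
  then have "cross3 ?t (ev v) \<noteq> 0" by auto
  then show "cross3 (pd1 (f \<circ> X) w) (pd2 (f \<circ> X) w) \<noteq> 0"
    unfolding w pd_fX using g_nonzero[of u v] by (simp add: cross_mult_right)
  show "pd1 (f \<circ> X) w \<bullet> pd2 (f \<circ> X) w = 0" unfolding w pd_fX using te by simp
  obtain m where "pd2 (pd1 (f \<circ> X)) w = m *\<^sub>R ev v" using pd12 w by metis
  then show "pd2 (pd1 (f \<circ> X)) w \<bullet> cross3 (pd1 (f \<circ> X) w) (pd2 (f \<circ> X) w) = 0"
    unfolding w pd_fX by (simp add: cross_mult_right dot_cross_self)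
qed

end

section \<open>Covering maps from local sections\<close>

lemma sections_agree:
  fixes S S' :: "'m::topological_space \<Rightarrow> 'z::t2_space"
  assumes U: "open U" "connected U" and c: "continuous_on U S" "continuous_on U S'"
    and X: "\<And>m. m \<in> U \<Longrightarrow> X (S m) = m" "\<And>m. m \<in> U \<Longrightarrow> X (S' m) = m" and op: "open (S ` U)"
    and m0: "m0 \<in> U" "S m0 = S' m0" and m: "m \<in> U"
  shows "S m = S' m"
proof (rule connected_local_iff[where P = "\<lambda>m. S m = S' m", OF U(2) m0 _ m])
  fix t assume t: "t \<in> U"
  have pre: "\<exists>V. open V \<and> t \<in> V \<and> V \<subseteq> U \<and> (\<forall>m\<in>V. H m \<in> A)" if "continuous_on U H" "open A" "H t \<in> A" for H :: "'m \<Rightarrow> 'z" and A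
    using continuous_on_open_vimage[OF U(1)] that t by (intro exI[of _ "H -` A \<inter> U"]) auto
  show "\<exists>V. open V \<and> t \<in> V \<and> (\<forall>t'\<in>V \<inter> U. (S t' = S' t') = (S t = S' t))"
  proof (cases "S t = S' t")
    case True
    obtain V where V: "open V" "t \<in> V" "V \<subseteq> U" "\<forall>m\<in>V. S' m \<in> S ` U"
      using pre[OF c(2) op] True t by (metis imageI)
    have "S m = S' m" if mV: "m \<in> V" for m
    proof -
      have "S' m \<in> S ` U" using V(4) mV by blast
      then obtain m' where "m' \<in> U" "S' m = S m'" by blast
      moreover have "X (S' m) = m" using X(2) V(3) mV by blast
      ultimately show ?thesis using X(1) by metis
    qed
    then show ?thesis using True V by (intro exI[of _ V]) auto
  next
    case False
    then obtain A B where AB: "open A" "open B" "S t \<in> A" "S' t \<in> B" "A \<inter> B = {}" using hausdorff by metis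
    obtain V where V: "open V" "t \<in> V" "\<forall>m\<in>V. S m \<in> A" using pre[OF c(1) AB(1,3)] by blast
    obtain V' where V': "open V'" "t \<in> V'" "\<forall>m\<in>V'. S' m \<in> B" using pre[OF c(2) AB(2,4)] by blast
    have "\<forall>t'\<in>(V \<inter> V') \<inter> U. S t' \<noteq> S' t'" using V V' AB(5) by fastforce
    then show ?thesis using False V V' by (intro exI[of _ "V \<inter> V'"]) auto
  qed
qed

text \<open>The images of the sections are the sheets over \<open>U\<close>, disjoint by
  \<open>sections_agree\<close>. Surjectivity comes from the same hypothesis: once \<open>U\<close>
  meets the range, a section shows that \<open>U\<close> lies in it, so the range is open and closed
  in a connected space.\<close>

lemma covering_space_sections:
  fixes X :: "'z::t2_space \<Rightarrow> 'm::topological_space"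
  assumes conn: "connected (UNIV :: 'm set)" and cont: "continuous_on UNIV X"
    and sec: "\<And>m. \<exists>U. open U \<and> m \<in> U \<and> connected U \<and>
      (\<forall>z. X z \<in> U \<longrightarrow> (\<exists>S. continuous_on U S \<and> (\<forall>m\<in>U. X (S m) = m) \<and> S (X z) = z \<and> open (S ` U)))"
  shows "covering_space UNIV X UNIV"
proof -
  have op: "open (range X)"
  proof (subst open_subopen, rule ballI)
    fix m assume "m \<in> range X"
    then obtain z where z: "m = X z" by blast
    obtain U where U: "open U" "m \<in> U" "\<And>z. X z \<in> U \<Longrightarrow> \<exists>S. \<forall>m\<in>U. X (S m) = m" using sec[of m] by fastforce
    then obtain S where "\<forall>m\<in>U. X (S m) = m" using z by blast
    then have "U \<subseteq> range X" by (metis rangeI subsetI)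
    then show "\<exists>T. open T \<and> m \<in> T \<and> T \<subseteq> range X" using U by blast
  qed
  have cl: "open (- range X)"
  proof (subst open_subopen, rule ballI)
    fix m assume m: "m \<in> - range X"
    obtain U where U: "open U" "m \<in> U" "\<And>z. X z \<in> U \<Longrightarrow> \<exists>S. \<forall>m\<in>U. X (S m) = m" using sec[of m] by fastforce
    have "U \<inter> range X = {}"
    proof (rule ccontr)
      assume "U \<inter> range X \<noteq> {}"
      then obtain z where "X z \<in> U" by blast
      then obtain S where "\<forall>m\<in>U. X (S m) = m" using U(3) by blast
      then have "X (S m) = m" using U(2) by blast
      then show False using m by (metis ComplD rangeI)
    qed
    then show "\<exists>T. open T \<and> m \<in> T \<and> T \<subseteq> - range X" using U by blast
  qed
  have surj: "range X = UNIV"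
    using conn op cl unfolding connected_clopen by (auto simp: closed_def)
  show ?thesis
    unfolding covering_space_def
  proof (intro conjI ballI)
    show "continuous_on UNIV X" "X ` UNIV = UNIV" by (rule cont, rule surj)
    fix m
    obtain U where U: "open U" "m \<in> U" "connected U"
      "\<And>z. X z \<in> U \<Longrightarrow> \<exists>S. continuous_on U S \<and> (\<forall>m\<in>U. X (S m) = m) \<and> S (X z) = z \<and> open (S ` U)" using sec[of m] by blast
    define V where "V = {S ` U | S. continuous_on U S \<and> (\<forall>m\<in>U. X (S m) = m) \<and> open (S ` U)}"
    show "\<exists>T. m \<in> T \<and> openin (top_of_set UNIV) T \<and> (\<exists>v. \<Union> v = UNIV \<inter> X -` T \<and>
       (\<forall>u\<in>v. openin (top_of_set UNIV) u) \<and> pairwise disjnt v \<and> (\<forall>u\<in>v. \<exists>q. homeomorphism u T X q))"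
    proof (intro exI[of _ U] conjI exI[of _ V])
      show "\<Union> V = UNIV \<inter> X -` U"
      proof
        show "\<Union> V \<subseteq> UNIV \<inter> X -` U" by (auto simp: V_def)
        show "UNIV \<inter> X -` U \<subseteq> \<Union> V"
        proof
          fix z assume "z \<in> UNIV \<inter> X -` U"
          then have z: "X z \<in> U" by simp
          then obtain S where "continuous_on U S" "\<forall>m\<in>U. X (S m) = m" "S (X z) = z" "open (S ` U)" using U(4) by blast
          then have "S ` U \<in> V" "z \<in> S ` U" using z by (auto simp: V_def intro: image_eqI[of _ _ "X z"])
          then show "z \<in> \<Union> V" by blast
        qed
      qed
      show "pairwise disjnt V"
      proof (rule pairwiseI)
        fix A B assume AB: "A \<in> V" "B \<in> V" "A \<noteq> B"
        obtain S where S: "A = S ` U" "continuous_on U S" "\<And>m. m \<in> U \<Longrightarrow> X (S m) = m" "open (S ` U)"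
          using AB(1) unfolding V_def by blast
        obtain S' where S': "B = S' ` U" "continuous_on U S'" "\<And>m. m \<in> U \<Longrightarrow> X (S' m) = m"
          using AB(2) unfolding V_def by blast
        show "disjnt A B"
        proof (rule ccontr)
          assume "\<not> disjnt A B"
          then obtain m1 m2 where m: "m1 \<in> U" "m2 \<in> U" "S m1 = S' m2" using S(1) S'(1) by (auto simp: disjnt_def)
          then have "m1 = m2" using S(3) S'(3) by metis
          then have "S x = S' x" if "x \<in> U" for x
            using sections_agree[OF U(1,3) S(2) S'(2) S(3) S'(3) S(4) m(1) _ that] m(3) by simp
          then have "A = B" using S(1) S'(1) by simp
          then show False using AB(3) by simp
        qed
      qed
      show "\<forall>u\<in>V. \<exists>q. homeomorphism u U X q"
      proof
        fix u assume "u \<in> V"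
        then obtain S where S: "u = S ` U" "continuous_on U S" "\<And>m. m \<in> U \<Longrightarrow> X (S m) = m" by (auto simp: V_def)
        have "homeomorphism u U X S"
          unfolding homeomorphism_def S(1)
          using S(2,3) continuous_on_subset[OF cont] by (auto simp: image_iff)
        then show "\<exists>q. homeomorphism u U X q" by blast
      qed
    qed (use U in \<open>auto simp: V_def\<close>)
  qed
qed

section \<open>The covering property and the conclusion\<close>

context strip
begin

text \<open>A single box around \<open>m\<close> is evenly covered: \<open>box_lift\<close> lifts
  all of it, whichever of its points the given preimage lies over.\<close>

lemma covering: "covering_space UNIV X UNIV"
proof (rule covering_space_sections[OF conn])
  show "continuous_on UNIV X" using X_isCont by (simp add: continuous_at_imp_continuous_on)
  fix m
  obtain e where "dir m e" using dir_exists by blast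
  then obtain eps R E P Q p' q xi eta xi' eta' chi where bx: "box f F N eps R E P Q p' q xi eta xi' eta' chi"
    and b: "chi (0, 0) = m" using box_exists by metis
  interpret box f F N eps R E P Q p' q xi eta xi' eta' chi by (rule bx)
  let ?U = "chi ` sq"
  have "connected ?U"
    by (rule connected_continuous_image[OF chi_cont]) (intro connected_Times connected_Ioo)
  moreover have "\<exists>S. continuous_on ?U S \<and> (\<forall>m\<in>?U. X (S m) = m) \<and> S (X z) = z \<and> open (S ` ?U)" if z: "X z \<in> ?U" for z
  proof -
    obtain u0 v0 where z0: "z = (u0, v0)" by (metis surj_pair)
    note cb = co_bounds[OF z]
    let ?s0 = "fst (co (X z))" and ?w0 = "snd (co (X z))"
    have "X (u0, v0) = chi (?s0, ?w0)" using cb(3) z0 by simp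
    from box_lift[OF bx cb(1,2) this] obtain u1 \<sigma> \<kappa> where l: "u1 + \<sigma> * ?s0 = u0" "\<kappa> ?w0 = v0"
      "\<And>w. \<bar>w\<bar> < eps \<Longrightarrow> \<exists>\<kappa>'. (\<kappa> has_real_derivative \<kappa>') (at w)"
      "\<And>s w. \<bar>s\<bar> < eps \<Longrightarrow> \<bar>w\<bar> < eps \<Longrightarrow> X (u1 + \<sigma> * s, \<kappa> w) = chi (s, w)" by metis
    define K where "K z = (u1 + \<sigma> * fst z, \<kappa> (snd z))" for z
    define S where "S m = K (co m)" for m
    have "continuous_on {-eps<..<eps} \<kappa>"
      by (rule continuous_at_imp_continuous_on) (use l(3) DERIV_isCont in \<open>force simp: abs_less_iff\<close>)
    then have "continuous_on sq (\<lambda>z. \<kappa> (snd z))"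
      by (rule continuous_on_compose2[OF _ continuous_on_snd[OF continuous_on_id]]) auto
    then have Kc: "continuous_on sq K"
      unfolding K_def by (intro continuous_intros)
    have Sc: "continuous_on ?U S"
      unfolding S_def by (rule continuous_on_compose2[OF Kc co_cont]) (use chi_co(2) in blast)
    have XS: "X (S m) = m" if "m \<in> ?U" for m
      using l(4)[OF co_bounds(1,2)[OF that]] co_bounds(3)[OF that] by (simp add: S_def K_def)
    have XK: "X (K z) = chi z" if "z \<in> sq" for z
      using XS[of "chi z"] co_chi[OF that] that by (simp add: S_def)
    \<comment> \<open>\<open>X \<circ> K\<close> is \<open>chi\<close>, which is injective, so
      \<open>K\<close> is injective as well. Both sides are plane domains, so invariance of domain
      makes the sheet open.\<close>
    have "inj_on K sq"
      by (rule inj_onI) (metis XK co_chi)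
    then have "open (K ` sq)"
      by (intro invariance_of_domain Kc) (simp add: open_Times)
    moreover have "S ` ?U = K ` sq"
      unfolding image_image S_def by (rule image_cong) (simp_all add: co_chi)
    ultimately have "open (S ` ?U)" by simp
    moreover have "S (X z) = z" using l(1,2) z0 by (simp add: S_def K_def)
    ultimately show ?thesis using Sc XS by blast
  qed
  moreover have "m \<in> ?U" using b center by blast
  ultimately show "\<exists>U. open U \<and> m \<in> U \<and> connected U \<and>
      (\<forall>z. X z \<in> U \<longrightarrow> (\<exists>S. continuous_on U S \<and> (\<forall>m\<in>U. X (S m) = m) \<and> S (X z) = z \<and> open (S ` U)))"
    using box_open by blast
qed

lemma d1_base: "d1 r v = ev v" "unit_tangent r v = ev v"
  using vector_derivative_at[OF r'[of v]] frame_base(1)[of v] by (simp_all add: d1_def unit_tangent_def)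

lemma parametrization:
  "regular_curve r" "rotation_minimizing_frame r q1 q2" "unit_speed_plane_curve x y"
proof -
  have "ev v \<noteq> 0" for v using frame_base(1)[of v] by auto
  then show "regular_curve r" by (simp add: regular_curve_def base_smooth d1_base)
  have "\<exists>k. d1 q1 v = k *\<^sub>R ev v" "\<exists>k. d1 q2 v = k *\<^sub>R ev v" for v
    using vector_derivative_at[OF q_deriv(1)[of v]] vector_derivative_at[OF q_deriv(2)[of v]] by (auto simp: d1_def)
  then show "rotation_minimizing_frame r q1 q2"
    unfolding rotation_minimizing_frame_def d1_base using base_smooth frame_base by blast
  show "unit_speed_plane_curve x y" by (simp add: unit_speed_plane_curve_def xy_smooth unit_speed_xy)
qed

end

theorem mainTheorem3:
  fixes f :: "'m::{t2_space, second_countable_topology} \<Rightarrow> real^3"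
    and F :: "'m set set"
  assumes "immersed_surface f"
    and "connected (UNIV :: 'm set)"
    and "orientable f"
    and "complete_surface f"
    and "planar_geodesic_foliation f F"
  shows "\<exists>(X :: real \<times> real \<Rightarrow> 'm) (r :: real \<Rightarrow> real^3) q1 q2 (x :: real \<Rightarrow> real) y.
           regular_curve r \<and> rotation_minimizing_frame r q1 q2 \<and>
           unit_speed_plane_curve x y \<and>
           (\<forall>u v. f (X (u, v)) = r v + x u *\<^sub>R q1 v + y u *\<^sub>R q2 v) \<and>
           (\<forall>v. X ` (UNIV \<times> {v}) \<in> F) \<and>
           covering_space UNIV X UNIV \<and>
           curvature_line_coordinates (f \<circ> X)"
proof -
  obtain N where "unit_normal f N" using assms(3) by (auto simp: orientable_def)
  then interpret pgf f F N using assms by unfold_locales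
  \<comment> \<open>Any base point with either of its two directions will do; the direction is then
    carried along the base trajectory.\<close>
  obtain p0 :: 'm and e0 where "dir p0 e0" using dir_exists by blast
  then interpret strip f F N p0 e0 by unfold_locales
  show ?thesis
    using parametrization X_formula X_image covering curvature_line by blast
qed

end
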